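(* Consider the Brusselator system on the unit sphere, with parameters $E>0$, $\tau>0$, $0<f<1$, $$\frac{\partial u}{\partial t}=\varepsilon^2\Delta_S u+\varepsilon^2E-u+fu^2v,\qquad \tau\frac{\partial v}{\partial t}=\Delta_S v+\varepsilon^{-2}(u-u^2v),$$ and let $\varepsilon\to0$, $\nu=-1/\log\varepsilon$. Consider an $N$-spot quasi-equilibrium pattern, in the sense of matched asymptotic expansions defined in the context, with spots centered at $\mathbf{x}_j=(\cos\phi_j\sin\theta_j,\sin\phi_j\sin\theta_j,\cos\theta_j)^T$, $j=1,\dots,N$. Provided that there are no $\mathcal{O}(1)$ time-scale instabilities of the quasi-equilibrium spot pattern, the spot locations vary on the slow time-scale $\sigma=\varepsilon^2t$ and satisfy the differential algebraic system $$\frac{d\theta_j}{d\sigma}=-\frac{2}{\mathcal{A}_j}\alpha_1(\mathbf{x}_j),\qquad \sin\theta_j\frac{d\phi_j}{d\sigma}=-\frac{2}{\mathcal{A}_j}\alpha_2(\mathbf{x}_j),\qquad j=1,\dots,N,$$ where $\mathcal{A}_j=\mathcal{A}(S_j;f)$ and, with $L_i(\mathbf{x})=\log|\mathbf{x}-\mathbf{x}_i|$, $$\begin{pmatrix}\alpha_1(\mathbf{x}_j)\\ \alpha_2(\mathbf{x}_j)\end{pmatrix}=\sum_{i\ne j}S_i\begin{pmatrix}\partial_\theta L_i\\ \frac{1}{\sin\theta_j}\partial_\phi L_i\end{pmatrix}\Bigg|_{\phi=\phi_j,\,\theta=\theta_j},$$ and the spot strengths $\mathbf{S}=(S_1,\dots,S_N)^T$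 are coupled to the slow dynamics by the nonlinear algebraic system $$\bigl[I-\nu(I-\mathcal{E}_0)\mathcal{G}\bigr]\mathbf{S}+\nu(I-\mathcal{E}_0)\boldsymbol{\chi}(\mathbf{S})-\frac{2E}{N}\mathbf{e}=\mathbf{0}.$$
   Context: $\Delta_S=\frac{1}{\sin^2\theta}\partial_\phi^2+\frac1{\sin\theta}\partial_\theta(\sin\theta\,\partial_\theta)$ is the surface Laplacian of the unit sphere, with $\mathbf{x}=(\cos\phi\sin\theta,\sin\phi\sin\theta,\cos\theta)^T$; spot centers are distinct with $\theta_j\in(0,\pi)$. Core problem. For a spot strength $S_j$, the radially symmetric functions $U_{j0}(\rho),V_{j0}(\rho)$ solve on $0<\rho<\infty$, with $\Delta_\rho=\partial_{\rho\rho}+\rho^{-1}\partial_\rho$, $$\Delta_\rho U_{j0}-U_{j0}+fU_{j0}^2V_{j0}=0,\quad \Delta_\rho V_{j0}+U_{j0}-U_{j0}^2V_{j0}=0,$$ $U_{j0}'(0)=V_{j0}'(0)=0$, $U_{j0}\to0$ (exponentially), $V_{j0}\sim S_j\log\rho+\chi(S_j)+o(1)$ as $\rho\to\infty$; this defines $\chi(S_j)=\chi(S_j;f)$. Matrices. $I$ is the $N\times N$ identity, $(\mathcal{E}_0)_{ij}=1/N$, $\mathcal{G}_{ij}=\log|\mathbf{x}_i-\mathbf{x}_j|$ for $i\ne j$, $\mathcal{G}_{ii}=0$, $\mathbf{e}=(1,\dots,1)^T$, $(\boldsymbol\chi(\mathbf{S}))_i=\chi(S_i)$. The function $\mathcal{A}$.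 Let $$\mathcal{M}_j=\begin{pmatrix}-1+2fU_{j0}V_{j0}&fU_{j0}^2\\ 1-2U_{j0}V_{j0}&-U_{j0}^2\end{pmatrix}$$ and let $\mathbf{P}=(P_1,P_2)^T$ be the solution, regular at $\rho=0$, of $\Delta_\rho\mathbf{P}-\rho^{-2}\mathbf{P}+\mathcal{M}_j^T\mathbf{P}=0$ with $\mathbf{P}\sim(1/\rho,1/\rho)^T$ as $\rho\to\infty$. Then $\mathcal{A}_j=\mathcal{A}(S_j;f)=\int_0^\infty U_{j0}'(\rho)P_1(\rho)\rho\,d\rho$, assumed nonzero. Matched asymptotic quasi-equilibrium pattern. The spot centers are $\mathbf{x}_j=\mathbf{x}_j(\sigma)$, $\sigma=\varepsilon^2t$, and the following hold, where terms in $\log\varepsilon$ are retained and matching is imposed separately at orders $\varepsilon^0$ and $\varepsilon^1$. (Inner) Near $\mathbf{x}_j$, with $s_1=\varepsilon^{-1}(\theta-\theta_j(\sigma))$, $s_2=\varepsilon^{-1}\sin\theta_j(\phi-\phi_j(\sigma))$, $\mathbf{s}=(s_1,s_2)^T$, $\rho=|\mathbf{s}|$, one has $u=U_{j0}(\rho)+\varepsilon U_{j1}(\mathbf{s},\sigma)+\cdots$, $v=V_{j0}(\rho)+\varepsilon V_{j1}(\mathbf{s},\sigma)+\cdots$, where $(U_{j0},V_{j0})$ solves the core problem with strength $S_j$, and the order-$\varepsilon$ terms of the PDE give, on $\mathbb{R}^2$, with $\mathbf{U}_{jk}=(U_{jk},V_{jk})^T$ and $\Delta_{\mathbf{s}}=\partial_{s_1}^2+\partial_{s_2}^2$,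 $$\Delta_{\mathbf{s}}\mathbf{U}_{j1}+\mathcal{M}_j\mathbf{U}_{j1}=-\cot\theta_j\bigl(\partial_{s_1}-2s_1\partial_{s_2}^2\bigr)\mathbf{U}_{j0}-\begin{pmatrix}\bigl(\theta_j'\partial_{s_1}+\phi_j'\sin\theta_j\,\partial_{s_2}\bigr)U_{j0}\\0\end{pmatrix},$$ where $'=d/d\sigma$ on $\theta_j,\phi_j$. (Outer) Away from the spots $u\sim\varepsilon^2E$, and $v$ satisfies $\Delta_Sv=-E+2\pi\sum_{i=1}^NS_i\delta(\mathbf{x}-\mathbf{x}_i)$ on the sphere, so that $\sum_iS_i=2E$ and $v=\sum_iS_i\log|\mathbf{x}-\mathbf{x}_i|+\text{const}$, where the constant may depend on $\varepsilon$. (Matching) For each $j$, the expansion of the outer $v$ as $\mathbf{x}\to\mathbf{x}_j$, written in the variable $\mathbf{s}$ through terms of order $\varepsilon$, agrees with the behavior as $\rho\to\infty$ of $V_{j0}+\varepsilon V_{j1}$, and $U_{j1}\to0$ as $\rho\to\infty$; these far-field relations may be differentiated. An $\mathcal{O}(1)$ time-scale instability means that the linearization of the PDE about the quasi-equilibrium pattern (with spot locations frozen) has, as $\varepsilon\to0$, an eigenvalue $\lambda=\mathcal{O}(1)$ with $\mathrm{Re}\,\lambda>0$ (perturbations proportional to $e^{\lambda t}$). *)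

theory Defs
  imports "HOL-Analysis.Analysis"
begin

section \<open>Calculus conventions\<close>

definition C2_fun :: "('a::real_normed_vector \<Rightarrow> 'b::real_normed_vector) \<Rightarrow> bool" where
  "C2_fun g \<longleftrightarrow>
     (\<exists>(D :: 'a \<Rightarrow> 'a \<Rightarrow>\<^sub>L 'b) (D2 :: 'a \<Rightarrow> 'a \<Rightarrow>\<^sub>L ('a \<Rightarrow>\<^sub>L 'b)).
        (\<forall>x. (g has_derivative blinfun_apply (D x)) (at x)) \<and>
        (\<forall>x. (D has_derivative blinfun_apply (D2 x)) (at x)) \<and>
        continuous_on UNIV D2)"

definition d1 :: "(real \<times> real \<Rightarrow> real) \<Rightarrow> real \<times> real \<Rightarrow> real" where
  "d1 g s = deriv (\<lambda>a. g (a, snd s)) (fst s)"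

definition d2 :: "(real \<times> real \<Rightarrow> real) \<Rightarrow> real \<times> real \<Rightarrow> real" where
  "d2 g s = deriv (\<lambda>b. g (fst s, b)) (snd s)"

definition lap2 :: "(real \<times> real \<Rightarrow> real) \<Rightarrow> real \<times> real \<Rightarrow> real" where
  "lap2 g s = d1 (d1 g) s + d2 (d2 g) s"

definition radial_lap :: "(real \<Rightarrow> real) \<Rightarrow> real \<Rightarrow> real" where
  "radial_lap g \<rho> = deriv (deriv g) \<rho> + deriv g \<rho> / \<rho>"

definition twice_diff_pos :: "(real \<Rightarrow> real) \<Rightarrow> bool" where
  "twice_diff_pos g \<longleftrightarrow>
     (\<forall>\<rho>>0. g field_differentiable (at \<rho>) \<and> deriv g field_differentiable (at \<rho>))"

text \<open>Functions on the unit sphere are functions on \<open>real^3\<close> of which only the values at the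
  points \<open>sph \<theta> \<phi>\<close> matter; \<open>lapS\<close> is the surface Laplacian at the point with
  angles \<open>\<theta>\<close>, \<open>\<phi>\<close>, meaningful for \<open>0 < \<theta> < pi\<close>.\<close>

definition sph :: "real \<Rightarrow> real \<Rightarrow> real^3" where
  "sph \<theta> \<phi> = vector [cos \<phi> * sin \<theta>, sin \<phi> * sin \<theta>, cos \<theta>]"

definition lapS :: "(real^3 \<Rightarrow> 'a::real_normed_vector) \<Rightarrow> real \<Rightarrow> real \<Rightarrow> 'a" where
  "lapS g \<theta> \<phi> =
     (1 / (sin \<theta>)^2) *\<^sub>R
        vector_derivative (\<lambda>p. vector_derivative (\<lambda>q. g (sph \<theta> q)) (at p)) (at \<phi>) +
     (1 / sin \<theta>) *\<^sub>R
        vector_derivative (\<lambda>p. sin p *\<^sub>R vector_derivative (\<lambda>q. g (sph q \<phi>)) (at p)) (at \<theta>)"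

definition sphere_integral :: "(real \<Rightarrow> real \<Rightarrow> real) \<Rightarrow> real" where
  "sphere_integral F =
     set_lebesgue_integral lborel ({0<..<pi} \<times> {0<..<2*pi}) (\<lambda>(\<theta>, \<phi>). F \<theta> \<phi> * sin \<theta>)"


section \<open>The Brusselator and its linearization\<close>

text \<open>The system is \<open>\<partial>u/\<partial>t = brus_u\<close>, \<open>\<tau> \<partial>v/\<partial>t = brus_v\<close>.
  The right-hand sides are polymorphic so that they can be evaluated both at real fields and at
  complex perturbations of them.\<close>

definition brus_u ::
  "real \<Rightarrow> real \<Rightarrow> real \<Rightarrow> (real^3 \<Rightarrow> 'a::real_normed_field) \<Rightarrow> (real^3 \<Rightarrow> 'a)
     \<Rightarrow> real \<Rightarrow> real \<Rightarrow> 'a" where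
  "brus_u E f \<epsilon> u v \<theta> \<phi> =
     of_real (\<epsilon>^2) * lapS u \<theta> \<phi> + of_real (\<epsilon>^2 * E) - u (sph \<theta> \<phi>)
       + of_real f * (u (sph \<theta> \<phi>))^2 * v (sph \<theta> \<phi>)"

definition brus_v ::
  "real \<Rightarrow> (real^3 \<Rightarrow> 'a::real_normed_field) \<Rightarrow> (real^3 \<Rightarrow> 'a) \<Rightarrow> real \<Rightarrow> real \<Rightarrow> 'a" where
  "brus_v \<epsilon> u v \<theta> \<phi> =
     lapS v \<theta> \<phi>
       + of_real (1 / \<epsilon>^2) * (u (sph \<theta> \<phi>) - (u (sph \<theta> \<phi>))^2 * v (sph \<theta> \<phi>))"

text \<open>Residuals of the two equations for time-dependent fields \<open>u t x\<close>, \<open>v t x\<close>.\<close>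

definition residual_u ::
  "real \<Rightarrow> real \<Rightarrow> real \<Rightarrow> (real \<Rightarrow> real^3 \<Rightarrow> real) \<Rightarrow> (real \<Rightarrow> real^3 \<Rightarrow> real)
     \<Rightarrow> real \<Rightarrow> real \<Rightarrow> real \<Rightarrow> real" where
  "residual_u E f \<epsilon> u v t \<theta> \<phi> =
     deriv (\<lambda>r. u r (sph \<theta> \<phi>)) t - brus_u E f \<epsilon> (u t) (v t) \<theta> \<phi>"

definition residual_v ::
  "real \<Rightarrow> real \<Rightarrow> (real \<Rightarrow> real^3 \<Rightarrow> real) \<Rightarrow> (real \<Rightarrow> real^3 \<Rightarrow> real)
     \<Rightarrow> real \<Rightarrow> real \<Rightarrow> real \<Rightarrow> real" where
  "residual_v \<tau> \<epsilon> u v t \<theta> \<phi> =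
     \<tau> * deriv (\<lambda>r. v r (sph \<theta> \<phi>)) t - brus_v \<epsilon> (u t) (v t) \<theta> \<phi>"

definition linearization_eigenvalue ::
  "real \<Rightarrow> real \<Rightarrow> real \<Rightarrow> real \<Rightarrow> (real^3 \<Rightarrow> real) \<Rightarrow> (real^3 \<Rightarrow> real) \<Rightarrow> complex \<Rightarrow> bool" where
  "linearization_eigenvalue E \<tau> f \<epsilon> u v \<mu> \<longleftrightarrow>
     (\<exists>(\<Phi> :: real^3 \<Rightarrow> complex) (\<Psi> :: real^3 \<Rightarrow> complex).
        C2_fun \<Phi> \<and> C2_fun \<Psi> \<and> (\<exists>x\<in>sphere 0 1. \<Phi> x \<noteq> 0 \<or> \<Psi> x \<noteq> 0) \<and>
        (\<forall>\<theta>\<in>{0<..<pi}. \<forall>\<phi>.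
           \<mu> * \<Phi> (sph \<theta> \<phi>) =
             deriv (\<lambda>h. brus_u E f \<epsilon> (\<lambda>x. of_real (u x) + h * \<Phi> x)
                                        (\<lambda>x. of_real (v x) + h * \<Psi> x) \<theta> \<phi>) 0 \<and>
           of_real \<tau> * \<mu> * \<Psi> (sph \<theta> \<phi>) =
             deriv (\<lambda>h. brus_v \<epsilon> (\<lambda>x. of_real (u x) + h * \<Phi> x)
                                     (\<lambda>x. of_real (v x) + h * \<Psi> x) \<theta> \<phi>) 0))"

text \<open>Instability on the \<open>O(1)\<close> time scale of a family of patterns indexed by \<open>\<epsilon>\<close>. The real part
  is kept away from zero: growth rates that vanish with \<open>\<epsilon>\<close> act on longer time scales.\<close>

definition O1_instability ::
  "real \<Rightarrow> real \<Rightarrow> real \<Rightarrow> (real \<Rightarrow> real^3 \<Rightarrow> real) \<Rightarrow> (real \<Rightarrow> real^3 \<Rightarrow> real) \<Rightarrow> bool" where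
  "O1_instability E \<tau> f u v \<longleftrightarrow>
     (\<exists>(\<mu> :: real \<Rightarrow> complex) c C. 0 < c \<and>
        (\<forall>\<^sub>F \<epsilon> in at_right 0.
           linearization_eigenvalue E \<tau> f \<epsilon> (u \<epsilon>) (v \<epsilon>) (\<mu> \<epsilon>) \<and>
           c \<le> Re (\<mu> \<epsilon>) \<and> cmod (\<mu> \<epsilon>) \<le> C))"


section \<open>The core problem and the function A\<close>

definition core_solution ::
  "real \<Rightarrow> real \<Rightarrow> (real \<Rightarrow> real) \<Rightarrow> (real \<Rightarrow> real) \<Rightarrow> real \<Rightarrow> bool" where
  "core_solution f S U V c \<longleftrightarrow>
     twice_diff_pos U \<and> twice_diff_pos V \<and>
     (\<forall>\<rho>>0. radial_lap U \<rho> - U \<rho> + f * (U \<rho>)^2 * V \<rho> = 0 \<and>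
            radial_lap V \<rho> + U \<rho> - (U \<rho>)^2 * V \<rho> = 0) \<and>
     (U has_real_derivative 0) (at 0 within {0..}) \<and>
     (V has_real_derivative 0) (at 0 within {0..}) \<and>
     (\<exists>a>0. \<exists>C. \<forall>\<rho>\<ge>0. \<bar>U \<rho>\<bar> \<le> C * exp (- a * \<rho>)) \<and>
     ((\<lambda>\<rho>. V \<rho> - S * ln \<rho>) \<longlongrightarrow> c) at_top"

definition core_matrix ::
  "real \<Rightarrow> (real \<Rightarrow> real) \<Rightarrow> (real \<Rightarrow> real) \<Rightarrow> real \<Rightarrow> real^2^2" where
  "core_matrix f U V \<rho> =
     vector [vector [- 1 + 2 * f * U \<rho> * V \<rho>, f * (U \<rho>)^2],
             vector [1 - 2 * U \<rho> * V \<rho>, - ((U \<rho>)^2)]]"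

text \<open>Regularity at the origin is one-sided differentiability, as for the core solution.\<close>

definition adjoint_solution ::
  "real \<Rightarrow> (real \<Rightarrow> real) \<Rightarrow> (real \<Rightarrow> real) \<Rightarrow> (real \<Rightarrow> real) \<Rightarrow> (real \<Rightarrow> real) \<Rightarrow> bool" where
  "adjoint_solution f U V P1 P2 \<longleftrightarrow>
     twice_diff_pos P1 \<and> twice_diff_pos P2 \<and>
     (\<forall>\<rho>>0.
        vector [radial_lap P1 \<rho> - P1 \<rho> / \<rho>^2, radial_lap P2 \<rho> - P2 \<rho> / \<rho>^2]
          + transpose (core_matrix f U V \<rho>) *v vector [P1 \<rho>, P2 \<rho>] = (0 :: real^2)) \<and>
     P1 differentiable (at 0 within {0..}) \<and> P2 differentiable (at 0 within {0..}) \<and>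
     ((\<lambda>\<rho>. \<rho> * P1 \<rho>) \<longlongrightarrow> 1) at_top \<and> ((\<lambda>\<rho>. \<rho> * P2 \<rho>) \<longlongrightarrow> 1) at_top"

text \<open>Uniqueness of the core and adjoint solutions for a given strength is not presupposed: a
  \<open>core_branch\<close> selects, as functions of the strength, the solutions that all spots of
  the pattern use, and thereby determines \<open>\<chi>(S)\<close> and \<open>A(S)\<close>.\<close>

record core_branch =
  core_U :: "real \<Rightarrow> real \<Rightarrow> real"
  core_V :: "real \<Rightarrow> real \<Rightarrow> real"
  core_chi :: "real \<Rightarrow> real"
  core_P1 :: "real \<Rightarrow> real \<Rightarrow> real"
  core_P2 :: "real \<Rightarrow> real \<Rightarrow> real"

definition core_branch_at :: "real \<Rightarrow> core_branch \<Rightarrow> real \<Rightarrow> bool" where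
  "core_branch_at f K S \<longleftrightarrow>
     core_solution f S (core_U K S) (core_V K S) (core_chi K S) \<and>
     adjoint_solution f (core_U K S) (core_V K S) (core_P1 K S) (core_P2 K S)"

definition core_A :: "core_branch \<Rightarrow> real \<Rightarrow> real" where
  "core_A K S =
     set_lebesgue_integral lborel {0<..} (\<lambda>\<rho>. deriv (core_U K S) \<rho> * core_P1 K S \<rho> * \<rho>)"


section \<open>Matched asymptotic quasi-equilibrium patterns\<close>

text \<open>The coefficients of the expansions in powers of \<open>\<epsilon>\<close> retain all logarithms of \<open>\<epsilon>\<close>, so
  they, too, carry the argument \<open>\<epsilon>\<close>. The argument \<open>\<sigma>\<close> is the slow time \<open>\<epsilon>^2 t\<close>. Argument order:
  \<open>\<epsilon>\<close>, spot, \<open>\<sigma>\<close> for quantities that belong to a spot and \<open>\<epsilon>\<close>, \<open>\<sigma>\<close> for the others. The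
  additive constant of the outer solution is \<open>pat_c0 + \<epsilon> * pat_c1\<close>.\<close>

record 'n spot_pattern =
  pat_theta :: "real \<Rightarrow> 'n \<Rightarrow> real \<Rightarrow> real"
  pat_phi :: "real \<Rightarrow> 'n \<Rightarrow> real \<Rightarrow> real"
  pat_S :: "real \<Rightarrow> 'n \<Rightarrow> real \<Rightarrow> real"
  pat_U1 :: "real \<Rightarrow> 'n \<Rightarrow> real \<Rightarrow> real \<times> real \<Rightarrow> real"
  pat_V1 :: "real \<Rightarrow> 'n \<Rightarrow> real \<Rightarrow> real \<times> real \<Rightarrow> real"
  pat_outer_v :: "real \<Rightarrow> real \<Rightarrow> real^3 \<Rightarrow> real"
  pat_c0 :: "real \<Rightarrow> real \<Rightarrow> real"
  pat_c1 :: "real \<Rightarrow> real \<Rightarrow> real"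
  pat_u :: "real \<Rightarrow> real \<Rightarrow> real^3 \<Rightarrow> real"
  pat_v :: "real \<Rightarrow> real \<Rightarrow> real^3 \<Rightarrow> real"

definition pat_x :: "'n spot_pattern \<Rightarrow> real \<Rightarrow> 'n \<Rightarrow> real \<Rightarrow> real^3" where
  "pat_x Q \<epsilon> j \<sigma> = sph (pat_theta Q \<epsilon> j \<sigma>) (pat_phi Q \<epsilon> j \<sigma>)"

definition pat_U0 :: "core_branch \<Rightarrow> 'n spot_pattern \<Rightarrow> real \<Rightarrow> 'n \<Rightarrow> real \<Rightarrow> real \<times> real \<Rightarrow> real" where
  "pat_U0 K Q \<epsilon> j \<sigma> s = core_U K (pat_S Q \<epsilon> j \<sigma>) (norm s)"

definition pat_V0 :: "core_branch \<Rightarrow> 'n spot_pattern \<Rightarrow> real \<Rightarrow> 'n \<Rightarrow> real \<Rightarrow> real \<times> real \<Rightarrow> real" where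
  "pat_V0 K Q \<epsilon> j \<sigma> s = core_V K (pat_S Q \<epsilon> j \<sigma>) (norm s)"

text \<open>Angles of the point with inner coordinates \<open>s\<close> at the \<open>j\<close>-th spot. The scale \<open>\<eta>\<close> is
  separate from \<open>\<epsilon>\<close> so that a limit in the scale can be taken with the coefficients, and the
  logarithms of \<open>\<epsilon>\<close> in them, held fixed.\<close>

definition local_theta :: "'n spot_pattern \<Rightarrow> real \<Rightarrow> 'n \<Rightarrow> real \<Rightarrow> real \<Rightarrow> real \<times> real \<Rightarrow> real" where
  "local_theta Q \<epsilon> j \<sigma> \<eta> s = pat_theta Q \<epsilon> j \<sigma> + \<eta> * fst s"

definition local_phi :: "'n spot_pattern \<Rightarrow> real \<Rightarrow> 'n \<Rightarrow> real \<Rightarrow> real \<Rightarrow> real \<times> real \<Rightarrow> real" where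
  "local_phi Q \<epsilon> j \<sigma> \<eta> s = pat_phi Q \<epsilon> j \<sigma> + \<eta> * snd s / sin (pat_theta Q \<epsilon> j \<sigma>)"

definition local_point :: "'n spot_pattern \<Rightarrow> real \<Rightarrow> 'n \<Rightarrow> real \<Rightarrow> real \<Rightarrow> real \<times> real \<Rightarrow> real^3" where
  "local_point Q \<epsilon> j \<sigma> \<eta> s = sph (local_theta Q \<epsilon> j \<sigma> \<eta> s) (local_phi Q \<epsilon> j \<sigma> \<eta> s)"

definition outer_log ::
  "'n::finite spot_pattern \<Rightarrow> real \<Rightarrow> real \<Rightarrow> real \<Rightarrow> real^3 \<Rightarrow> real" where
  "outer_log Q \<epsilon> \<sigma> \<eta> x =
     (\<Sum>i\<in>UNIV. pat_S Q \<epsilon> i \<sigma> * ln (norm (x - pat_x Q \<epsilon> i \<sigma>))) + pat_c0 Q \<epsilon> \<sigma> + \<eta> * pat_c1 Q \<epsilon> \<sigma>"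

definition pattern_geometry :: "real \<Rightarrow> real set \<Rightarrow> 'n::finite spot_pattern \<Rightarrow> bool" where
  "pattern_geometry \<epsilon>\<^sub>0 J Q \<longleftrightarrow>
     (\<forall>\<epsilon>\<in>{0<..<\<epsilon>\<^sub>0}. \<forall>\<sigma>\<in>J.
        inj (\<lambda>j. pat_x Q \<epsilon> j \<sigma>) \<and>
        (\<forall>j. pat_theta Q \<epsilon> j \<sigma> \<in> {0<..<pi} \<and>
             pat_theta Q \<epsilon> j field_differentiable (at \<sigma>) \<and>
             pat_phi Q \<epsilon> j field_differentiable (at \<sigma>)))"

text \<open>The first part consists of the order-one and order-\<open>\<epsilon>\<close> inner problems; the second part says
  that the fields have the corresponding two-term expansion and satisfy the Brusselator through
  order \<open>\<epsilon>\<close> (the equation for \<open>v\<close> multiplied by \<open>\<epsilon>^2\<close>).\<close>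

definition inner_expansion ::
  "real \<Rightarrow> real \<Rightarrow> real \<Rightarrow> real \<Rightarrow> real set \<Rightarrow> core_branch \<Rightarrow> 'n::finite spot_pattern \<Rightarrow> bool" where
  "inner_expansion E \<tau> f \<epsilon>\<^sub>0 J K Q \<longleftrightarrow>
     (\<forall>\<epsilon>\<in>{0<..<\<epsilon>\<^sub>0}. \<forall>\<sigma>\<in>J. \<forall>j.
        core_branch_at f K (pat_S Q \<epsilon> j \<sigma>) \<and>
        C2_fun (pat_U1 Q \<epsilon> j \<sigma>) \<and> C2_fun (pat_V1 Q \<epsilon> j \<sigma>) \<and>
        (let \<theta>j = pat_theta Q \<epsilon> j \<sigma>;
             \<theta>' = deriv (pat_theta Q \<epsilon> j) \<sigma>;
             \<phi>' = deriv (pat_phi Q \<epsilon> j) \<sigma>;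
             U0 = pat_U0 K Q \<epsilon> j \<sigma>;
             V0 = pat_V0 K Q \<epsilon> j \<sigma>;
             U1 = pat_U1 Q \<epsilon> j \<sigma>;
             V1 = pat_V1 Q \<epsilon> j \<sigma>;
             M = core_matrix f (core_U K (pat_S Q \<epsilon> j \<sigma>)) (core_V K (pat_S Q \<epsilon> j \<sigma>))
         in \<forall>s. (vector [lap2 U1 s, lap2 V1 s] :: real^2) + M (norm s) *v vector [U1 s, V1 s] =
                - cot \<theta>j *\<^sub>R vector [d1 U0 s - 2 * fst s * d2 (d2 U0) s,
                                 d1 V0 s - 2 * fst s * d2 (d2 V0) s]
                - vector [\<theta>' * d1 U0 s + \<phi>' * sin \<theta>j * d2 U0 s, 0])) \<and>
     (\<forall>\<epsilon>\<in>{0<..<\<epsilon>\<^sub>0}. \<forall>\<sigma>\<in>J. C2_fun (pat_u Q \<epsilon> \<sigma>) \<and> C2_fun (pat_v Q \<epsilon> \<sigma>) \<and>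
        (\<forall>x. (\<lambda>r. pat_u Q \<epsilon> r x) field_differentiable (at \<sigma>) \<and>
             (\<lambda>r. pat_v Q \<epsilon> r x) field_differentiable (at \<sigma>))) \<and>
     (\<forall>\<sigma>\<in>J. \<forall>j s.
        ((\<lambda>\<epsilon>. (pat_u Q \<epsilon> \<sigma> (local_point Q \<epsilon> j \<sigma> \<epsilon> s)
                - (pat_U0 K Q \<epsilon> j \<sigma> s + \<epsilon> * pat_U1 Q \<epsilon> j \<sigma> s)) / \<epsilon>) \<longlongrightarrow> 0) (at_right 0) \<and>
        ((\<lambda>\<epsilon>. (pat_v Q \<epsilon> \<sigma> (local_point Q \<epsilon> j \<sigma> \<epsilon> s)
                - (pat_V0 K Q \<epsilon> j \<sigma> s + \<epsilon> * pat_V1 Q \<epsilon> j \<sigma> s)) / \<epsilon>) \<longlongrightarrow> 0) (at_right 0) \<and>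
        ((\<lambda>\<epsilon>. residual_u E f \<epsilon> (\<lambda>t. pat_u Q \<epsilon> (\<epsilon>^2 * t)) (\<lambda>t. pat_v Q \<epsilon> (\<epsilon>^2 * t)) (\<sigma> / \<epsilon>^2)
                (local_theta Q \<epsilon> j \<sigma> \<epsilon> s) (local_phi Q \<epsilon> j \<sigma> \<epsilon> s) / \<epsilon>) \<longlongrightarrow> 0) (at_right 0) \<and>
        ((\<lambda>\<epsilon>. \<epsilon>^2 * residual_v \<tau> \<epsilon> (\<lambda>t. pat_u Q \<epsilon> (\<epsilon>^2 * t)) (\<lambda>t. pat_v Q \<epsilon> (\<epsilon>^2 * t)) (\<sigma> / \<epsilon>^2)
                (local_theta Q \<epsilon> j \<sigma> \<epsilon> s) (local_phi Q \<epsilon> j \<sigma> \<epsilon> s) / \<epsilon>) \<longlongrightarrow> 0) (at_right 0))"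

text \<open>The outer equation \<open>\<Delta>v = - E + 2 pi (\<Sum>i. S\<^sub>i \<delta>(x - x\<^sub>i))\<close> is meant in the sense of
  distributions on the sphere.\<close>

definition outer_expansion ::
  "real \<Rightarrow> real \<Rightarrow> real \<Rightarrow> real \<Rightarrow> real set \<Rightarrow> 'n::finite spot_pattern \<Rightarrow> bool" where
  "outer_expansion E \<tau> f \<epsilon>\<^sub>0 J Q \<longleftrightarrow>
     (\<forall>\<epsilon>\<in>{0<..<\<epsilon>\<^sub>0}. \<forall>\<sigma>\<in>J.
        (\<forall>g :: real^3 \<Rightarrow> real. C2_fun g \<longrightarrow>
           sphere_integral (\<lambda>\<theta> \<phi>. pat_outer_v Q \<epsilon> \<sigma> (sph \<theta> \<phi>) * lapS g \<theta> \<phi>) =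
             - E * sphere_integral (\<lambda>\<theta> \<phi>. g (sph \<theta> \<phi>))
             + 2 * pi * (\<Sum>i\<in>UNIV. pat_S Q \<epsilon> i \<sigma> * g (pat_x Q \<epsilon> i \<sigma>))) \<and>
        (\<forall>x \<in> sphere 0 1 - range (\<lambda>j. pat_x Q \<epsilon> j \<sigma>).
           pat_outer_v Q \<epsilon> \<sigma> x = outer_log Q \<epsilon> \<sigma> \<epsilon> x)) \<and>
     (\<forall>\<sigma>\<in>J. \<forall>\<delta>>0. \<forall>r>0. \<forall>\<^sub>F \<epsilon> in at_right 0.
        (\<forall>x\<in>sphere 0 1. (\<forall>j. \<delta> \<le> norm (x - pat_x Q \<epsilon> j \<sigma>)) \<longrightarrow>
           \<bar>pat_u Q \<epsilon> \<sigma> x / (\<epsilon>^2 * E) - 1\<bar> \<le> r \<and>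
           \<bar>pat_v Q \<epsilon> \<sigma> x - pat_outer_v Q \<epsilon> \<sigma> x\<bar> \<le> r * \<epsilon>) \<and>
        (\<forall>\<theta>\<in>{0<..<pi}. \<forall>\<phi>. (\<forall>j. \<delta> \<le> norm (sph \<theta> \<phi> - pat_x Q \<epsilon> j \<sigma>)) \<longrightarrow>
           \<bar>residual_u E f \<epsilon> (\<lambda>t. pat_u Q \<epsilon> (\<epsilon>^2 * t)) (\<lambda>t. pat_v Q \<epsilon> (\<epsilon>^2 * t)) (\<sigma> / \<epsilon>^2) \<theta> \<phi>\<bar>
             \<le> r * \<epsilon>^2 \<and>
           \<bar>residual_v \<tau> \<epsilon> (\<lambda>t. pat_u Q \<epsilon> (\<epsilon>^2 * t)) (\<lambda>t. pat_v Q \<epsilon> (\<epsilon>^2 * t)) (\<sigma> / \<epsilon>^2) \<theta> \<phi>\<bar>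
             \<le> r))"

text \<open>Agreement at infinity up to \<open>o(w)\<close>, together with the differentiated relation.\<close>

definition far_field_agrees ::
  "(real \<times> real \<Rightarrow> real) \<Rightarrow> (real \<times> real \<Rightarrow> real) \<Rightarrow> (real \<times> real \<Rightarrow> real) \<Rightarrow> bool" where
  "far_field_agrees w g h \<longleftrightarrow>
     ((\<lambda>s. (g s - h s) / w s) \<longlongrightarrow> 0) at_infinity \<and>
     ((\<lambda>s. d1 g s - d1 h s) \<longlongrightarrow> 0) at_infinity \<and>
     ((\<lambda>s. d2 g s - d2 h s) \<longlongrightarrow> 0) at_infinity"

text \<open>\<open>S\<^sub>j * ln \<eta> + M0 s + \<eta> * M1 s\<close> is the expansion of the outer solution at the \<open>j\<close>-th spot in
  inner coordinates of scale \<open>\<eta>\<close>. At \<open>\<eta> = \<epsilon>\<close> the logarithm belongs to the order-one terms. The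
  order-\<open>\<epsilon>\<close> terms grow linearly at infinity and are compared up to \<open>o(\<rho>)\<close>.\<close>

definition matching ::
  "real \<Rightarrow> real set \<Rightarrow> core_branch \<Rightarrow> 'n::finite spot_pattern \<Rightarrow> bool" where
  "matching \<epsilon>\<^sub>0 J K Q \<longleftrightarrow>
     (\<forall>\<epsilon>\<in>{0<..<\<epsilon>\<^sub>0}. \<forall>\<sigma>\<in>J. \<forall>j. \<exists>M0 M1.
        (\<forall>s. s \<noteq> 0 \<longrightarrow>
           ((\<lambda>\<eta>. (outer_log Q \<epsilon> \<sigma> \<eta> (local_point Q \<epsilon> j \<sigma> \<eta> s)
                   - (pat_S Q \<epsilon> j \<sigma> * ln \<eta> + M0 s)) / \<eta>) \<longlongrightarrow> M1 s) (at_right 0)) \<and>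
        far_field_agrees (\<lambda>s. 1) (pat_V0 K Q \<epsilon> j \<sigma>) (\<lambda>s. pat_S Q \<epsilon> j \<sigma> * ln \<epsilon> + M0 s) \<and>
        far_field_agrees norm (pat_V1 Q \<epsilon> j \<sigma>) M1 \<and>
        far_field_agrees (\<lambda>s. 1) (pat_U1 Q \<epsilon> j \<sigma>) (\<lambda>s. 0))"

definition quasi_equilibrium_pattern ::
  "real \<Rightarrow> real \<Rightarrow> real \<Rightarrow> real \<Rightarrow> real set \<Rightarrow> core_branch \<Rightarrow> 'n::finite spot_pattern \<Rightarrow> bool" where
  "quasi_equilibrium_pattern E \<tau> f \<epsilon>\<^sub>0 J K Q \<longleftrightarrow>
     pattern_geometry \<epsilon>\<^sub>0 J Q \<and> inner_expansion E \<tau> f \<epsilon>\<^sub>0 J K Q \<and>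
     outer_expansion E \<tau> f \<epsilon>\<^sub>0 J Q \<and> matching \<epsilon>\<^sub>0 J K Q"


section \<open>The slow dynamics\<close>

definition alpha1 :: "'n::finite spot_pattern \<Rightarrow> real \<Rightarrow> 'n \<Rightarrow> real \<Rightarrow> real" where
  "alpha1 Q \<epsilon> j \<sigma> =
     (\<Sum>i\<in>UNIV - {j}. pat_S Q \<epsilon> i \<sigma> *
        deriv (\<lambda>\<theta>. ln (norm (sph \<theta> (pat_phi Q \<epsilon> j \<sigma>) - pat_x Q \<epsilon> i \<sigma>))) (pat_theta Q \<epsilon> j \<sigma>))"

definition alpha2 :: "'n::finite spot_pattern \<Rightarrow> real \<Rightarrow> 'n \<Rightarrow> real \<Rightarrow> real" where
  "alpha2 Q \<epsilon> j \<sigma> =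
     (\<Sum>i\<in>UNIV - {j}. pat_S Q \<epsilon> i \<sigma> * (1 / sin (pat_theta Q \<epsilon> j \<sigma>) *
        deriv (\<lambda>\<phi>. ln (norm (sph (pat_theta Q \<epsilon> j \<sigma>) \<phi> - pat_x Q \<epsilon> i \<sigma>))) (pat_phi Q \<epsilon> j \<sigma>)))"

definition avg_matrix :: "real^'n^'n::finite" where
  "avg_matrix = (\<chi> i j. 1 / real CARD('n))"

definition green_matrix :: "('n \<Rightarrow> real^3) \<Rightarrow> real^'n^'n::finite" where
  "green_matrix x = (\<chi> i j. if i = j then 0 else ln (norm (x i - x j)))"

definition strength_system ::
  "real \<Rightarrow> real \<Rightarrow> (real \<Rightarrow> real) \<Rightarrow> ('n \<Rightarrow> real^3) \<Rightarrow> real^'n::finite \<Rightarrow> bool" where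
  "strength_system E \<nu> chi x S \<longleftrightarrow>
     (mat 1 - \<nu> *\<^sub>R ((mat 1 - avg_matrix) ** green_matrix x)) *v S
       + \<nu> *\<^sub>R ((mat 1 - avg_matrix) *v (\<chi> i. chi (S $ i)))
       - (2 * E / real CARD('n)) *\<^sub>R (\<chi> i. 1) = 0"

end

theory Submission
  imports Defs
begin

text \<open>The dynamics come from the Fredholm alternative for the order-\<open>\<epsilon>\<close> inner problem. Its
  first angular harmonics satisfy radial equations, and Lagrange's identity with the adjoint
  solution \<open>P\<close> shows that \<open>\<rho> (P \<bullet> y' - P' \<bullet> y)\<close> has derivative
  \<open>- (\<theta>\<^sub>j' or \<phi>\<^sub>j' sin \<theta>\<^sub>j) \<rho> P\<^sub>1 U\<^sub>0'\<close> once the curvature terms are removed by an explicit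
  particular solution. That expression vanishes at the origin, and at infinity it tends to twice
  the gradient coefficient \<open>\<alpha>\<close> of the outer solution, since \<open>P\<^sub>2 \<sim> 1/\<rho>\<close> and the \<open>V\<close> component of
  \<open>y\<close> grows like \<open>\<alpha> \<rho>\<close>. Matching at order one gives
  \<open>\<chi>(S\<^sub>j) = S\<^sub>j log \<epsilon> + (G S)\<^sub>j + const\<close>; the projection \<open>I - E\<^sub>0\<close> eliminates the constant, and
  integrating the outer equation over the sphere fixes the sum of the strengths.\<close>


section \<open>Asymptotics of the core and adjoint solutions\<close>

text \<open>The data at infinity concern functions only (\<open>V - S ln \<rho>\<close> tends to
  \<open>c\<close>, \<open>\<rho> P\<close> tends to 1), and at the origin \<open>U\<close>,
  \<open>V\<close> and \<open>P\<close> are only known to be differentiable from the right, whereas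
  the Lagrange boundary term contains derivatives. These are recovered from the divergence form
  \<open>(\<rho> g')' = e\<close> of the equations, by mean values over an interval whose length is
  adapted to the decay of \<open>e\<close>. The delicate case is \<open>P\<^sub>1\<close>: its
  equation contains \<open>P\<^sub>1 - P\<^sub>2\<close>, which is \<open>o(1/\<rho>)\<close> with
  no better rate at hand. The factor 2 of the law of motion arises because
  \<open>P\<^sub>2 y\<^sub>2'\<close> and \<open>- P\<^sub>2' y\<^sub>2\<close> both contribute
  \<alpha>. Curvature leaves no trace in the law, because
  \<open>S\<^sub>j cot \<theta>\<^sub>j / 8\<close> occurs twice with opposite signs: once as the
  linear growth of the particular solution, once as the cosine harmonic of the term in
  \<open>s\<^sub>1 s\<^sub>2\<^sup>2 / \<rho>\<^sup>2\<close> that the logarithm of the chordal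
  distance adds to the far field.\<close>

lemma flux_bound:
  fixes g g' e :: "real \<Rightarrow> real"
  assumes a: "0 < a" and h: "0 < h" "h \<le> a"
    and g: "\<And>x. a \<le> x \<Longrightarrow> x \<le> a + h \<Longrightarrow> (g has_real_derivative g' x) (at x)"
    and flux: "\<And>x. a \<le> x \<Longrightarrow> x \<le> a + h \<Longrightarrow> ((\<lambda>x. x * g' x) has_real_derivative e x) (at x)"
    and e: "\<And>x. a \<le> x \<Longrightarrow> x \<le> a + h \<Longrightarrow> \<bar>e x\<bar> \<le> B"
  shows "\<bar>a * g' a\<bar> \<le> 2 * a / h * \<bar>g (a + h) - g a\<bar> + h * B"
proof -
  \<comment> \<open>At the mean-value point the flux is \<open>\<xi>\<close> times a difference
    quotient of \<open>g\<close>, and between \<open>a\<close> and \<open>\<xi>\<close> it varies by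
    at most \<open>h * B\<close>. The factor 2 comes from
    \<open>\<xi> < a + h \<le> 2 * a\<close>.\<close>
  obtain \<xi> where \<xi>: "a < \<xi>" "\<xi> < a + h" and 1: "g (a + h) - g a = (a + h - a) * g' \<xi>"
    using MVT2[of a "a + h" g g'] h g by auto
  obtain \<zeta> where \<zeta>: "a < \<zeta>" "\<zeta> < \<xi>" and 2: "\<xi> * g' \<xi> - a * g' a = (\<xi> - a) * e \<zeta>"
    using MVT2[of a \<xi> "\<lambda>x. x * g' x" e] \<xi> flux by auto
  have "\<bar>(\<xi> - a) * e \<zeta>\<bar> \<le> h * B"
    unfolding abs_mult using \<xi> \<zeta> e[of \<zeta>] by (intro mult_mono) auto
  moreover have "\<bar>\<xi> * g' \<xi>\<bar> \<le> 2 * a / h * \<bar>g (a + h) - g a\<bar>"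
  proof -
    have "\<bar>\<xi> * g' \<xi>\<bar> \<le> 2 * a * \<bar>g' \<xi>\<bar>"
      unfolding abs_mult using \<xi> a h by (intro mult_right_mono) auto
    then show ?thesis using h a by (simp add: 1 abs_mult)
  qed
  ultimately show ?thesis using 2 by linarith
qed

text \<open>Step length \<open>h = a\<close>: from \<open>a\<close> to \<open>2 * a\<close> the
  power weights stay comparable, and the error \<open>h * B\<close> costs one power of
  \<open>a\<close>, which the assumed decay of \<open>e\<close> pays for. The derivative then decays
  one power faster than the function.\<close>

lemma flux_tendsto_doubling:
  fixes g g' e :: "real \<Rightarrow> real"
  assumes g: "\<And>x. 0 < x \<Longrightarrow> (g has_real_derivative g' x) (at x)"
    and flux: "\<And>x. 0 < x \<Longrightarrow> ((\<lambda>x. x * g' x) has_real_derivative e x) (at x)"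
    and lim: "((\<lambda>x. x ^ n * g x) \<longlongrightarrow> 0) at_top" and e: "((\<lambda>x. x ^ Suc n * e x) \<longlongrightarrow> 0) at_top"
  shows "((\<lambda>x. x ^ Suc n * g' x) \<longlongrightarrow> 0) at_top"
proof (rule tendstoI)
  fix r :: real assume r: "0 < r"
  obtain b1 where b1: "\<And>x. b1 \<le> x \<Longrightarrow> \<bar>x ^ n * g x\<bar> < r / 8"
    using tendstoD[OF lim, of "r / 8"] r by (auto simp: eventually_at_top_linorder)
  obtain b2 where b2: "\<And>x. b2 \<le> x \<Longrightarrow> \<bar>x ^ Suc n * e x\<bar> < r / 8"
    using tendstoD[OF e, of "r / 8"] r by (auto simp: eventually_at_top_linorder)
  have "\<bar>a ^ Suc n * g' a\<bar> < r" if a: "a \<ge> max 1 (max b1 b2)" for a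
  proof -
    have a0: "0 < a" using a by auto
    have mono: "\<bar>a ^ k * z\<bar> \<le> \<bar>x ^ k * z\<bar>" if "a \<le> x" for k x z
      unfolding abs_mult using that a0 by (intro mult_right_mono) (auto simp: power_mono)
    have "\<bar>a * g' a\<bar> \<le> 2 * a / a * \<bar>g (a + a) - g a\<bar> + a * (r / 8 / a ^ Suc n)"
    proof (rule flux_bound[OF a0 a0 order.refl g flux])
      fix x assume x: "a \<le> x"
      have "\<bar>a ^ Suc n * e x\<bar> \<le> r / 8" using mono[OF x, of "Suc n" "e x"] b2[of x] x a by linarith
      then show "\<bar>e x\<bar> \<le> r / 8 / a ^ Suc n"
        using a0 by (simp add: field_simps abs_mult)
    qed (use a0 in auto)
    then have "a ^ n * \<bar>a * g' a\<bar> \<le> a ^ n * (2 * a / a * \<bar>g (a + a) - g a\<bar> + a * (r / 8 / a ^ Suc n))"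
      using a0 by (intro mult_left_mono) auto
    also have "\<dots> = 2 * \<bar>a ^ n * g (a + a) - a ^ n * g a\<bar> + r / 8"
    proof -
      have "\<bar>a ^ n * g (a + a) - a ^ n * g a\<bar> = a ^ n * \<bar>g (a + a) - g a\<bar>"
        using a0 by (simp add: abs_mult flip: right_diff_distrib)
      then show ?thesis using a0 by (simp add: distrib_left)
    qed
    also have "\<dots> < 2 * (r / 8 + r / 8) + r / 2"
    proof -
      have "\<bar>a ^ n * g (a + a)\<bar> \<le> \<bar>(a + a) ^ n * g (a + a)\<bar>" by (rule mono) (use a0 in simp)
      moreover have "\<bar>(a + a) ^ n * g (a + a)\<bar> < r / 8" "\<bar>a ^ n * g a\<bar> < r / 8"
        using b1[of "a + a"] b1[of a] a by auto
      ultimately show ?thesis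
        using r abs_triangle_ineq4[of "a ^ n * g (a + a)" "a ^ n * g a"] by argo
    qed
    finally show ?thesis using a0 r by (simp add: abs_mult mult_ac)
  qed
  then show "\<forall>\<^sub>F x in at_top. dist (x ^ Suc n * g' x) 0 < r"
    unfolding eventually_at_top_linorder by (intro exI[of _ "max 1 (max b1 b2)"]) simp
qed

text \<open>Step length \<open>h = 1\<close>, for a flux derivative that tends to 0 at no known
  rate: the error is \<open>B\<close> itself instead of \<open>a * B\<close>. The price is that the
  derivative gains no power over the function. This is the version for the first adjoint
  component.\<close>

lemma flux_tendsto_unit_step:
  fixes g g' e :: "real \<Rightarrow> real"
  assumes g: "\<And>x. 0 < x \<Longrightarrow> (g has_real_derivative g' x) (at x)"
    and flux: "\<And>x. 0 < x \<Longrightarrow> ((\<lambda>x. x * g' x) has_real_derivative e x) (at x)"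
    and lim: "((\<lambda>x. x * g x) \<longlongrightarrow> 0) at_top" and e: "(e \<longlongrightarrow> 0) at_top"
  shows "((\<lambda>x. x * g' x) \<longlongrightarrow> 0) at_top"
proof (rule tendstoI)
  fix r :: real assume r: "0 < r"
  obtain b1 where b1: "\<And>x. b1 \<le> x \<Longrightarrow> \<bar>x * g x\<bar> < r / 8"
    using tendstoD[OF lim, of "r / 8"] r by (auto simp: eventually_at_top_linorder)
  obtain b2 where b2: "\<And>x. b2 \<le> x \<Longrightarrow> \<bar>e x\<bar> < r / 8"
    using tendstoD[OF e, of "r / 8"] r by (auto simp: eventually_at_top_linorder)
  have "\<bar>a * g' a\<bar> < r" if a: "a \<ge> max 1 (max b1 b2)" for a
  proof -
    have a0: "0 < a" using a by auto
    have "\<bar>a * g' a\<bar> \<le> 2 * a / 1 * \<bar>g (a + 1) - g a\<bar> + 1 * (r / 8)"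
      by (rule flux_bound[OF a0 _ _ g flux]) (use a a0 b2 in \<open>force intro: less_imp_le\<close>)+
    also have "\<dots> = 2 * \<bar>a * g (a + 1) - a * g a\<bar> + r / 8"
      using a0 by (simp add: abs_mult flip: right_diff_distrib)
    also have "\<dots> < 2 * (r / 8 + r / 8) + r / 2"
    proof -
      have "\<bar>a * g (a + 1)\<bar> \<le> \<bar>(a + 1) * g (a + 1)\<bar>"
        unfolding abs_mult using a0 by (intro mult_right_mono) auto
      moreover have "\<bar>(a + 1) * g (a + 1)\<bar> < r / 8" "\<bar>a * g a\<bar> < r / 8"
        using b1[of "a + 1"] b1[of a] a by auto
      ultimately show ?thesis using r abs_triangle_ineq4[of "a * g (a + 1)" "a * g a"] by argo
    qed
    finally show ?thesis using r by auto
  qed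
  then show "\<forall>\<^sub>F x in at_top. dist (x * g' x) 0 < r"
    unfolding eventually_at_top_linorder by (intro exI[of _ "max 1 (max b1 b2)"]) simp
qed

text \<open>The intervals from \<open>a\<close> to \<open>2 * a\<close> now shrink to the origin.
  Only \<open>x * e\<close> is asked to be bounded, since the adjoint equations have a
  \<open>1 / x\<close> singularity in the flux derivative. A bound on \<open>x * g'\<close> is
  enough, because in the Lagrange boundary term it meets a factor that tends to 0.\<close>

lemma flux_Bfun_at_right_0:
  fixes g g' e :: "real \<Rightarrow> real"
  assumes g: "\<And>x. 0 < x \<Longrightarrow> (g has_real_derivative g' x) (at x)"
    and flux: "\<And>x. 0 < x \<Longrightarrow> ((\<lambda>x. x * g' x) has_real_derivative e x) (at x)"
    and bdd: "Bfun g (at_right 0)" and e: "Bfun (\<lambda>x. x * e x) (at_right 0)"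
  shows "Bfun (\<lambda>x. x * g' x) (at_right 0)"
proof -
  obtain B where B: "\<forall>\<^sub>F x in at_right 0. \<bar>g x\<bar> \<le> B" "0 < B" using bdd unfolding Bfun_def by auto
  obtain C where C: "\<forall>\<^sub>F x in at_right 0. \<bar>x * e x\<bar> \<le> C" "0 < C" using e unfolding Bfun_def by auto
  obtain d where d: "0 < d" "\<And>x. 0 < x \<Longrightarrow> x < d \<Longrightarrow> \<bar>g x\<bar> \<le> B \<and> \<bar>x * e x\<bar> \<le> C"
    using eventually_conj[OF B(1) C(1)] by (auto simp: eventually_at_right_field)
  have "\<bar>a * g' a\<bar> \<le> 2 * (2 * B) + C" if a: "0 < a" "a < d / 2" for a
  proof -
    have "\<bar>a * g' a\<bar> \<le> 2 * a / a * \<bar>g (a + a) - g a\<bar> + a * (C / a)"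
    proof (rule flux_bound[OF a(1) a(1) order.refl g flux])
      fix x assume x: "a \<le> x" "x \<le> a + a"
      have "\<bar>a * e x\<bar> \<le> \<bar>x * e x\<bar>"
        unfolding abs_mult using a x by (intro mult_right_mono) auto
      then show "\<bar>e x\<bar> \<le> C / a"
        using a x d(2)[of x] by (auto simp: field_simps abs_mult)
    qed (use a in auto)
    also have "\<dots> = 2 * \<bar>g (a + a) - g a\<bar> + C" using a by simp
    finally have "\<bar>a * g' a\<bar> \<le> 2 * \<bar>g (a + a) - g a\<bar> + C" .
    moreover have "\<bar>g (a + a)\<bar> \<le> B" "\<bar>g a\<bar> \<le> B" using d(2)[of "a + a"] d(2)[of a] a by auto
    ultimately show ?thesis using abs_triangle_ineq4[of "g (a + a)" "g a"] by argo
  qed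
  then have "\<forall>\<^sub>F x in at_right 0. norm (x * g' x) \<le> 2 * (2 * B) + C"
    using d(1) unfolding eventually_at_right_field by (intro exI[of _ "d / 2"]) auto
  then show ?thesis by (rule BfunI)
qed

section \<open>The core solution at infinity\<close>

lemma core_solution_derivs:
  assumes "core_solution f S U V c" "0 < \<rho>"
  shows "(U has_real_derivative deriv U \<rho>) (at \<rho>)"
    and "(V has_real_derivative deriv V \<rho>) (at \<rho>)"
    and "(deriv U has_real_derivative (U \<rho> - f * (U \<rho>)\<^sup>2 * V \<rho> - deriv U \<rho> / \<rho>)) (at \<rho>)"
    and "(deriv V has_real_derivative ((U \<rho>)\<^sup>2 * V \<rho> - U \<rho> - deriv V \<rho> / \<rho>)) (at \<rho>)"
proof -
  note * = assms(1)[unfolded core_solution_def twice_diff_pos_def radial_lap_def]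
  show "(U has_real_derivative deriv U \<rho>) (at \<rho>)" "(V has_real_derivative deriv V \<rho>) (at \<rho>)"
    using * assms(2) by (auto intro: field_differentiable_derivI)
  have "(deriv U has_real_derivative deriv (deriv U) \<rho>) (at \<rho>)"
       "(deriv V has_real_derivative deriv (deriv V) \<rho>) (at \<rho>)"
    using * assms(2) by (auto intro: field_differentiable_derivI)
  moreover have "deriv (deriv U) \<rho> = U \<rho> - f * (U \<rho>)\<^sup>2 * V \<rho> - deriv U \<rho> / \<rho>"
    "deriv (deriv V) \<rho> = (U \<rho>)\<^sup>2 * V \<rho> - U \<rho> - deriv V \<rho> / \<rho>"
    using * assms(2) by (auto simp: algebra_simps)
  ultimately show "(deriv U has_real_derivative (U \<rho> - f * (U \<rho>)\<^sup>2 * V \<rho> - deriv U \<rho> / \<rho>)) (at \<rho>)"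
    "(deriv V has_real_derivative ((U \<rho>)\<^sup>2 * V \<rho> - U \<rho> - deriv V \<rho> / \<rho>)) (at \<rho>)" by simp_all
qed

lemma core_solution_flux:
  assumes "core_solution f S U V c" "0 < \<rho>"
  shows "((\<lambda>\<rho>. \<rho> * deriv U \<rho>) has_real_derivative \<rho> * (U \<rho> - f * (U \<rho>)\<^sup>2 * V \<rho>)) (at \<rho>)"
    and "((\<lambda>\<rho>. \<rho> * deriv V \<rho>) has_real_derivative \<rho> * ((U \<rho>)\<^sup>2 * V \<rho> - U \<rho>)) (at \<rho>)"
  using assms(2)
  by (auto intro!: derivative_eq_intros core_solution_derivs[OF assms] simp: field_simps)

lemma power_times_exp_decay:
  fixes g :: "real \<Rightarrow> real"
  assumes "0 < a" "\<And>\<rho>. 0 \<le> \<rho> \<Longrightarrow> \<bar>g \<rho>\<bar> \<le> C * exp (- a * \<rho>)"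
  shows "((\<lambda>\<rho>. \<rho> ^ n * g \<rho>) \<longlongrightarrow> 0) at_top"
proof (rule Lim_null_comparison)
  show "\<forall>\<^sub>F \<rho> in at_top. norm (\<rho> ^ n * g \<rho>) \<le> C / a ^ n * ((a * \<rho>) ^ n / exp (a * \<rho>))"
    using eventually_ge_at_top[of 0]
  proof eventually_elim
    case (elim \<rho>)
    have "norm (\<rho> ^ n * g \<rho>) \<le> \<rho> ^ n * (C * exp (- a * \<rho>))"
      using elim assms(2)[of \<rho>] by (auto simp: abs_mult intro!: mult_left_mono)
    then show ?case using assms(1) by (simp add: exp_minus field_simps)
  qed
  have "filterlim (\<lambda>\<rho>. a * \<rho>) at_top at_top"
    using assms(1) by (intro filterlim_tendsto_pos_mult_at_top[OF tendsto_const]) (auto simp: filterlim_ident)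
  from filterlim_compose[OF tendsto_power_div_exp_0 this]
  have "((\<lambda>\<rho>. (a * \<rho>) ^ n / exp (a * \<rho>)) \<longlongrightarrow> 0) at_top" .
  then show "((\<lambda>\<rho>. C / a ^ n * ((a * \<rho>) ^ n / exp (a * \<rho>))) \<longlongrightarrow> 0) at_top"
    by (rule tendsto_mult_right_zero)
qed

lemma core_solution_decay:
  assumes "core_solution f S U V c"
  shows "((\<lambda>\<rho>. \<rho> ^ n * U \<rho>) \<longlongrightarrow> 0) at_top" and "((\<lambda>\<rho>. V \<rho> / \<rho>) \<longlongrightarrow> 0) at_top"
proof -
  show "((\<lambda>\<rho>. \<rho> ^ n * U \<rho>) \<longlongrightarrow> 0) at_top"
    using assms unfolding core_solution_def by (blast intro: power_times_exp_decay)
  have "((\<lambda>\<rho>. V \<rho> - S * ln \<rho>) \<longlongrightarrow> c) at_top" using assms unfolding core_solution_def by auto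
  from tendsto_divide_0[OF this filterlim_mono[OF filterlim_ident at_top_le_at_infinity order.refl]]
  have "((\<lambda>\<rho>. (V \<rho> - S * ln \<rho>) / \<rho>) \<longlongrightarrow> 0) at_top" .
  moreover have "((\<lambda>\<rho>. S * (ln \<rho> / \<rho>)) \<longlongrightarrow> 0) at_top"
    by (intro tendsto_mult_right_zero ln_x_over_x_tendsto_0)
  ultimately have "((\<lambda>\<rho>. (V \<rho> - S * ln \<rho>) / \<rho> + S * (ln \<rho> / \<rho>)) \<longlongrightarrow> 0 + 0) at_top"
    by (rule tendsto_add)
  then show "((\<lambda>\<rho>. V \<rho> / \<rho>) \<longlongrightarrow> 0) at_top" by (simp add: diff_divide_distrib)
qed

lemma core_solution_nonlinear_decay:
  assumes "core_solution f S U V c"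
  shows "((\<lambda>\<rho>. \<rho> ^ n * (U \<rho> * V \<rho>)) \<longlongrightarrow> 0) at_top" "((\<lambda>\<rho>. \<rho> ^ n * (U \<rho>)\<^sup>2) \<longlongrightarrow> 0) at_top"
    "((\<lambda>\<rho>. \<rho> ^ n * ((U \<rho>)\<^sup>2 * V \<rho>)) \<longlongrightarrow> 0) at_top"
proof -
  note d = core_solution_decay[OF assms]
  have U: "(U \<longlongrightarrow> 0) at_top" using d(1)[of 0] by simp
  \<comment> \<open>One spare power of \<rho> absorbs the logarithmic growth of
    \<open>V\<close>.\<close>
  have "((\<lambda>\<rho>. (\<rho> ^ Suc n * U \<rho>) * (V \<rho> / \<rho>)) \<longlongrightarrow> 0) at_top"
    using tendsto_mult_zero[OF d] .
  then show 1: "((\<lambda>\<rho>. \<rho> ^ n * (U \<rho> * V \<rho>)) \<longlongrightarrow> 0) at_top"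
    by (rule Lim_transform_eventually) (use eventually_gt_at_top[of 0] in eventually_elim, simp)
  show "((\<lambda>\<rho>. \<rho> ^ n * (U \<rho>)\<^sup>2) \<longlongrightarrow> 0) at_top"
    using tendsto_mult_zero[OF d(1)[of n] U] by (simp add: power2_eq_square mult.assoc)
  show "((\<lambda>\<rho>. \<rho> ^ n * ((U \<rho>)\<^sup>2 * V \<rho>)) \<longlongrightarrow> 0) at_top"
    using tendsto_mult_zero[OF 1 U] by (simp add: power2_eq_square mult_ac)
qed

lemma core_solution_deriv_at_top:
  assumes "core_solution f S U V c"
  shows "((\<lambda>\<rho>. \<rho>\<^sup>2 * deriv U \<rho>) \<longlongrightarrow> 0) at_top" "((\<lambda>\<rho>. \<rho> * deriv V \<rho>) \<longlongrightarrow> S) at_top"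
proof -
  note d = core_solution_decay[OF assms] core_solution_nonlinear_decay[OF assms]
  \<comment> \<open>The quadratic weight is dictated by the corrector of the solvability argument, a
    multiple of \<open>\<rho>\<^sup>2 * deriv U \<rho>\<close> that has to vanish at
    infinity.\<close>
  have "((\<lambda>x. x ^ Suc 1 * deriv U x) \<longlongrightarrow> 0) at_top"
  proof (rule flux_tendsto_doubling[OF core_solution_derivs(1)[OF assms] core_solution_flux(1)[OF assms] d(1)])
    have "((\<lambda>x. x ^ 3 * U x - f * (x ^ 3 * ((U x)\<^sup>2 * V x))) \<longlongrightarrow> 0 - f * 0) at_top"
      by (intro tendsto_intros d)
    then show "((\<lambda>x. x ^ Suc 1 * (x * (U x - f * (U x)\<^sup>2 * V x))) \<longlongrightarrow> 0) at_top"
      by (simp add: algebra_simps power2_eq_square power3_eq_cube)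
  qed
  then show "((\<lambda>\<rho>. \<rho>\<^sup>2 * deriv U \<rho>) \<longlongrightarrow> 0) at_top" by (simp add: power2_eq_square)
  \<comment> \<open>Subtracting the far field \<open>S * ln x + c\<close> makes the function vanish
    at infinity. The logarithm has the constant flux \<open>S\<close>, so the flux derivative does
    not change.\<close>
  have "((\<lambda>x. x ^ Suc 0 * (deriv V x - S / x)) \<longlongrightarrow> 0) at_top"
  proof (rule flux_tendsto_doubling)
    show "((\<lambda>x. V x - S * ln x - c) has_real_derivative deriv V x - S / x) (at x)" if "0 < x" for x
      using that by (auto intro!: derivative_eq_intros core_solution_derivs(2)[OF assms])
    show "((\<lambda>x. x * (deriv V x - S / x)) has_real_derivative x * ((U x)\<^sup>2 * V x - U x)) (at x)"
      if "0 < x" for x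
    proof (rule has_field_derivative_transform_within_open[where S = "{0<..}"])
      show "((\<lambda>x. x * deriv V x - S) has_real_derivative x * ((U x)\<^sup>2 * V x - U x)) (at x)"
        using DERIV_diff[OF core_solution_flux(2)[OF assms that] DERIV_const] by simp
    qed (use that in \<open>auto simp: field_simps\<close>)
    show "((\<lambda>x. x ^ 0 * (V x - S * ln x - c)) \<longlongrightarrow> 0) at_top"
      using assms unfolding core_solution_def by (auto simp: LIM_zero)
    have "((\<lambda>x. x ^ 2 * ((U x)\<^sup>2 * V x) - x ^ 2 * U x) \<longlongrightarrow> 0 - 0) at_top"
      by (intro tendsto_intros d)
    then show "((\<lambda>x. x ^ Suc 0 * (x * ((U x)\<^sup>2 * V x - U x))) \<longlongrightarrow> 0) at_top"
      by (simp add: algebra_simps power2_eq_square)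
  qed
  then have "((\<lambda>x. x * (deriv V x - S / x) + S) \<longlongrightarrow> 0 + S) at_top"
    by (intro tendsto_add) auto
  then have "((\<lambda>x. x * (deriv V x - S / x) + S) \<longlongrightarrow> S) at_top" by simp
  then show "((\<lambda>\<rho>. \<rho> * deriv V \<rho>) \<longlongrightarrow> S) at_top"
    by (rule Lim_transform_eventually)
      (use eventually_gt_at_top[of 0] in eventually_elim, simp add: field_simps)
qed

section \<open>Boundedness near the origin\<close>

lemma tendsto_imp_Bfun_real:
  fixes g :: "'a \<Rightarrow> real"
  assumes "(g \<longlongrightarrow> l) F" shows "Bfun g F"
proof -
  from tendstoD[OF assms, of 1] have "\<forall>\<^sub>F x in F. norm (g x) \<le> \<bar>l\<bar> + 1"
    by (auto simp: dist_real_def elim!: eventually_mono)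
  then show ?thesis by (rule BfunI)
qed

lemma one_sided_continuous_Bfun:
  assumes "continuous (at 0 within {0::real..}) (g :: real \<Rightarrow> real)"
  shows "Bfun g (at_right 0)"
proof (rule tendsto_imp_Bfun_real)
  show "(g \<longlongrightarrow> g 0) (at_right 0)"
    using assms unfolding continuous_within by (rule tendsto_within_subset) auto
qed

lemma core_solution_Bfun_0:
  assumes "core_solution f S U V c"
  shows "Bfun U (at_right 0)" "Bfun V (at_right 0)"
proof -
  have "continuous (at 0 within {0..}) U" "continuous (at 0 within {0..}) V"
    using assms unfolding core_solution_def by (auto intro: DERIV_continuous)
  then show "Bfun U (at_right 0)" "Bfun V (at_right 0)" by (auto intro: one_sided_continuous_Bfun)
qed

lemma Bfun_mult_real:
  fixes g h :: "'a \<Rightarrow> real"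
  assumes "Bfun g F" "Bfun h F" shows "Bfun (\<lambda>x. g x * h x) F"
proof -
  obtain B C where "0 < B" "0 < C" "\<forall>\<^sub>F x in F. norm (g x) \<le> B" "\<forall>\<^sub>F x in F. norm (h x) \<le> C"
    using assms unfolding Bfun_def by blast
  note B = this
  have "\<forall>\<^sub>F x in F. norm (g x * h x) \<le> B * C"
    using B(3,4) by eventually_elim (use B(1) in \<open>auto simp: abs_mult intro!: mult_mono\<close>)
  then show ?thesis by (rule BfunI)
qed

lemma Bfun_add_real:
  fixes g h :: "'a \<Rightarrow> real"
  assumes "Bfun g F" "Bfun h F" shows "Bfun (\<lambda>x. g x + h x) F"
proof -
  obtain B C where "0 < B" "0 < C" "\<forall>\<^sub>F x in F. norm (g x) \<le> B" "\<forall>\<^sub>F x in F. norm (h x) \<le> C"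
    using assms unfolding Bfun_def by blast
  note B = this
  have "\<forall>\<^sub>F x in F. norm (g x + h x) \<le> B + C"
    using B(3,4) by eventually_elim auto
  then show ?thesis by (rule BfunI)
qed

lemma Bfun_diff_real:
  fixes g h :: "'a \<Rightarrow> real"
  assumes "Bfun g F" "Bfun h F" shows "Bfun (\<lambda>x. g x - h x) F"
  using Bfun_add_real[OF assms(1) Bfun_mult_real[OF Bfun_const[of "-1"] assms(2)]] by simp

lemma tendsto_mult_zero_Bfun:
  fixes g h :: "'a \<Rightarrow> real"
  assumes "(g \<longlongrightarrow> 0) F" "Bfun h F" shows "((\<lambda>x. g x * h x) \<longlongrightarrow> 0) F"
proof -
  obtain C where C: "0 < C" "\<forall>\<^sub>F x in F. norm (h x) \<le> C"
    using assms(2) unfolding Bfun_def by blast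
  have "\<forall>\<^sub>F x in F. norm (g x * h x) \<le> norm (g x) * C"
    using C(2) by eventually_elim (auto simp: abs_mult intro: mult_left_mono)
  then show ?thesis
    by (rule Lim_null_comparison) (use assms(1) in \<open>auto intro!: tendsto_mult_left_zero tendsto_rabs_zero\<close>)
qed

lemma Bfun_ident_at_right_0: "Bfun (\<lambda>x::real. x) (at_right 0)"
  by (rule tendsto_imp_Bfun_real) (rule tendsto_ident_at)

lemmas Bfun_intros = Bfun_mult_real Bfun_add_real Bfun_diff_real Bfun_const Bfun_ident_at_right_0

section \<open>The adjoint solution at infinity and at the origin\<close>

lemma adjoint_solution_derivs:
  assumes "adjoint_solution f U V P1 P2" "0 < \<rho>"
  shows "(P1 has_real_derivative deriv P1 \<rho>) (at \<rho>)"
    and "(P2 has_real_derivative deriv P2 \<rho>) (at \<rho>)"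
    and "(deriv P1 has_real_derivative P1 \<rho> / \<rho>\<^sup>2 - deriv P1 \<rho> / \<rho>
      - ((2 * f * U \<rho> * V \<rho> - 1) * P1 \<rho> + (1 - 2 * U \<rho> * V \<rho>) * P2 \<rho>)) (at \<rho>)"
    and "(deriv P2 has_real_derivative P2 \<rho> / \<rho>\<^sup>2 - deriv P2 \<rho> / \<rho>
      - (f * (U \<rho>)\<^sup>2 * P1 \<rho> - (U \<rho>)\<^sup>2 * P2 \<rho>)) (at \<rho>)"
proof -
  note * = assms(1)[unfolded adjoint_solution_def twice_diff_pos_def]
  show "(P1 has_real_derivative deriv P1 \<rho>) (at \<rho>)" "(P2 has_real_derivative deriv P2 \<rho>) (at \<rho>)"
    using * assms(2) by (auto intro: field_differentiable_derivI)
  have 1: "(deriv P1 has_real_derivative deriv (deriv P1) \<rho>) (at \<rho>)"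
       "(deriv P2 has_real_derivative deriv (deriv P2) \<rho>) (at \<rho>)"
    using * assms(2) by (auto intro: field_differentiable_derivI)
  have "vector [radial_lap P1 \<rho> - P1 \<rho> / \<rho>^2, radial_lap P2 \<rho> - P2 \<rho> / \<rho>^2]
          + transpose (core_matrix f U V \<rho>) *v vector [P1 \<rho>, P2 \<rho>] = (0 :: real^2)"
    using * assms(2) by blast
  then have "deriv (deriv P1) \<rho> = P1 \<rho> / \<rho>\<^sup>2 - deriv P1 \<rho> / \<rho>
      - ((2 * f * U \<rho> * V \<rho> - 1) * P1 \<rho> + (1 - 2 * U \<rho> * V \<rho>) * P2 \<rho>)"
    "deriv (deriv P2) \<rho> = P2 \<rho> / \<rho>\<^sup>2 - deriv P2 \<rho> / \<rho> - (f * (U \<rho>)\<^sup>2 * P1 \<rho> - (U \<rho>)\<^sup>2 * P2 \<rho>)"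
    by (auto simp: vec_eq_iff forall_2 matrix_vector_mult_def sum_2 transpose_def core_matrix_def
        radial_lap_def algebra_simps)
  with 1 show "(deriv P1 has_real_derivative P1 \<rho> / \<rho>\<^sup>2 - deriv P1 \<rho> / \<rho>
      - ((2 * f * U \<rho> * V \<rho> - 1) * P1 \<rho> + (1 - 2 * U \<rho> * V \<rho>) * P2 \<rho>)) (at \<rho>)"
    "(deriv P2 has_real_derivative P2 \<rho> / \<rho>\<^sup>2 - deriv P2 \<rho> / \<rho>
      - (f * (U \<rho>)\<^sup>2 * P1 \<rho> - (U \<rho>)\<^sup>2 * P2 \<rho>)) (at \<rho>)"
    by simp_all
qed

lemma adjoint_solution_flux:
  assumes "adjoint_solution f U V P1 P2" "0 < \<rho>"
  shows "((\<lambda>\<rho>. \<rho> * deriv P1 \<rho>) has_real_derivative P1 \<rho> / \<rho>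
      - \<rho> * ((2 * f * U \<rho> * V \<rho> - 1) * P1 \<rho> + (1 - 2 * U \<rho> * V \<rho>) * P2 \<rho>)) (at \<rho>)"
    and "((\<lambda>\<rho>. \<rho> * deriv P2 \<rho>) has_real_derivative P2 \<rho> / \<rho>
      - \<rho> * (f * (U \<rho>)\<^sup>2 * P1 \<rho> - (U \<rho>)\<^sup>2 * P2 \<rho>)) (at \<rho>)"
  using assms(2)
  by (auto intro!: derivative_eq_intros adjoint_solution_derivs[OF assms]
      simp: field_simps power2_eq_square)

text \<open>The function \<open>1 / \<rho>\<close> solves the equation without the matrix term;
  subtracting it turns the far field into a null limit. The transposed matrix tends to the rows (-1,
  1) and (0, 0). Hence the second equation decouples up to rapidly decaying terms and yields the
  sharp rate for \<open>deriv P2\<close>, while the first keeps \<open>P2 - P1\<close>, whose flux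
  contribution tends to 0 only because \<open>\<rho> * P1 \<rho>\<close> and
  \<open>\<rho> * P2 \<rho>\<close> have the same limit.\<close>

lemma adjoint_solution_at_top:
  assumes core: "core_solution f S U V c" and adj: "adjoint_solution f U V P1 P2"
  shows "((\<lambda>\<rho>. \<rho> * P1 \<rho>) \<longlongrightarrow> 1) at_top" "((\<lambda>\<rho>. \<rho> * P2 \<rho>) \<longlongrightarrow> 1) at_top"
    "((\<lambda>\<rho>. \<rho> * deriv P1 \<rho>) \<longlongrightarrow> 0) at_top" "((\<lambda>\<rho>. \<rho>\<^sup>2 * deriv P2 \<rho>) \<longlongrightarrow> -1) at_top"
proof -
  show P1: "((\<lambda>\<rho>. \<rho> * P1 \<rho>) \<longlongrightarrow> 1) at_top" and P2: "((\<lambda>\<rho>. \<rho> * P2 \<rho>) \<longlongrightarrow> 1) at_top"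
    using adj unfolding adjoint_solution_def by auto
  note d = core_solution_nonlinear_decay[OF core]
  have inv: "((\<lambda>\<rho>::real. 1 / \<rho>) \<longlongrightarrow> 0) at_top"
    using tendsto_inverse_0_at_top[OF filterlim_ident] by (simp add: divide_inverse)
  have shift: "((\<lambda>x. P x - 1 / x) has_real_derivative deriv P x + 1 / x\<^sup>2) (at x)"
    "((\<lambda>x. x * (deriv P x + 1 / x\<^sup>2)) has_real_derivative e - 1 / x\<^sup>2) (at x)"
    if "0 < x" "(P has_real_derivative deriv P x) (at x)"
      "((\<lambda>x. x * deriv P x) has_real_derivative e) (at x)" for P x e
  proof -
    show "((\<lambda>x. P x - 1 / x) has_real_derivative deriv P x + 1 / x\<^sup>2) (at x)"
      using that by (auto intro!: derivative_eq_intros simp: power2_eq_square)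
    have "((\<lambda>x. x * deriv P x + 1 / x) has_real_derivative e - 1 / x\<^sup>2) (at x)"
      using that by (auto intro!: DERIV_add[OF that(3), THEN DERIV_cong] derivative_eq_intros simp: power2_eq_square)
    then show "((\<lambda>x. x * (deriv P x + 1 / x\<^sup>2)) has_real_derivative e - 1 / x\<^sup>2) (at x)"
      by (rule has_field_derivative_transform_within_open[where S = "{0<..}"])
        (use that in \<open>auto simp: field_simps power2_eq_square\<close>)
  qed
  have P1': "((\<lambda>x. x * (P1 x - 1 / x)) \<longlongrightarrow> 0) at_top" if "((\<lambda>x. x * P1 x) \<longlongrightarrow> 1) at_top" for P1 :: "real \<Rightarrow> real"
    using LIM_zero[OF that] by (rule Lim_transform_eventually)
      (use eventually_gt_at_top[of 0] in eventually_elim, simp add: field_simps)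
  have "((\<lambda>x. x * (deriv P1 x + 1 / x\<^sup>2)) \<longlongrightarrow> 0) at_top"
  proof (rule flux_tendsto_unit_step[OF shift(1) shift(2)])
    show "((\<lambda>x. P1 x / x - x * ((2 * f * U x * V x - 1) * P1 x + (1 - 2 * U x * V x) * P2 x) - 1 / x\<^sup>2)
       \<longlongrightarrow> 0) at_top"
    proof (rule Lim_transform_eventually)
      show "((\<lambda>x. (x * P1 x) * (1 / x) * (1 / x) - ((2 * f * (x ^ 0 * (U x * V x)) - 1) * (x * P1 x) +
           (1 - 2 * (x ^ 0 * (U x * V x))) * (x * P2 x)) - (1 / x) * (1 / x)) \<longlongrightarrow> 0) at_top"
        by (rule tendsto_eq_intros P1 P2 d inv refl | simp)+
    qed (use eventually_gt_at_top[of 0] in eventually_elim, simp add: field_simps power2_eq_square)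
  qed (auto intro: adjoint_solution_derivs[OF adj] adjoint_solution_flux[OF adj] P1'[OF P1])
  from tendsto_diff[OF this inv] show "((\<lambda>\<rho>. \<rho> * deriv P1 \<rho>) \<longlongrightarrow> 0) at_top"
    by (simp, rule_tac Lim_transform_eventually)
      (assumption, use eventually_gt_at_top[of 0] in eventually_elim, simp add: field_simps power2_eq_square)
  have "((\<lambda>x. x ^ Suc 1 * (deriv P2 x + 1 / x\<^sup>2)) \<longlongrightarrow> 0) at_top"
  proof (rule flux_tendsto_doubling[OF shift(1) shift(2)])
    show "((\<lambda>x. x ^ Suc 1 * (P2 x / x - x * (f * (U x)\<^sup>2 * P1 x - (U x)\<^sup>2 * P2 x) - 1 / x\<^sup>2))
       \<longlongrightarrow> 0) at_top"
    proof (rule Lim_transform_eventually)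
      show "((\<lambda>x. x * P2 x - (f * (x ^ 2 * (U x)\<^sup>2) * (x * P1 x) - (x ^ 2 * (U x)\<^sup>2) * (x * P2 x)) - 1)
         \<longlongrightarrow> 0) at_top"
        by (rule tendsto_eq_intros P1 P2 d inv refl | simp)+
    qed (use eventually_gt_at_top[of 0] in eventually_elim, simp add: field_simps power2_eq_square)
  qed (use P1'[OF P2] in \<open>auto intro: adjoint_solution_derivs[OF adj] adjoint_solution_flux[OF adj]\<close>)
  from tendsto_diff[OF this tendsto_const[of 1]] show "((\<lambda>\<rho>. \<rho>\<^sup>2 * deriv P2 \<rho>) \<longlongrightarrow> -1) at_top"
    by (simp, rule_tac Lim_transform_eventually)
      (assumption, use eventually_gt_at_top[of 0] in eventually_elim, simp add: field_simps power2_eq_square)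
qed

lemma core_solution_deriv_Bfun_0:
  assumes "core_solution f S U V c"
  shows "Bfun (\<lambda>\<rho>. \<rho> * deriv U \<rho>) (at_right 0)" "Bfun (\<lambda>\<rho>. \<rho> * deriv V \<rho>) (at_right 0)"
proof -
  note b = core_solution_Bfun_0[OF assms]
  show "Bfun (\<lambda>\<rho>. \<rho> * deriv U \<rho>) (at_right 0)"
    by (rule flux_Bfun_at_right_0[OF core_solution_derivs(1)[OF assms] core_solution_flux(1)[OF assms] b(1)])
      (auto simp: power2_eq_square intro!: Bfun_intros b)
  show "Bfun (\<lambda>\<rho>. \<rho> * deriv V \<rho>) (at_right 0)"
    by (rule flux_Bfun_at_right_0[OF core_solution_derivs(2)[OF assms] core_solution_flux(2)[OF assms] b(2)])
      (auto simp: power2_eq_square intro!: Bfun_intros b)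
qed

lemma adjoint_solution_Bfun_0:
  assumes core: "core_solution f S U V c" and adj: "adjoint_solution f U V P1 P2"
  shows "Bfun P1 (at_right 0)" "Bfun P2 (at_right 0)"
    "Bfun (\<lambda>\<rho>. \<rho> * deriv P1 \<rho>) (at_right 0)" "Bfun (\<lambda>\<rho>. \<rho> * deriv P2 \<rho>) (at_right 0)"
proof -
  note b = core_solution_Bfun_0[OF core]
  show 1: "Bfun P1 (at_right 0)" and 2: "Bfun P2 (at_right 0)"
    using adj unfolding adjoint_solution_def
    by (auto intro!: one_sided_continuous_Bfun differentiable_imp_continuous_within)
  \<comment> \<open>The singular term \<open>P x / x\<close> of the flux derivative becomes bounded
    after multiplication by \<open>x\<close>, which is all that the estimate at the origin asks
    for.\<close>
  have cancel: "Bfun (\<lambda>x. x * (P x / x - x * e x)) (at_right 0)"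
    if "Bfun P (at_right 0)" "Bfun e (at_right 0)" for P e :: "real \<Rightarrow> real"
  proof -
    have "Bfun (\<lambda>x. P x - x * x * e x) (at_right 0)" by (intro Bfun_intros that)
    then obtain B where "\<forall>\<^sub>F x in at_right 0. norm (P x - x * x * e x) \<le> B" unfolding Bfun_def by blast
    then have "\<forall>\<^sub>F x in at_right 0. norm (x * (P x / x - x * e x)) \<le> B"
      using eventually_at_right_less[of "0::real"]
      by eventually_elim (simp add: algebra_simps)
    then show ?thesis by (rule BfunI)
  qed
  show "Bfun (\<lambda>\<rho>. \<rho> * deriv P1 \<rho>) (at_right 0)"
    by (rule flux_Bfun_at_right_0[OF adjoint_solution_derivs(1)[OF adj] adjoint_solution_flux(1)[OF adj] 1])
      (auto simp: power2_eq_square intro!: Bfun_intros b 1 2 cancel)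
  show "Bfun (\<lambda>\<rho>. \<rho> * deriv P2 \<rho>) (at_right 0)"
    by (rule flux_Bfun_at_right_0[OF adjoint_solution_derivs(2)[OF adj] adjoint_solution_flux(2)[OF adj] 2])
      (auto simp: power2_eq_square intro!: Bfun_intros b 1 2 cancel)
qed

section \<open>The radial solvability condition\<close>

text \<open>The two systems carry transposed coefficients (\<open>m12\<close> and \<open>m21\<close>
  trade places), so the matrix terms cancel, and so do the \<open>1 / \<rho>\<^sup>2\<close> terms.
  The factor \<rho> in front absorbs the first-order terms, and only the forcing survives.\<close>

lemma lagrange_identity:
  fixes P1 P2 y1 y2 :: "real \<Rightarrow> real"
  assumes "0 < \<rho>"
    and "(P1 has_real_derivative P1' \<rho>) (at \<rho>)" "(P2 has_real_derivative P2' \<rho>) (at \<rho>)"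
    and "(y1 has_real_derivative y1' \<rho>) (at \<rho>)" "(y2 has_real_derivative y2' \<rho>) (at \<rho>)"
    and "(P1' has_real_derivative P1 \<rho> / \<rho>\<^sup>2 - P1' \<rho> / \<rho> - (m11 * P1 \<rho> + m21 * P2 \<rho>)) (at \<rho>)"
    and "(P2' has_real_derivative P2 \<rho> / \<rho>\<^sup>2 - P2' \<rho> / \<rho> - (m12 * P1 \<rho> + m22 * P2 \<rho>)) (at \<rho>)"
    and "(y1' has_real_derivative y1 \<rho> / \<rho>\<^sup>2 - y1' \<rho> / \<rho> - (m11 * y1 \<rho> + m12 * y2 \<rho>) + r1) (at \<rho>)"
    and "(y2' has_real_derivative y2 \<rho> / \<rho>\<^sup>2 - y2' \<rho> / \<rho> - (m21 * y1 \<rho> + m22 * y2 \<rho>) + r2) (at \<rho>)"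
  shows "((\<lambda>\<rho>. \<rho> * (P1 \<rho> * y1' \<rho> - P1' \<rho> * y1 \<rho> + P2 \<rho> * y2' \<rho> - P2' \<rho> * y2 \<rho>))
    has_real_derivative \<rho> * (P1 \<rho> * r1 + P2 \<rho> * r2)) (at \<rho>)"
  using \<open>0 < \<rho>\<close> by (auto intro!: derivative_eq_intros assms(2-)) (simp add: field_simps)

text \<open>Let \<open>N\<close> be the planar Laplacian of the core profile, so that
  \<open>U'' = N - U' / \<rho>\<close>. Then \<open>w = \<rho>\<^sup>2 U'\<close> satisfies
  \<open>w'' + w' / \<rho> - w / \<rho>\<^sup>2 = 4 \<rho> N + \<rho>\<^sup>2 N'\<close>, and
  \<open>N'\<close> is minus the core matrix applied to the derivative of the core solution. So
  \<open>k / 4\<close> times \<open>w\<close> solves the linearized system with forcing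
  \<open>k \<rho> N\<close>; this is where the quarter comes from.\<close>

lemma geometric_corrector_derivs:
  assumes core: "core_solution f S U V c" and \<rho>: "0 < \<rho>"
  shows "((\<lambda>\<rho>. k / 4 * (\<rho>\<^sup>2 * deriv U \<rho>)) has_real_derivative
      k / 4 * (\<rho> * deriv U \<rho> + \<rho>\<^sup>2 * (U \<rho> - f * (U \<rho>)\<^sup>2 * V \<rho>))) (at \<rho>)"
    and "((\<lambda>\<rho>. k / 4 * (\<rho>\<^sup>2 * deriv V \<rho>)) has_real_derivative
      k / 4 * (\<rho> * deriv V \<rho> + \<rho>\<^sup>2 * ((U \<rho>)\<^sup>2 * V \<rho> - U \<rho>))) (at \<rho>)"
    and "((\<lambda>\<rho>. k / 4 * (\<rho> * deriv U \<rho> + \<rho>\<^sup>2 * (U \<rho> - f * (U \<rho>)\<^sup>2 * V \<rho>))) has_real_derivative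
      k / 4 * (3 * \<rho> * (U \<rho> - f * (U \<rho>)\<^sup>2 * V \<rho>)
        + \<rho>\<^sup>2 * (deriv U \<rho> - f * (2 * U \<rho> * deriv U \<rho> * V \<rho> + (U \<rho>)\<^sup>2 * deriv V \<rho>)))) (at \<rho>)"
    and "((\<lambda>\<rho>. k / 4 * (\<rho> * deriv V \<rho> + \<rho>\<^sup>2 * ((U \<rho>)\<^sup>2 * V \<rho> - U \<rho>))) has_real_derivative
      k / 4 * (3 * \<rho> * ((U \<rho>)\<^sup>2 * V \<rho> - U \<rho>)
        + \<rho>\<^sup>2 * (2 * U \<rho> * deriv U \<rho> * V \<rho> + (U \<rho>)\<^sup>2 * deriv V \<rho> - deriv U \<rho>))) (at \<rho>)"
  using \<rho> by (auto intro!: derivative_eq_intros core_solution_derivs[OF core]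
      simp: field_simps power2_eq_square)

text \<open>\<open>(\<rho>\<^sup>2/8) cot \<theta>\<^sub>j U\<^sub>0'\<close> is the first harmonic of the order-\<open>\<epsilon>\<close> change of \<open>U\<^sub>0\<close> when its
  argument is replaced by the chordal distance to the spot centre. Subtracting this corrector
  (with \<open>k = cot \<theta>\<^sub>j / 2\<close>) removes the curvature terms from the right-hand side, and leaves a
  problem to which the Fredholm alternative against the adjoint solution applies.\<close>

lemma radial_solvability:
  fixes u v u' v' :: "real \<Rightarrow> real"
  assumes core: "core_solution f S U V c" and adj: "adjoint_solution f U V P1 P2"
    and u: "\<And>\<rho>. 0 < \<rho> \<Longrightarrow> (u has_real_derivative u' \<rho>) (at \<rho>)"
    and v: "\<And>\<rho>. 0 < \<rho> \<Longrightarrow> (v has_real_derivative v' \<rho>) (at \<rho>)"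
    and u': "\<And>\<rho>. 0 < \<rho> \<Longrightarrow> (u' has_real_derivative u \<rho> / \<rho>\<^sup>2 - u' \<rho> / \<rho>
        - ((2 * f * U \<rho> * V \<rho> - 1) * u \<rho> + f * (U \<rho>)\<^sup>2 * v \<rho>)
        + (k * \<rho> * (U \<rho> - f * (U \<rho>)\<^sup>2 * V \<rho>) - m * deriv U \<rho>)) (at \<rho>)"
    and v': "\<And>\<rho>. 0 < \<rho> \<Longrightarrow> (v' has_real_derivative v \<rho> / \<rho>\<^sup>2 - v' \<rho> / \<rho>
        - ((1 - 2 * U \<rho> * V \<rho>) * u \<rho> + (- (U \<rho>)\<^sup>2) * v \<rho>)
        + k * \<rho> * ((U \<rho>)\<^sup>2 * V \<rho> - U \<rho>)) (at \<rho>)"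
    and top: "(u \<longlongrightarrow> 0) at_top" "(u' \<longlongrightarrow> 0) at_top"
      "((\<lambda>\<rho>. v \<rho> / \<rho>) \<longlongrightarrow> \<kappa>) at_top" "(v' \<longlongrightarrow> \<kappa>) at_top"
    and zero: "(u \<longlongrightarrow> 0) (at_right 0)" "Bfun u' (at_right 0)"
      "(v \<longlongrightarrow> 0) (at_right 0)" "Bfun v' (at_right 0)"
    and int: "set_integrable lborel {0<..} (\<lambda>\<rho>. deriv U \<rho> * P1 \<rho> * \<rho>)"
  shows "2 * (\<kappa> - k * S / 4) = - m * set_lebesgue_integral lborel {0<..} (\<lambda>\<rho>. deriv U \<rho> * P1 \<rho> * \<rho>)"
proof -
  define w1 where "w1 \<rho> = k / 4 * (\<rho>\<^sup>2 * deriv U \<rho>)" for \<rho>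
  define w2 where "w2 \<rho> = k / 4 * (\<rho>\<^sup>2 * deriv V \<rho>)" for \<rho>
  define w1' where "w1' \<rho> = k / 4 * (\<rho> * deriv U \<rho> + \<rho>\<^sup>2 * (U \<rho> - f * (U \<rho>)\<^sup>2 * V \<rho>))" for \<rho>
  define w2' where "w2' \<rho> = k / 4 * (\<rho> * deriv V \<rho> + \<rho>\<^sup>2 * ((U \<rho>)\<^sup>2 * V \<rho> - U \<rho>))" for \<rho>
  note w_derivs = geometric_corrector_derivs[OF core, of _ k,
      folded w1_def[abs_def] w2_def[abs_def] w1'_def[abs_def] w2'_def[abs_def] w1'_def w2'_def]
  define F where "F \<rho> = \<rho> * (P1 \<rho> * (u' \<rho> - w1' \<rho>) - deriv P1 \<rho> * (u \<rho> - w1 \<rho>)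
    + P2 \<rho> * (v' \<rho> - w2' \<rho>) - deriv P2 \<rho> * (v \<rho> - w2 \<rho>))" for \<rho>
  have F: "(F has_real_derivative - m * (deriv U \<rho> * P1 \<rho> * \<rho>)) (at \<rho>)" if \<rho>: "0 < \<rho>" for \<rho>
  proof -
    have y1': "((\<lambda>\<rho>. u' \<rho> - w1' \<rho>) has_real_derivative (u \<rho> - w1 \<rho>) / \<rho>\<^sup>2 - (u' \<rho> - w1' \<rho>) / \<rho>
        - ((2 * f * U \<rho> * V \<rho> - 1) * (u \<rho> - w1 \<rho>) + f * (U \<rho>)\<^sup>2 * (v \<rho> - w2 \<rho>)) + - m * deriv U \<rho>) (at \<rho>)"
      by (rule DERIV_cong[OF DERIV_diff[OF u'[OF \<rho>] w_derivs(3)[OF \<rho>]]])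
        (use \<rho> in \<open>simp add: w1_def w2_def w1'_def field_simps power2_eq_square\<close>)
    have y2': "((\<lambda>\<rho>. v' \<rho> - w2' \<rho>) has_real_derivative (v \<rho> - w2 \<rho>) / \<rho>\<^sup>2 - (v' \<rho> - w2' \<rho>) / \<rho>
        - ((1 - 2 * U \<rho> * V \<rho>) * (u \<rho> - w1 \<rho>) + (- (U \<rho>)\<^sup>2) * (v \<rho> - w2 \<rho>)) + 0) (at \<rho>)"
      by (rule DERIV_cong[OF DERIV_diff[OF v'[OF \<rho>] w_derivs(4)[OF \<rho>]]])
        (use \<rho> in \<open>simp add: w1_def w2_def w2'_def field_simps power2_eq_square\<close>)
    have P2': "(deriv P2 has_real_derivative P2 \<rho> / \<rho>\<^sup>2 - deriv P2 \<rho> / \<rho>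
      - (f * (U \<rho>)\<^sup>2 * P1 \<rho> + (- (U \<rho>)\<^sup>2) * P2 \<rho>)) (at \<rho>)"
      using adjoint_solution_derivs(4)[OF adj \<rho>] by simp
    have "(F has_real_derivative \<rho> * (P1 \<rho> * (- m * deriv U \<rho>) + P2 \<rho> * 0)) (at \<rho>)"
      unfolding F_def[abs_def]
      by (rule lagrange_identity[where y1' = "\<lambda>\<rho>. u' \<rho> - w1' \<rho>" and y2' = "\<lambda>\<rho>. v' \<rho> - w2' \<rho>",
            OF \<rho> adjoint_solution_derivs(1,2)[OF adj \<rho>]
            DERIV_diff[OF u[OF \<rho>] w_derivs(1)[OF \<rho>]] DERIV_diff[OF v[OF \<rho>] w_derivs(2)[OF \<rho>]]
            adjoint_solution_derivs(3)[OF adj \<rho>] P2' y1' y2'])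
    then show ?thesis by (simp add: mult_ac)
  qed
  \<comment> \<open>Near the origin \<open>\<rho> * deriv P1 \<rho>\<close> and
    \<open>\<rho> * deriv P2 \<rho>\<close> are merely bounded; they are multiplied by solution
    minus corrector, which tends to 0.\<close>
  have F_0: "(F \<longlongrightarrow> 0) (at_right 0)"
  proof -
    note b = core_solution_Bfun_0[OF core] core_solution_deriv_Bfun_0[OF core]
      adjoint_solution_Bfun_0[OF core adj]
    have id: "((\<lambda>\<rho>::real. \<rho>) \<longlongrightarrow> 0) (at_right 0)" by (rule tendsto_ident_at)
    have w: "(w1 \<longlongrightarrow> 0) (at_right 0)" "(w2 \<longlongrightarrow> 0) (at_right 0)"
      using tendsto_mult_zero_Bfun[OF id Bfun_mult_real[OF Bfun_const[of "k / 4"] b(3)]]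
        tendsto_mult_zero_Bfun[OF id Bfun_mult_real[OF Bfun_const[of "k / 4"] b(4)]]
      by (simp_all add: w1_def[abs_def] w2_def[abs_def] power2_eq_square mult_ac)
    have w': "Bfun w1' (at_right 0)" "Bfun w2' (at_right 0)"
      unfolding w1'_def[abs_def] w2'_def[abs_def] power2_eq_square by (intro Bfun_intros b)+
    have "((\<lambda>\<rho>. \<rho> * (P1 \<rho> * (u' \<rho> - w1' \<rho>)) - (u \<rho> - w1 \<rho>) * (\<rho> * deriv P1 \<rho>)
      + \<rho> * (P2 \<rho> * (v' \<rho> - w2' \<rho>)) - (v \<rho> - w2 \<rho>) * (\<rho> * deriv P2 \<rho>)) \<longlongrightarrow> 0 - 0 + 0 - 0) (at_right 0)"
      by (intro tendsto_diff tendsto_add tendsto_mult_zero_Bfun Bfun_intros b w' zero id)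
        (use tendsto_diff[OF zero(1) w(1)] tendsto_diff[OF zero(3) w(2)] in simp_all)
    then show ?thesis unfolding F_def[abs_def] by (simp add: algebra_simps)
  qed
  have F_top: "(F \<longlongrightarrow> 2 * (\<kappa> - k * S / 4)) at_top"
  proof -
    note d = core_solution_decay(1)[OF core, of 2] core_solution_nonlinear_decay[OF core, of 2]
      core_solution_deriv_at_top[OF core]
    note P = adjoint_solution_at_top[OF core adj]
    have inv: "((\<lambda>\<rho>::real. 1 / \<rho>) \<longlongrightarrow> 0) at_top"
      using tendsto_inverse_0_at_top[OF filterlim_ident] by (simp add: divide_inverse)
    have w1: "(w1 \<longlongrightarrow> 0) at_top"
      using tendsto_mult_right_zero[OF d(5)] unfolding w1_def[abs_def] .
    have "((\<lambda>\<rho>. k / 4 * (\<rho> * deriv V \<rho>)) \<longlongrightarrow> k / 4 * S) at_top" by (intro tendsto_intros d)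
    then have w2: "((\<lambda>\<rho>. w2 \<rho> / \<rho>) \<longlongrightarrow> k / 4 * S) at_top"
      by (rule Lim_transform_eventually)
        (use eventually_gt_at_top[of 0] in eventually_elim, simp add: w2_def power2_eq_square)
    have "((\<lambda>\<rho>. k / 4 * (1 / \<rho> * (\<rho>\<^sup>2 * deriv U \<rho>) + (\<rho>\<^sup>2 * U \<rho> - f * (\<rho>\<^sup>2 * ((U \<rho>)\<^sup>2 * V \<rho>)))))
        \<longlongrightarrow> k / 4 * (0 * 0 + (0 - f * 0))) at_top" by (intro tendsto_intros d inv)
    then have "((\<lambda>\<rho>. k / 4 * (1 / \<rho> * (\<rho>\<^sup>2 * deriv U \<rho>) + (\<rho>\<^sup>2 * U \<rho> - f * (\<rho>\<^sup>2 * ((U \<rho>)\<^sup>2 * V \<rho>)))))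
        \<longlongrightarrow> 0) at_top" by simp
    then have w1': "(w1' \<longlongrightarrow> 0) at_top"
      by (rule Lim_transform_eventually)
        (use eventually_gt_at_top[of 0] in eventually_elim, simp add: w1'_def power2_eq_square algebra_simps)
    have "((\<lambda>\<rho>. k / 4 * (\<rho> * deriv V \<rho> + (\<rho>\<^sup>2 * ((U \<rho>)\<^sup>2 * V \<rho>) - \<rho>\<^sup>2 * U \<rho>)))
        \<longlongrightarrow> k / 4 * (S + (0 - 0))) at_top" by (intro tendsto_intros d)
    then have w2': "(w2' \<longlongrightarrow> k / 4 * S) at_top"
      by (simp add: w2'_def[abs_def] algebra_simps)
    \<comment> \<open>The terms with \<open>P1\<close> vanish in the limit. Since
      \<open>\<rho> * P2 \<rho>\<close> tends to 1 and
      \<open>\<rho>\<^sup>2 * deriv P2 \<rho>\<close> to -1, the value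
      \<open>\<kappa> - k / 4 * S\<close> is counted twice.\<close>
    have "((\<lambda>\<rho>. (\<rho> * P1 \<rho>) * (u' \<rho> - w1' \<rho>) - (\<rho> * deriv P1 \<rho>) * (u \<rho> - w1 \<rho>)
      + (\<rho> * P2 \<rho>) * (v' \<rho> - w2' \<rho>) - (\<rho>\<^sup>2 * deriv P2 \<rho>) * (v \<rho> / \<rho> - w2 \<rho> / \<rho>))
      \<longlongrightarrow> 1 * (0 - 0) - 0 * (0 - 0) + 1 * (\<kappa> - k / 4 * S) - (-1) * (\<kappa> - k / 4 * S)) at_top"
      by (intro tendsto_intros P top w1 w1' w2 w2')
    then have "((\<lambda>\<rho>. (\<rho> * P1 \<rho>) * (u' \<rho> - w1' \<rho>) - (\<rho> * deriv P1 \<rho>) * (u \<rho> - w1 \<rho>)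
      + (\<rho> * P2 \<rho>) * (v' \<rho> - w2' \<rho>) - (\<rho>\<^sup>2 * deriv P2 \<rho>) * (v \<rho> / \<rho> - w2 \<rho> / \<rho>))
      \<longlongrightarrow> 2 * (\<kappa> - k * S / 4)) at_top" by simp
    then show ?thesis
      by (rule Lim_transform_eventually)
        (use eventually_gt_at_top[of 0] in eventually_elim,
          simp add: F_def power2_eq_square algebra_simps)
  qed
  have half_line: "einterval 0 \<infinity> = {0::real<..}"
    using einterval_eq(2)[of 0] by (simp only: zero_ereal_def)
  \<comment> \<open>The integrand has no known sign, hence the fundamental theorem on the half line
    is used in the form that takes integrability as a premise.\<close>
  have "(LBINT \<rho>=0..\<infinity>. - m * (deriv U \<rho> * P1 \<rho> * \<rho>)) = 2 * (\<kappa> - k * S / 4) - 0"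
  proof (rule interval_integral_FTC_integrable)
    fix \<rho> assume "0 < ereal \<rho>"
    then have \<rho>: "0 < \<rho>" by simp
    then show "(F has_vector_derivative - m * (deriv U \<rho> * P1 \<rho> * \<rho>)) (at \<rho>)"
      using F by (simp add: has_real_derivative_iff_has_vector_derivative)
    have "isCont (deriv U) \<rho>" "isCont P1 \<rho>"
      using core_solution_derivs(3)[OF core \<rho>] adjoint_solution_derivs(1)[OF adj \<rho>] DERIV_isCont by blast+
    then show "isCont (\<lambda>\<rho>. - m * (deriv U \<rho> * P1 \<rho> * \<rho>)) \<rho>" by (intro continuous_intros)
  next
    show "set_integrable lborel (einterval 0 \<infinity>) (\<lambda>\<rho>. - m * (deriv U \<rho> * P1 \<rho> * \<rho>))"
      unfolding half_line by (rule set_integrable_mult_right) (rule int)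
    show "((F \<circ> real_of_ereal) \<longlongrightarrow> 0) (at_right 0)"
      using F_0 unfolding zero_ereal_def ereal_tendsto_simps1 .
    show "((F \<circ> real_of_ereal) \<longlongrightarrow> 2 * (\<kappa> - k * S / 4)) (at_left \<infinity>)"
      using F_top unfolding ereal_tendsto_simps1 .
  qed simp
  then show ?thesis
    using set_integral_mult_right[of lborel "{0<..}" "- m" "\<lambda>\<rho>. deriv U \<rho> * P1 \<rho> * \<rho>"]
    by (simp only: interval_lebesgue_integral_def half_line)
       (simp add: zero_ereal_def[symmetric])
qed

section \<open>First angular harmonics of planar functions\<close>

lemma partials_of_has_derivative:
  assumes "(g has_derivative L) (at s)"
  shows "d1 g s = L (1, 0)" "d2 g s = L (0, 1)"
    "(g has_derivative (\<lambda>h. fst h * d1 g s + snd h * d2 g s)) (at s)"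
proof -
  have g: "(g has_derivative L) (at (fst s, snd s))" using assms by simp
  interpret L: bounded_linear L using assms by (rule has_derivative_bounded_linear)
  have "((\<lambda>a. (a, snd s)) has_derivative (\<lambda>h. (h, 0))) (at (fst s))"
    by (auto intro!: derivative_eq_intros)
  from diff_chain_at[OF this g] have deriv1: "((\<lambda>a. g (a, snd s)) has_derivative (\<lambda>h. L (h, 0))) (at (fst s))"
    by (simp add: o_def)
  have L1: "L (h, 0) = L (1, 0) * h" for h using L.scaleR[of h "(1, 0)"] by (simp add: mult.commute)
  have "(\<lambda>h. L (h, 0)) = (*) (L (1, 0))" by (rule ext) (rule L1)
  with deriv1 show 1: "d1 g s = L (1, 0)"
    unfolding d1_def by (intro DERIV_imp_deriv) (simp only: has_field_derivative_def)
  have "((\<lambda>b. (fst s, b)) has_derivative (\<lambda>h. (0, h))) (at (snd s))"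
    by (auto intro!: derivative_eq_intros)
  from diff_chain_at[OF this g] have deriv2: "((\<lambda>b. g (fst s, b)) has_derivative (\<lambda>h. L (0, h))) (at (snd s))"
    by (simp add: o_def)
  have L2: "L (0, h) = L (0, 1) * h" for h using L.scaleR[of h "(0, 1)"] by (simp add: mult.commute)
  have "(\<lambda>h. L (0, h)) = (*) (L (0, 1))" by (rule ext) (rule L2)
  with deriv2 show 2: "d2 g s = L (0, 1)"
    unfolding d2_def by (intro DERIV_imp_deriv) (simp only: has_field_derivative_def)
  have "L = (\<lambda>h. fst h * L (1, 0) + snd h * L (0, 1))"
  proof
    show "L h = fst h * L (1, 0) + snd h * L (0, 1)" for h
      using L.add[of "(fst h, 0)" "(0, snd h)"] L1[of "fst h"] L2[of "snd h"] by (simp add: mult.commute)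
  qed
  then show "(g has_derivative (\<lambda>h. fst h * d1 g s + snd h * d2 g s)) (at s)"
    unfolding 1 2 by (rule has_derivative_eq_rhs[OF assms])
qed

lemma C2_fun_partials:
  fixes g :: "real \<times> real \<Rightarrow> real"
  assumes "C2_fun g"
  shows "(g has_derivative (\<lambda>h. fst h * d1 g s + snd h * d2 g s)) (at s)"
    "(d1 g has_derivative (\<lambda>h. fst h * d1 (d1 g) s + snd h * d2 (d1 g) s)) (at s)"
    "(d2 g has_derivative (\<lambda>h. fst h * d1 (d2 g) s + snd h * d2 (d2 g) s)) (at s)"
    "continuous_on UNIV (d1 (d1 g))" "continuous_on UNIV (d2 (d1 g))"
    "continuous_on UNIV (d1 (d2 g))" "continuous_on UNIV (d2 (d2 g))"
proof -
  obtain D and D2 where D: "\<And>x. (g has_derivative blinfun_apply (D x)) (at x)"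
    and D2: "\<And>x. (D has_derivative blinfun_apply (D2 x)) (at x)" and cont: "continuous_on UNIV D2"
    using assms unfolding C2_fun_def by blast
  have d1g: "d1 g = (\<lambda>x. D x (1, 0))" and d2g: "d2 g = (\<lambda>x. D x (0, 1))"
    using partials_of_has_derivative[OF D] by blast+
  have app: "((\<lambda>x. D x e) has_derivative (\<lambda>h. D2 s h e)) (at s)" for e s
    using blinfun.bounded_linear_left[THEN bounded_linear.has_derivative, OF D2] .
  show "(g has_derivative (\<lambda>h. fst h * d1 g s + snd h * d2 g s)) (at s)"
    using partials_of_has_derivative(3)[OF D] .
  show "(d1 g has_derivative (\<lambda>h. fst h * d1 (d1 g) s + snd h * d2 (d1 g) s)) (at s)"
    "(d2 g has_derivative (\<lambda>h. fst h * d1 (d2 g) s + snd h * d2 (d2 g) s)) (at s)"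
    using partials_of_has_derivative(3)[OF app] unfolding d1g d2g by blast+
  have "d1 (\<lambda>x. D x e) = (\<lambda>s. D2 s (1, 0) e)" "d2 (\<lambda>x. D x e) = (\<lambda>s. D2 s (0, 1) e)" for e
    using partials_of_has_derivative(1,2)[OF app] by blast+
  then show "continuous_on UNIV (d1 (d1 g))" "continuous_on UNIV (d2 (d1 g))"
    "continuous_on UNIV (d1 (d2 g))" "continuous_on UNIV (d2 (d2 g))"
    unfolding d1g d2g by (auto intro!: continuous_intros cont)
qed

lemma has_real_derivative_pair_compose:
  fixes x y :: "real \<Rightarrow> real"
  assumes "(g has_derivative (\<lambda>h. fst h * p + snd h * q)) (at (x t, y t))"
    and "(x has_real_derivative x') (at t)" "(y has_real_derivative y') (at t)"
  shows "((\<lambda>t. g (x t, y t)) has_real_derivative x' * p + y' * q) (at t)"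
proof -
  have "((\<lambda>t. (x t, y t)) has_derivative (\<lambda>h. (x' * h, y' * h))) (at t)"
    using assms(2,3) unfolding has_field_derivative_def by (rule has_derivative_Pair)
  from diff_chain_at[OF this assms(1)] show ?thesis
    unfolding has_field_derivative_def o_def
    by (rule has_derivative_eq_rhs) (rule ext, simp add: algebra_simps)
qed

text \<open>First Fourier mode of a function of the angle; dividing by \<open>pi\<close> makes
  \<open>cos\<close> yield \<open>a\<close> and \<open>sin\<close> yield \<open>b\<close>. With
  \<open>a\<close>, \<open>b\<close> free, one computation serves the \<theta> component (1, 0) and
  the \<phi> component (0, 1).\<close>

definition harmonic_coeff :: "real \<Rightarrow> real \<Rightarrow> (real \<Rightarrow> real) \<Rightarrow> real" where
  "harmonic_coeff a b F = integral {0..2*pi} (\<lambda>\<omega>. (a * cos \<omega> + b * sin \<omega>) * F \<omega>) / pi"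

lemma harmonic_coeff_FTC:
  assumes "\<And>\<omega>. (H has_real_derivative (a * cos \<omega> + b * sin \<omega>) * F \<omega>) (at \<omega>)"
  shows "harmonic_coeff a b F = (H (2 * pi) - H 0) / pi"
proof -
  have "((\<lambda>\<omega>. (a * cos \<omega> + b * sin \<omega>) * F \<omega>) has_integral H (2 * pi) - H 0) {0..2*pi}"
  proof (rule fundamental_theorem_of_calculus)
    show "(H has_vector_derivative (a * cos \<omega> + b * sin \<omega>) * F \<omega>) (at \<omega> within {0..2*pi})" for \<omega>
      using has_field_derivative_at_within[OF assms]
      unfolding has_real_derivative_iff_has_vector_derivative .
  qed simp
  then show ?thesis unfolding harmonic_coeff_def by (simp add: integral_unique)
qed

lemma harmonic_coeff_moments:
  "harmonic_coeff a b (\<lambda>\<omega>. 1) = 0" "harmonic_coeff a b cos = a" "harmonic_coeff a b sin = b"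
  "harmonic_coeff a b (\<lambda>\<omega>. cos \<omega> * (sin \<omega>)\<^sup>2) = a / 4"
proof -
  have "harmonic_coeff a b (\<lambda>\<omega>. 1) = ((a * sin (2 * pi) - b * cos (2 * pi)) - (a * sin 0 - b * cos 0)) / pi"
    by (rule harmonic_coeff_FTC) (auto intro!: derivative_eq_intros)
  then show "harmonic_coeff a b (\<lambda>\<omega>. 1) = 0" by simp
  \<comment> \<open>Both shapes are needed to eliminate squares of the cosine from the right-nested
    products that \<open>algebra_simps\<close> leaves behind.\<close>
  have cc: "cos \<omega> * cos \<omega> = 1 - sin \<omega> * sin \<omega>" "cos \<omega> * (cos \<omega> * x) = (1 - sin \<omega> * sin \<omega>) * x"
    for \<omega> x :: real
    using cos_squared_eq[of \<omega>] by (metis power2_eq_square mult.assoc)+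
  let ?H = "\<lambda>\<omega>. a / 2 * (\<omega> + sin \<omega> * cos \<omega>) + b / 2 * (sin \<omega>)\<^sup>2"
  have "(?H has_real_derivative (a * cos \<omega> + b * sin \<omega>) * cos \<omega>) (at \<omega>)" for \<omega>
    by (rule DERIV_cong, (rule derivative_eq_intros refl)+)
      (simp add: power2_eq_square numeral_eq_Suc algebra_simps cc)
  then have "harmonic_coeff a b cos = (?H (2 * pi) - ?H 0) / pi" by (rule harmonic_coeff_FTC)
  then show "harmonic_coeff a b cos = a" by simp
  let ?H = "\<lambda>\<omega>. a / 2 * (sin \<omega>)\<^sup>2 + b / 2 * (\<omega> - sin \<omega> * cos \<omega>)"
  have "(?H has_real_derivative (a * cos \<omega> + b * sin \<omega>) * sin \<omega>) (at \<omega>)" for \<omega>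
    by (rule DERIV_cong, (rule derivative_eq_intros refl)+)
      (simp add: power2_eq_square numeral_eq_Suc algebra_simps cc)
  then have "harmonic_coeff a b sin = (?H (2 * pi) - ?H 0) / pi" by (rule harmonic_coeff_FTC)
  then show "harmonic_coeff a b sin = b" by simp
  \<comment> \<open>The product subtracted from \<omega> is \<open>sin (4 \<omega>) / 4\<close>, and
    \<open>1 - cos (4 \<omega>)\<close> equals 8 times the product of the squares of sine and
    cosine.\<close>
  let ?H = "\<lambda>\<omega>. a / 8 * (\<omega> - sin \<omega> * cos \<omega> * ((cos \<omega>)\<^sup>2 - (sin \<omega>)\<^sup>2)) + b / 4 * (sin \<omega>) ^ 4"
  have "(?H has_real_derivative (a * cos \<omega> + b * sin \<omega>) * (cos \<omega> * (sin \<omega>)\<^sup>2)) (at \<omega>)" for \<omega>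
    by (rule DERIV_cong, (rule derivative_eq_intros refl)+)
      (simp add: power2_eq_square numeral_eq_Suc algebra_simps cc)
  then have "harmonic_coeff a b (\<lambda>\<omega>. cos \<omega> * (sin \<omega>)\<^sup>2) = (?H (2 * pi) - ?H 0) / pi"
    by (rule harmonic_coeff_FTC)
  then show "harmonic_coeff a b (\<lambda>\<omega>. cos \<omega> * (sin \<omega>)\<^sup>2) = a / 4" by simp
qed

lemma harmonic_coeff_integrable:
  fixes F :: "real \<Rightarrow> real"
  assumes "continuous_on UNIV F"
  shows "(\<lambda>\<omega>. (a * cos \<omega> + b * sin \<omega>) * F \<omega>) integrable_on {0..2*pi}"
  by (intro integrable_continuous_interval continuous_intros continuous_on_subset[OF assms]) auto

lemma harmonic_coeff_add:
  assumes "continuous_on UNIV F" "continuous_on UNIV G"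
  shows "harmonic_coeff a b (\<lambda>\<omega>. F \<omega> + G \<omega>) = harmonic_coeff a b F + harmonic_coeff a b G"
  unfolding harmonic_coeff_def
  using integral_add[OF assms[THEN harmonic_coeff_integrable], of a b a b]
  by (simp add: distrib_left add_divide_distrib)

lemma harmonic_coeff_cmult:
  "harmonic_coeff a b (\<lambda>\<omega>. k * F \<omega>) = k * harmonic_coeff a b F"
  unfolding harmonic_coeff_def by (simp add: mult.left_commute)

lemma harmonic_coeff_diff:
  assumes "continuous_on UNIV F" "continuous_on UNIV G"
  shows "harmonic_coeff a b (\<lambda>\<omega>. F \<omega> - G \<omega>) = harmonic_coeff a b F - harmonic_coeff a b G"
  using harmonic_coeff_add[OF assms(1), of "\<lambda>\<omega>. - 1 * G \<omega>" a b] harmonic_coeff_cmult[of a b "-1" G]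
    assms(2) by (simp add: continuous_on_minus)

lemma harmonic_coeff_bound:
  assumes "\<And>\<omega>. \<bar>F \<omega>\<bar> \<le> B"
  shows "\<bar>harmonic_coeff a b F\<bar> \<le> 2 * (\<bar>a\<bar> + \<bar>b\<bar>) * B"
proof -
  let ?f = "\<lambda>\<omega>. (a * cos \<omega> + b * sin \<omega>) * F \<omega>"
  have B: "0 \<le> B" using assms[of 0] by linarith
  have "norm (integral {0..2*pi} ?f) \<le> (\<bar>a\<bar> + \<bar>b\<bar>) * B * (2 * pi)"
  \<comment> \<open>The integral of a non-integrable function is 0 by convention, so the bound needs
    no regularity of \<open>F\<close>.\<close>
  proof (cases "?f integrable_on {0..2*pi}")
    case True
    have "norm (?f \<omega>) \<le> (\<bar>a\<bar> + \<bar>b\<bar>) * B" for \<omega>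
    proof -
      have "\<bar>a * cos \<omega>\<bar> \<le> \<bar>a\<bar> * 1" "\<bar>b * sin \<omega>\<bar> \<le> \<bar>b\<bar> * 1"
        unfolding abs_mult by (intro mult_left_mono; simp)+
      then have "\<bar>a * cos \<omega> + b * sin \<omega>\<bar> \<le> \<bar>a\<bar> + \<bar>b\<bar>" by linarith
      then show ?thesis
        unfolding real_norm_def abs_mult using assms[of \<omega>] B by (intro mult_mono) auto
    qed
    then show ?thesis
      using has_integral_bound[of "(\<bar>a\<bar> + \<bar>b\<bar>) * B" ?f _ 0 "2 * pi"] True B
      by (auto simp: integrable_integral)
  qed (use B in \<open>simp add: not_integrable_integral\<close>)
  then have "\<bar>integral {0..2*pi} ?f\<bar> / pi \<le> (\<bar>a\<bar> + \<bar>b\<bar>) * B * (2 * pi) / pi"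
    by (intro divide_right_mono) auto
  then show ?thesis unfolding harmonic_coeff_def by (simp add: mult_ac)
qed

lemma norm_polar [simp]: "norm (\<rho> * cos \<omega>, \<rho> * sin \<omega>) = \<bar>\<rho>\<bar>"
proof -
  have "(\<rho> * cos \<omega>)\<^sup>2 + (\<rho> * sin \<omega>)\<^sup>2 = \<rho>\<^sup>2 * ((cos \<omega>)\<^sup>2 + (sin \<omega>)\<^sup>2)"
    by (simp only: power_mult_distrib distrib_left)
  then show ?thesis by (simp add: norm_Pair)
qed

text \<open>Limits along \<open>at_infinity\<close> are uniform in the angle and therefore survive
  the angular average. The weight \<open>k\<close> is 1 for the function itself and
  \<open>cos\<close> or \<open>sin\<close> for the two parts of a radial derivative.\<close>

lemma harmonic_coeff_at_infinity:
  fixes F :: "real \<times> real \<Rightarrow> real"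
  assumes "(F \<longlongrightarrow> 0) at_infinity" and k: "\<And>\<omega>. \<bar>k \<omega>\<bar> \<le> 1"
  shows "((\<lambda>\<rho>. harmonic_coeff a b (\<lambda>\<omega>. k \<omega> * F (\<rho> * cos \<omega>, \<rho> * sin \<omega>))) \<longlongrightarrow> 0) at_top"
proof (rule tendstoI)
  fix r :: real assume r: "0 < r"
  define q where "q = r / (2 * (\<bar>a\<bar> + \<bar>b\<bar>) + 1)"
  have q: "0 < q" "2 * (\<bar>a\<bar> + \<bar>b\<bar>) * q < r" using r by (auto simp: q_def field_simps)
  obtain R where R: "\<And>s. R \<le> norm s \<Longrightarrow> \<bar>F s\<bar> < q"
    using tendstoD[OF assms(1) q(1)] by (auto simp: eventually_at_infinity)
  have "\<bar>harmonic_coeff a b (\<lambda>\<omega>. k \<omega> * F (\<rho> * cos \<omega>, \<rho> * sin \<omega>))\<bar> < r" if "max 0 R \<le> \<rho>" for \<rho>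
  proof -
    have "\<bar>k \<omega> * F (\<rho> * cos \<omega>, \<rho> * sin \<omega>)\<bar> \<le> 1 * q" for \<omega>
      unfolding abs_mult using k R[of "(\<rho> * cos \<omega>, \<rho> * sin \<omega>)"] that by (intro mult_mono) auto
    from harmonic_coeff_bound[of "\<lambda>\<omega>. k \<omega> * F (\<rho> * cos \<omega>, \<rho> * sin \<omega>)", OF this, of a b] q(2) show ?thesis by linarith
  qed
  then show "\<forall>\<^sub>F \<rho> in at_top. dist (harmonic_coeff a b (\<lambda>\<omega>. k \<omega> * F (\<rho> * cos \<omega>, \<rho> * sin \<omega>))) 0 < r"
    unfolding eventually_at_top_linorder by (intro exI[of _ "max 0 R"]) auto
qed

lemma harmonic_coeff_derivative:
  fixes G G' :: "real \<Rightarrow> real \<Rightarrow> real"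
  assumes "\<And>\<rho> \<omega>. ((\<lambda>\<rho>. G \<rho> \<omega>) has_real_derivative G' \<rho> \<omega>) (at \<rho>)"
    and "\<And>\<rho>. continuous_on UNIV (G \<rho>)"
    and "continuous_on UNIV (\<lambda>(\<rho>, \<omega>). G' \<rho> \<omega>)"
  shows "((\<lambda>\<rho>. harmonic_coeff a b (G \<rho>)) has_real_derivative harmonic_coeff a b (G' \<rho>\<^sub>0)) (at \<rho>\<^sub>0)"
proof -
  let ?c = "\<lambda>\<omega>. a * cos \<omega> + b * sin \<omega>"
  have "((\<lambda>\<rho>. integral (cbox 0 (2 * pi)) (\<lambda>\<omega>. ?c \<omega> * G \<rho> \<omega>)) has_real_derivative
      integral (cbox 0 (2 * pi)) (\<lambda>\<omega>. ?c \<omega> * G' \<rho>\<^sub>0 \<omega>)) (at \<rho>\<^sub>0 within UNIV)"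
  proof (rule leibniz_rule_field_derivative)
    show "((\<lambda>\<rho>. ?c \<omega> * G \<rho> \<omega>) has_real_derivative ?c \<omega> * G' \<rho> \<omega>) (at \<rho> within UNIV)" for \<rho> \<omega>
      using assms(1) by (auto intro: DERIV_cmult)
    show "(\<lambda>\<omega>. ?c \<omega> * G \<rho> \<omega>) integrable_on cbox 0 (2 * pi)" for \<rho>
      using harmonic_coeff_integrable[OF assms(2)] by simp
    show "continuous_on (UNIV \<times> cbox 0 (2 * pi)) (\<lambda>(\<rho>, \<omega>). ?c \<omega> * G' \<rho> \<omega>)"
      using continuous_on_subset[OF assms(3), of "UNIV \<times> cbox 0 (2 * pi)"]
      unfolding case_prod_beta by (intro continuous_intros) auto
  qed auto
  then show ?thesis unfolding harmonic_coeff_def by (auto intro: DERIV_cdivide)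
qed

text \<open>In polar coordinates the Laplacian has the angular part
  \<open>1 / \<rho>\<^sup>2\<close> times the second angular derivative, and two integrations by
  parts over the circle turn that derivative into the factor -1 on the first mode. The polar map is
  smooth through radius 0, so the first-derivative and continuity claims hold for every real \<rho>,
  which gives regularity at the origin.\<close>

lemma harmonic_coeff_laplacian:
  fixes g :: "real \<times> real \<Rightarrow> real" and a b :: real
  assumes g: "C2_fun g"
  defines "u \<equiv> \<lambda>\<rho>. harmonic_coeff a b (\<lambda>\<omega>. g (\<rho> * cos \<omega>, \<rho> * sin \<omega>))"
    and "u' \<equiv> \<lambda>\<rho>. harmonic_coeff a b (\<lambda>\<omega>. cos \<omega> * d1 g (\<rho> * cos \<omega>, \<rho> * sin \<omega>)
      + sin \<omega> * d2 g (\<rho> * cos \<omega>, \<rho> * sin \<omega>))"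
  shows "(u has_real_derivative u' \<rho>) (at \<rho>)"
    and "0 < \<rho> \<Longrightarrow> (u' has_real_derivative u \<rho> / \<rho>\<^sup>2 - u' \<rho> / \<rho>
      + harmonic_coeff a b (\<lambda>\<omega>. lap2 g (\<rho> * cos \<omega>, \<rho> * sin \<omega>))) (at \<rho>)"
    and "isCont u' \<rho>"
proof -
  let ?e = "\<lambda>\<rho> \<omega>. (\<rho> * cos \<omega>, \<rho> * sin \<omega>) :: real \<times> real"
  note D = C2_fun_partials[OF g]
  have cont: "continuous_on UNIV g" "continuous_on UNIV (d1 g)" "continuous_on UNIV (d2 g)"
    using D(1-3) by (auto intro!: has_derivative_continuous_on)
  have cont_polar: "continuous_on UNIV (\<lambda>p. h (?e (fst p) (snd p)))" "continuous_on UNIV (\<lambda>\<omega>. h (?e r \<omega>))"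
    if "continuous_on UNIV h" for h :: "real \<times> real \<Rightarrow> real" and r
    by (rule continuous_on_compose2[OF that]; auto intro!: continuous_intros)+
  note cont2 = cont_polar[OF cont(1)] cont_polar[OF cont(2)] cont_polar[OF cont(3)]
    cont_polar[OF D(4)] cont_polar[OF D(5)] cont_polar[OF D(6)] cont_polar[OF D(7)]
  have radial: "((\<lambda>\<rho>. h (?e \<rho> \<omega>)) has_real_derivative cos \<omega> * d1 h (?e \<rho> \<omega>) + sin \<omega> * d2 h (?e \<rho> \<omega>)) (at \<rho>)"
    and angular: "((\<lambda>\<omega>. h (?e \<rho> \<omega>)) has_real_derivative
      - (\<rho> * sin \<omega>) * d1 h (?e \<rho> \<omega>) + \<rho> * cos \<omega> * d2 h (?e \<rho> \<omega>)) (at \<omega>)"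
    if "\<And>s. (h has_derivative (\<lambda>v. fst v * d1 h s + snd v * d2 h s)) (at s)" for h \<rho> \<omega>
    by (rule has_real_derivative_pair_compose[OF that]; auto intro!: derivative_eq_intros)+
  note radials = radial[OF D(1)] radial[OF D(2)] radial[OF D(3)]
  note angulars = angular[OF D(1)] angular[OF D(2)] angular[OF D(3)]
  have u: "(u has_real_derivative u' \<rho>) (at \<rho>)" for \<rho>
    unfolding u_def u'_def
    by (rule harmonic_coeff_derivative)
      (auto simp: case_prod_beta intro!: radials cont2 continuous_intros)
  then show "(u has_real_derivative u' \<rho>) (at \<rho>)" .
  define G2 where "G2 \<rho> \<omega> = cos \<omega> * (cos \<omega> * d1 (d1 g) (?e \<rho> \<omega>) + sin \<omega> * d2 (d1 g) (?e \<rho> \<omega>))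
      + sin \<omega> * (cos \<omega> * d1 (d2 g) (?e \<rho> \<omega>) + sin \<omega> * d2 (d2 g) (?e \<rho> \<omega>))" for \<rho> \<omega>
  have u': "(u' has_real_derivative harmonic_coeff a b (G2 \<rho>)) (at \<rho>)" for \<rho>
    unfolding u'_def G2_def
    by (rule harmonic_coeff_derivative)
      (auto simp: case_prod_beta intro!: DERIV_add DERIV_cmult radials cont2 continuous_intros)
  then show "isCont u' \<rho>" by (rule DERIV_isCont)
  assume \<rho>: "0 < \<rho>"
  \<comment> \<open>\<open>W\<close> is the second angular derivative of \<open>g\<close> along the
    circle of radius \<rho>; \<open>G2\<close> is the second radial one.\<close>
  define W where "W \<omega> = \<rho>\<^sup>2 * ((sin \<omega>)\<^sup>2 * d1 (d1 g) (?e \<rho> \<omega>) - sin \<omega> * cos \<omega> * (d2 (d1 g) (?e \<rho> \<omega>)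
      + d1 (d2 g) (?e \<rho> \<omega>)) + (cos \<omega>)\<^sup>2 * d2 (d2 g) (?e \<rho> \<omega>))
      - \<rho> * (cos \<omega> * d1 g (?e \<rho> \<omega>) + sin \<omega> * d2 g (?e \<rho> \<omega>))" for \<omega>
  have cont_W: "continuous_on UNIV W"
    unfolding W_def[abs_def] by (intro cont2 continuous_intros)
  let ?G = "\<lambda>\<omega>. - (\<rho> * sin \<omega>) * d1 g (?e \<rho> \<omega>) + \<rho> * cos \<omega> * d2 g (?e \<rho> \<omega>)"
  have "(?G has_real_derivative W \<omega>) (at \<omega>)" for \<omega>
    by (rule derivative_eq_intros angulars refl)+ (simp add: W_def algebra_simps power2_eq_square)
  \<comment> \<open>With \<open>c = a cos + b sin\<close> and \<open>c'' = - c\<close>, the function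
    \<open>c G - c' g\<close> has derivative \<open>c (W + g)\<close>. Its periodicity makes the
    first mode of \<open>W + g\<close> vanish.\<close>
  let ?H = "\<lambda>\<omega>. (a * cos \<omega> + b * sin \<omega>) * ?G \<omega> - (- a * sin \<omega> + b * cos \<omega>) * g (?e \<rho> \<omega>)"
  have "harmonic_coeff a b (\<lambda>\<omega>. W \<omega> + g (?e \<rho> \<omega>)) = (?H (2 * pi) - ?H 0) / pi"
  proof (rule harmonic_coeff_FTC)
    fix \<omega>
    have G: "(?G has_real_derivative W \<omega>) (at \<omega>)" by fact
    show "(?H has_real_derivative (a * cos \<omega> + b * sin \<omega>) * (W \<omega> + g (?e \<rho> \<omega>))) (at \<omega>)"
      by (rule derivative_eq_intros G angulars(1) refl)+ (simp add: algebra_simps)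
  qed
  then have W: "harmonic_coeff a b W + u \<rho> = 0"
    unfolding u_def using harmonic_coeff_add[OF cont_W cont2(2), of a b] by simp
  have "\<rho>\<^sup>2 * lap2 g (?e \<rho> \<omega>) = \<rho>\<^sup>2 * G2 \<rho> \<omega> + (\<rho> * (cos \<omega> * d1 g (?e \<rho> \<omega>) + sin \<omega> * d2 g (?e \<rho> \<omega>)) + W \<omega>)" for \<omega>
  proof -
    have "\<rho>\<^sup>2 * lap2 g (?e \<rho> \<omega>) = \<rho>\<^sup>2 * (((cos \<omega>)\<^sup>2 + (sin \<omega>)\<^sup>2) * (d1 (d1 g) (?e \<rho> \<omega>) + d2 (d2 g) (?e \<rho> \<omega>)))"
      by (simp add: lap2_def)
    then show ?thesis unfolding G2_def W_def by (simp only: power2_eq_square algebra_simps)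
  qed
  moreover define B where "B \<omega> = cos \<omega> * d1 g (?e \<rho> \<omega>) + sin \<omega> * d2 g (?e \<rho> \<omega>)" for \<omega>
  ultimately have "\<rho>\<^sup>2 * harmonic_coeff a b (\<lambda>\<omega>. lap2 g (?e \<rho> \<omega>)) =
      harmonic_coeff a b (\<lambda>\<omega>. \<rho>\<^sup>2 * G2 \<rho> \<omega> + (\<rho> * B \<omega> + W \<omega>))"
    by (simp flip: harmonic_coeff_cmult)
  also have "\<dots> = \<rho>\<^sup>2 * harmonic_coeff a b (G2 \<rho>) + (\<rho> * harmonic_coeff a b B + harmonic_coeff a b W)"
  proof -
    have "continuous_on UNIV (G2 \<rho>)" "continuous_on UNIV B"
      unfolding G2_def[abs_def] B_def[abs_def] by (intro cont2 continuous_intros)+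
    then show ?thesis using cont_W
      by (simp add: harmonic_coeff_add harmonic_coeff_cmult continuous_on_add continuous_on_mult_left)
  qed
  also have "harmonic_coeff a b B = u' \<rho>" unfolding u'_def B_def[abs_def] ..
  finally have "harmonic_coeff a b (G2 \<rho>) = u \<rho> / \<rho>\<^sup>2 - u' \<rho> / \<rho>
      + harmonic_coeff a b (\<lambda>\<omega>. lap2 g (?e \<rho> \<omega>))"
    using W \<rho> by (simp add: field_simps power2_eq_square)
  then show "(u' has_real_derivative u \<rho> / \<rho>\<^sup>2 - u' \<rho> / \<rho>
      + harmonic_coeff a b (\<lambda>\<omega>. lap2 g (?e \<rho> \<omega>))) (at \<rho>)"
    using u' by metis
qed

section \<open>The order-\<open>\<epsilon>\<close> inner problem\<close>

lemma eventually_pair_neq_0: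
  assumes "(x, y) \<noteq> (0 :: real \<times> real)"
  shows "\<forall>\<^sub>F t in nhds x. (t, y) \<noteq> 0" "\<forall>\<^sub>F t in nhds y. (x, t) \<noteq> 0"
proof -
  have "((\<lambda>t. (t, y)) \<longlongrightarrow> (x, y)) (nhds x)" "((\<lambda>t. (x, t)) \<longlongrightarrow> (x, y)) (nhds y)"
    by (intro tendsto_Pair filterlim_ident tendsto_const)+
  then show "\<forall>\<^sub>F t in nhds x. (t, y) \<noteq> 0" "\<forall>\<^sub>F t in nhds y. (x, t) \<noteq> 0"
    using assms by (auto dest: tendsto_imp_eventually_ne)
qed

text \<open>A derivative sees only nearby values, and the complement of the origin is open. Formulas
  for radial profiles and the functions in the matching condition are available only there.\<close>

lemma partials_cong_away_from_0:
  assumes "\<And>s. s \<noteq> 0 \<Longrightarrow> g s = h s" "s \<noteq> 0"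
  shows "d1 g s = d1 h s" "d2 g s = d2 h s"
proof -
  have s: "(fst s, snd s) \<noteq> 0" using assms(2) by simp
  show "d1 g s = d1 h s" unfolding d1_def
    by (rule deriv_cong_ev[OF eventually_mono[OF eventually_pair_neq_0(1)[OF s]] refl]) (rule assms(1))
  show "d2 g s = d2 h s" unfolding d2_def
    by (rule deriv_cong_ev[OF eventually_mono[OF eventually_pair_neq_0(2)[OF s]] refl]) (rule assms(1))
qed

lemma norm_partial_derivs:
  assumes "(x, y) \<noteq> (0 :: real \<times> real)"
  shows "((\<lambda>t. norm (t, y)) has_real_derivative x / norm (x, y)) (at x)"
    "((\<lambda>t. norm (x, t)) has_real_derivative y / norm (x, y)) (at y)"
proof -
  have "x\<^sup>2 + y\<^sup>2 > 0" using assms by (auto simp: sum_power2_gt_zero_iff zero_prod_def)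
  then show "((\<lambda>t. norm (t, y)) has_real_derivative x / norm (x, y)) (at x)"
    "((\<lambda>t. norm (x, t)) has_real_derivative y / norm (x, y)) (at y)"
    by (auto simp: norm_Pair intro!: derivative_eq_intros simp: field_simps)
qed

lemma radial_partials:
  assumes U: "\<And>r. 0 < r \<Longrightarrow> (U has_real_derivative U' r) (at r)"
    and U': "\<And>r. 0 < r \<Longrightarrow> (U' has_real_derivative U'' r) (at r)"
    and s: "s \<noteq> 0"
  shows "d1 (\<lambda>s. U (norm s)) s = U' (norm s) * (fst s / norm s)"
    "d2 (\<lambda>s. U (norm s)) s = U' (norm s) * (snd s / norm s)"
    "d2 (d2 (\<lambda>s. U (norm s))) s = U'' (norm s) * (snd s / norm s)\<^sup>2
      + U' (norm s) * (1 - (snd s / norm s)\<^sup>2) / norm s"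
proof -
  have 1: "d1 (\<lambda>s. U (norm s)) s = U' (norm s) * (fst s / norm s)"
    and 2: "d2 (\<lambda>s. U (norm s)) s = U' (norm s) * (snd s / norm s)" if "s \<noteq> 0" for s
  proof -
    have s: "(fst s, snd s) \<noteq> 0" "0 < norm (fst s, snd s)" using that by simp_all
    show "d1 (\<lambda>s. U (norm s)) s = U' (norm s) * (fst s / norm s)"
      unfolding d1_def using DERIV_chain2[OF U[OF s(2)] norm_partial_derivs(1)[OF s(1)]]
      by (intro DERIV_imp_deriv) simp
    show "d2 (\<lambda>s. U (norm s)) s = U' (norm s) * (snd s / norm s)"
      unfolding d2_def using DERIV_chain2[OF U[OF s(2)] norm_partial_derivs(2)[OF s(1)]]
      by (intro DERIV_imp_deriv) simp
  qed
  show "d1 (\<lambda>s. U (norm s)) s = U' (norm s) * (fst s / norm s)"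
    "d2 (\<lambda>s. U (norm s)) s = U' (norm s) * (snd s / norm s)"
    using 1[OF s] 2[OF s] by auto
  obtain x y where xy: "s = (x, y)" by fastforce
  have s': "(x, y) \<noteq> 0" "0 < norm (x, y)" using s xy by simp_all
  have "d2 (d2 (\<lambda>s. U (norm s))) s = d2 (\<lambda>s. U' (norm s) * (snd s / norm s)) s"
    by (rule partials_cong_away_from_0(2)[OF 2 s])
  also have "\<dots> = U'' (norm s) * (snd s / norm s)\<^sup>2 + U' (norm s) * (1 - (snd s / norm s)\<^sup>2) / norm s"
    unfolding d2_def xy fst_conv snd_conv
  proof (rule DERIV_imp_deriv)
    show "((\<lambda>t. U' (norm (x, t)) * (t / norm (x, t))) has_real_derivative
      U'' (norm (x, y)) * (y / norm (x, y))\<^sup>2 + U' (norm (x, y)) * (1 - (y / norm (x, y))\<^sup>2) / norm (x, y)) (at y)"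
      by (rule DERIV_cong, rule DERIV_mult[OF DERIV_chain2[OF U'[OF s'(2)] norm_partial_derivs(2)[OF s'(1)]]
            DERIV_divide[OF DERIV_ident norm_partial_derivs(2)[OF s'(1)]]])
        (use s' in \<open>simp_all add: field_simps power2_eq_square\<close>)
  qed
  finally show "d2 (d2 (\<lambda>s. U (norm s))) s = U'' (norm s) * (snd s / norm s)\<^sup>2
      + U' (norm s) * (1 - (snd s / norm s)\<^sup>2) / norm s" .
qed

lemma polar_neq_0: "0 < (\<rho> :: real) \<Longrightarrow> (\<rho> * cos \<omega>, \<rho> * sin \<omega>) \<noteq> 0"
  using norm_polar[of \<rho> \<omega>] by (metis abs_of_pos less_irrefl norm_zero)

text \<open>\<open>N\<close> is the planar Laplacian of the radial function, used to eliminate the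
  second derivative of \<open>U\<close>. This prepares a cancellation: \<open>cos \<omega>\<close>
  has first mode \<open>a\<close> and \<open>cos \<omega> * (sin \<omega>)\<^sup>2\<close> has
  \<open>a / 4\<close>, so the terms in \<open>U'\<close> annihilate each other and only
  \<open>- a * \<rho> * N \<rho> / 2\<close> is left.\<close>

lemma harmonic_coeff_curvature_term:
  assumes U: "\<And>r. 0 < r \<Longrightarrow> (U has_real_derivative U' r) (at r)"
    and U': "\<And>r. 0 < r \<Longrightarrow> (U' has_real_derivative N r - U' r / r) (at r)"
    and \<rho>: "0 < \<rho>"
  defines "g \<equiv> \<lambda>s :: real \<times> real. U (norm s)"
  shows "d1 g (\<rho> * cos \<omega>, \<rho> * sin \<omega>) - 2 * (\<rho> * cos \<omega>) * d2 (d2 g) (\<rho> * cos \<omega>, \<rho> * sin \<omega>)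
      = - U' \<rho> * cos \<omega> - 2 * (\<rho> * N \<rho> - 2 * U' \<rho>) * (cos \<omega> * (sin \<omega>)\<^sup>2)"
    and "d1 g (\<rho> * cos \<omega>, \<rho> * sin \<omega>) = U' \<rho> * cos \<omega>"
    and "d2 g (\<rho> * cos \<omega>, \<rho> * sin \<omega>) = U' \<rho> * sin \<omega>"
proof -
  note * = radial_partials[OF U U' polar_neq_0[OF \<rho>], of \<omega>, folded g_def]
  show "d1 g (\<rho> * cos \<omega>, \<rho> * sin \<omega>) = U' \<rho> * cos \<omega>" "d2 g (\<rho> * cos \<omega>, \<rho> * sin \<omega>) = U' \<rho> * sin \<omega>"
    using * \<rho> by simp_all
  show "d1 g (\<rho> * cos \<omega>, \<rho> * sin \<omega>) - 2 * (\<rho> * cos \<omega>) * d2 (d2 g) (\<rho> * cos \<omega>, \<rho> * sin \<omega>)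
      = - U' \<rho> * cos \<omega> - 2 * (\<rho> * N \<rho> - 2 * U' \<rho>) * (cos \<omega> * (sin \<omega>)\<^sup>2)"
  proof -
    have dd: "d2 (d2 g) (\<rho> * cos \<omega>, \<rho> * sin \<omega>)
        = (N \<rho> - U' \<rho> / \<rho>) * (sin \<omega>)\<^sup>2 + U' \<rho> * (1 - (sin \<omega>)\<^sup>2) / \<rho>"
      using *(3) \<rho> by simp
    show ?thesis unfolding dd using *(1) \<rho> by (simp add: field_simps power2_eq_square)
  qed
qed

lemma continuous_on_polar:
  fixes h :: "real \<times> real \<Rightarrow> 'a::topological_space"
  assumes "continuous_on UNIV h"
  shows "continuous_on UNIV (\<lambda>\<omega>. h (\<rho> * cos \<omega>, \<rho> * sin \<omega>))"
  by (rule continuous_on_compose2[OF assms]) (auto intro!: continuous_intros)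

text \<open>Serves both components: \<open>W\<close> is a core profile, \<open>mu\<close> and
  \<open>mv\<close> form a row of the core matrix, and \<open>p\<close>, \<open>q\<close> are the
  two velocities, taken as 0 in the equation for \<open>v\<close>.\<close>

lemma harmonic_coeff_inner_problem:
  fixes U1 V1 :: "real \<times> real \<Rightarrow> real"
  assumes C2: "C2_fun U1" "C2_fun V1"
    and W: "\<And>r. 0 < r \<Longrightarrow> (W has_real_derivative W' r) (at r)"
    and W': "\<And>r. 0 < r \<Longrightarrow> (W' has_real_derivative N r - W' r / r) (at r)"
    and lap: "\<And>s. lap2 g s = - (mu (norm s) * U1 s + mv (norm s) * V1 s)
      - ct * (d1 (\<lambda>s. W (norm s)) s - 2 * fst s * d2 (d2 (\<lambda>s. W (norm s))) s)
      - (p * d1 (\<lambda>s. W (norm s)) s + q * d2 (\<lambda>s. W (norm s)) s)"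
    and \<rho>: "0 < \<rho>"
  shows "harmonic_coeff a b (\<lambda>\<omega>. lap2 g (\<rho> * cos \<omega>, \<rho> * sin \<omega>)) =
    - (mu \<rho> * harmonic_coeff a b (\<lambda>\<omega>. U1 (\<rho> * cos \<omega>, \<rho> * sin \<omega>))
      + mv \<rho> * harmonic_coeff a b (\<lambda>\<omega>. V1 (\<rho> * cos \<omega>, \<rho> * sin \<omega>)))
    + (a * ct / 2 * \<rho> * N \<rho> - (a * p + b * q) * W' \<rho>)"
proof -
  let ?U = "\<lambda>\<omega>. U1 (\<rho> * cos \<omega>, \<rho> * sin \<omega>)" and ?V = "\<lambda>\<omega>. V1 (\<rho> * cos \<omega>, \<rho> * sin \<omega>)"
  note curv = harmonic_coeff_curvature_term[OF W W' \<rho>]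
  have cont: "continuous_on UNIV ?U" "continuous_on UNIV ?V"
    by (rule continuous_on_polar, rule has_derivative_continuous_on, rule C2[THEN C2_fun_partials(1)])+
  have eq: "(\<lambda>\<omega>. lap2 g (\<rho> * cos \<omega>, \<rho> * sin \<omega>)) = (\<lambda>\<omega>. - mu \<rho> * ?U \<omega> + (- mv \<rho> * ?V \<omega>
      + ((ct - p) * W' \<rho> * cos \<omega> + (- q * W' \<rho> * sin \<omega>
      + 2 * ct * (\<rho> * N \<rho> - 2 * W' \<rho>) * (cos \<omega> * (sin \<omega>)\<^sup>2)))))"
    by (rule ext) (simp only: lap fst_conv norm_polar abs_of_pos[OF \<rho>] curv(1),
      simp only: curv(2,3), simp add: algebra_simps)
  have cont': "continuous_on UNIV (\<lambda>\<omega>::real. k * cos \<omega>)" "continuous_on UNIV (\<lambda>\<omega>::real. k * sin \<omega>)"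
    "continuous_on UNIV (\<lambda>\<omega>::real. k * (cos \<omega> * (sin \<omega>)\<^sup>2))" for k
    by (intro continuous_intros)+
  show ?thesis unfolding eq
    by (simp only: harmonic_coeff_add cont cont' continuous_on_mult_left continuous_on_add
        harmonic_coeff_cmult harmonic_coeff_moments) (simp add: field_simps)
qed

text \<open>Order-\<epsilon> part of the outer solution at a spot. The term in \<open>k\<close> is
  the curvature correction to the spot's own logarithm, the linear terms are the gradient of the
  potential of the other spots, and \<open>c\<close> is the order-\<epsilon> part of the additive
  constant.\<close>

definition outer_local :: "real \<Rightarrow> real \<Rightarrow> real \<Rightarrow> real \<Rightarrow> real \<times> real \<Rightarrow> real" where
  "outer_local k \<alpha>1 \<alpha>2 c s =
     k * (fst s * (snd s)\<^sup>2 / ((fst s)\<^sup>2 + (snd s)\<^sup>2)) + \<alpha>1 * fst s + \<alpha>2 * snd s + c"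

lemma outer_local_polar:
  assumes "0 < \<rho>"
  shows "outer_local k \<alpha>1 \<alpha>2 c (\<rho> * cos \<omega>, \<rho> * sin \<omega>) =
      \<rho> * (k * (cos \<omega> * (sin \<omega>)\<^sup>2) + (\<alpha>1 * cos \<omega> + \<alpha>2 * sin \<omega>)) + c * 1"
    and "d1 (outer_local k \<alpha>1 \<alpha>2 c) (\<rho> * cos \<omega>, \<rho> * sin \<omega>) =
      k * ((sin \<omega>)\<^sup>2 - 2 * (cos \<omega>)\<^sup>2 * (sin \<omega>)\<^sup>2) + \<alpha>1"
    and "d2 (outer_local k \<alpha>1 \<alpha>2 c) (\<rho> * cos \<omega>, \<rho> * sin \<omega>) =
      k * (2 * cos \<omega> * sin \<omega> - 2 * cos \<omega> * (sin \<omega>) ^ 3) + \<alpha>2"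
proof -
  have D: "(\<rho> * cos \<omega>)\<^sup>2 + (\<rho> * sin \<omega>)\<^sup>2 = \<rho>\<^sup>2"
    using norm_polar[of \<rho> \<omega>] by (simp add: norm_Pair real_sqrt_eq_iff[of _ "\<rho>\<^sup>2", symmetric] del: norm_polar)
  have ne: "(\<rho> * cos \<omega>)\<^sup>2 + (\<rho> * sin \<omega>)\<^sup>2 \<noteq> 0" unfolding D using assms by simp
  show "outer_local k \<alpha>1 \<alpha>2 c (\<rho> * cos \<omega>, \<rho> * sin \<omega>) =
      \<rho> * (k * (cos \<omega> * (sin \<omega>)\<^sup>2) + (\<alpha>1 * cos \<omega> + \<alpha>2 * sin \<omega>)) + c * 1"
    unfolding outer_local_def fst_conv snd_conv D using assms
    by (simp add: field_simps power2_eq_square)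
  have "((\<lambda>x. k * (x * y\<^sup>2 / (x\<^sup>2 + y\<^sup>2)) + \<alpha>1 * x + \<alpha>2 * y + c) has_real_derivative
      k * ((y\<^sup>2 * (x\<^sup>2 + y\<^sup>2) - x * y\<^sup>2 * (2 * x)) / ((x\<^sup>2 + y\<^sup>2) * (x\<^sup>2 + y\<^sup>2))) + \<alpha>1) (at x)"
    "((\<lambda>y. k * (x * y\<^sup>2 / (x\<^sup>2 + y\<^sup>2)) + \<alpha>1 * x + \<alpha>2 * y + c) has_real_derivative
      k * ((x * (2 * y) * (x\<^sup>2 + y\<^sup>2) - x * y\<^sup>2 * (2 * y)) / ((x\<^sup>2 + y\<^sup>2) * (x\<^sup>2 + y\<^sup>2))) + \<alpha>2) (at y)"
    if "x\<^sup>2 + y\<^sup>2 \<noteq> 0" for x y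
    using that by (auto intro!: derivative_eq_intros) (simp_all add: algebra_simps)
  from this[OF ne] have polar: "d1 (outer_local k \<alpha>1 \<alpha>2 c) (\<rho> * cos \<omega>, \<rho> * sin \<omega>) =
      k * (((\<rho> * sin \<omega>)\<^sup>2 * \<rho>\<^sup>2 - \<rho> * cos \<omega> * (\<rho> * sin \<omega>)\<^sup>2 * (2 * (\<rho> * cos \<omega>))) / (\<rho>\<^sup>2 * \<rho>\<^sup>2)) + \<alpha>1"
    "d2 (outer_local k \<alpha>1 \<alpha>2 c) (\<rho> * cos \<omega>, \<rho> * sin \<omega>) =
      k * ((\<rho> * cos \<omega> * (2 * (\<rho> * sin \<omega>)) * \<rho>\<^sup>2
        - \<rho> * cos \<omega> * (\<rho> * sin \<omega>)\<^sup>2 * (2 * (\<rho> * sin \<omega>))) / (\<rho>\<^sup>2 * \<rho>\<^sup>2)) + \<alpha>2"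
    unfolding d1_def d2_def outer_local_def fst_conv snd_conv D by (blast intro: DERIV_imp_deriv)+
  show "d1 (outer_local k \<alpha>1 \<alpha>2 c) (\<rho> * cos \<omega>, \<rho> * sin \<omega>) =
      k * ((sin \<omega>)\<^sup>2 - 2 * (cos \<omega>)\<^sup>2 * (sin \<omega>)\<^sup>2) + \<alpha>1"
    "d2 (outer_local k \<alpha>1 \<alpha>2 c) (\<rho> * cos \<omega>, \<rho> * sin \<omega>) =
      k * (2 * cos \<omega> * sin \<omega> - 2 * cos \<omega> * (sin \<omega>) ^ 3) + \<alpha>2"
    unfolding polar using assms by (simp_all add: field_simps power2_eq_square power3_eq_cube)
qed

lemma far_field_agrees_cong:
  assumes "far_field_agrees w g h" "\<And>s. s \<noteq> 0 \<Longrightarrow> h s = h' s"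
  shows "far_field_agrees w g h'"
proof -
  have ev: "\<forall>\<^sub>F s in at_infinity. (s :: real \<times> real) \<noteq> 0"
    unfolding eventually_at_infinity by (intro exI[of _ 1]) auto
  have "\<forall>\<^sub>F s in at_infinity. (g s - h s) / w s = (g s - h' s) / w s"
    "\<forall>\<^sub>F s in at_infinity. d1 g s - d1 h s = d1 g s - d1 h' s"
    "\<forall>\<^sub>F s in at_infinity. d2 g s - d2 h s = d2 g s - d2 h' s"
    using ev by (eventually_elim; simp add: assms(2) partials_cong_away_from_0[OF assms(2)])+
  then show ?thesis
    using assms(1) unfolding far_field_agrees_def by (auto intro: Lim_transform_eventually)
qed

text \<open>Up to the constant \<open>c\<close>, which has no first harmonic,
  \<open>outer_local\<close> is homogeneous of degree one; hence the quotient by \<rho> and the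
  radial derivative share their limit. The former follows from the far-field relation, the latter
  from its differentiated form.\<close>

lemma harmonic_coeff_far_field:
  fixes g :: "real \<times> real \<Rightarrow> real"
  assumes g: "C2_fun g" and ff: "far_field_agrees norm g (outer_local k \<alpha>1 \<alpha>2 c)"
  shows "((\<lambda>\<rho>. harmonic_coeff a b (\<lambda>\<omega>. g (\<rho> * cos \<omega>, \<rho> * sin \<omega>)) / \<rho>) \<longlongrightarrow> a * k / 4 + (a * \<alpha>1 + b * \<alpha>2)) at_top"
    and "((\<lambda>\<rho>. harmonic_coeff a b (\<lambda>\<omega>. cos \<omega> * d1 g (\<rho> * cos \<omega>, \<rho> * sin \<omega>)
      + sin \<omega> * d2 g (\<rho> * cos \<omega>, \<rho> * sin \<omega>))) \<longlongrightarrow> a * k / 4 + (a * \<alpha>1 + b * \<alpha>2)) at_top"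
proof -
  let ?h = "outer_local k \<alpha>1 \<alpha>2 c"
  define \<kappa> where "\<kappa> = a * k / 4 + (a * \<alpha>1 + b * \<alpha>2)"
  let ?e = "\<lambda>\<rho> \<omega>. (\<rho> * cos \<omega>, \<rho> * sin \<omega>) :: real \<times> real"
  let ?m = "\<lambda>\<omega>. k * (cos \<omega> * (sin \<omega>)\<^sup>2) + (\<alpha>1 * cos \<omega> + \<alpha>2 * sin \<omega>) :: real"
  have cont_m: "continuous_on UNIV ?m" by (intro continuous_intros)
  have cont': "continuous_on UNIV (\<lambda>\<omega>::real. k * cos \<omega>)" "continuous_on UNIV (\<lambda>\<omega>::real. k * sin \<omega>)"
    "continuous_on UNIV (\<lambda>\<omega>::real. k * (cos \<omega> * (sin \<omega>)\<^sup>2))" for k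
    by (intro continuous_intros)+
  have m: "harmonic_coeff a b ?m = \<kappa>"
    by (simp only: harmonic_coeff_add cont' continuous_on_add harmonic_coeff_cmult harmonic_coeff_moments)
      (simp add: \<kappa>_def algebra_simps)
  note D = C2_fun_partials[OF g]
  have cont: "continuous_on UNIV g" "continuous_on UNIV (d1 g)" "continuous_on UNIV (d2 g)"
    by (rule has_derivative_continuous_on, rule D)+
  note cont = this[THEN continuous_on_polar]
  have "((\<lambda>\<rho>. harmonic_coeff a b (\<lambda>\<omega>. 1 * ((g (?e \<rho> \<omega>) - ?h (?e \<rho> \<omega>)) / norm (?e \<rho> \<omega>)))) \<longlongrightarrow> 0) at_top"
    using ff unfolding far_field_agrees_def
    by (intro harmonic_coeff_at_infinity[of "\<lambda>s. (g s - ?h s) / norm s"]) auto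
  then have "((\<lambda>\<rho>. harmonic_coeff a b (\<lambda>\<omega>. 1 * ((g (?e \<rho> \<omega>) - ?h (?e \<rho> \<omega>)) / norm (?e \<rho> \<omega>))) + \<kappa>) \<longlongrightarrow> 0 + \<kappa>) at_top"
    by (intro tendsto_add tendsto_const)
  then show "((\<lambda>\<rho>. harmonic_coeff a b (\<lambda>\<omega>. g (?e \<rho> \<omega>)) / \<rho>) \<longlongrightarrow> a * k / 4 + (a * \<alpha>1 + b * \<alpha>2)) at_top"
    unfolding \<kappa>_def[symmetric] add_0
  proof (rule Lim_transform_eventually)
    show "\<forall>\<^sub>F \<rho> in at_top. harmonic_coeff a b (\<lambda>\<omega>. 1 * ((g (?e \<rho> \<omega>) - ?h (?e \<rho> \<omega>)) / norm (?e \<rho> \<omega>))) + \<kappa>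
      = harmonic_coeff a b (\<lambda>\<omega>. g (?e \<rho> \<omega>)) / \<rho>"
      using eventually_gt_at_top[of 0]
    proof eventually_elim
      case (elim \<rho>)
      have "(\<lambda>\<omega>. 1 * ((g (?e \<rho> \<omega>) - ?h (?e \<rho> \<omega>)) / norm (?e \<rho> \<omega>))) =
          (\<lambda>\<omega>. 1 / \<rho> * g (?e \<rho> \<omega>) - (?m \<omega> + c / \<rho> * 1))"
        using elim by (simp add: outer_local_polar[OF elim] field_simps)
      moreover have "harmonic_coeff a b (\<lambda>\<omega>. 1 / \<rho> * g (?e \<rho> \<omega>) - (?m \<omega> + c / \<rho> * 1))
          = 1 / \<rho> * harmonic_coeff a b (\<lambda>\<omega>. g (?e \<rho> \<omega>)) - (\<kappa> + c / \<rho> * 0)"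
        unfolding m[symmetric] harmonic_coeff_moments(1)[of a b, symmetric] harmonic_coeff_cmult[symmetric]
        by (subst harmonic_coeff_add[symmetric] harmonic_coeff_diff[symmetric]; (intro continuous_intros cont(1))?)+ simp
      ultimately show ?case by simp
    qed
  qed
  have "((\<lambda>\<rho>. harmonic_coeff a b (\<lambda>\<omega>. cos \<omega> * (d1 g (?e \<rho> \<omega>) - d1 ?h (?e \<rho> \<omega>)))
      + harmonic_coeff a b (\<lambda>\<omega>. sin \<omega> * (d2 g (?e \<rho> \<omega>) - d2 ?h (?e \<rho> \<omega>))) + \<kappa>) \<longlongrightarrow> 0 + 0 + \<kappa>) at_top"
    using ff unfolding far_field_agrees_def
    by (intro tendsto_add tendsto_const harmonic_coeff_at_infinity[of "\<lambda>s. d1 g s - d1 ?h s"]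
        harmonic_coeff_at_infinity[of "\<lambda>s. d2 g s - d2 ?h s"]) auto
  then show "((\<lambda>\<rho>. harmonic_coeff a b (\<lambda>\<omega>. cos \<omega> * d1 g (?e \<rho> \<omega>) + sin \<omega> * d2 g (?e \<rho> \<omega>)))
      \<longlongrightarrow> a * k / 4 + (a * \<alpha>1 + b * \<alpha>2)) at_top"
    unfolding \<kappa>_def[symmetric] add_0
  proof (rule Lim_transform_eventually)
    show "\<forall>\<^sub>F \<rho> in at_top. harmonic_coeff a b (\<lambda>\<omega>. cos \<omega> * (d1 g (?e \<rho> \<omega>) - d1 ?h (?e \<rho> \<omega>)))
      + harmonic_coeff a b (\<lambda>\<omega>. sin \<omega> * (d2 g (?e \<rho> \<omega>) - d2 ?h (?e \<rho> \<omega>))) + \<kappa>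
      = harmonic_coeff a b (\<lambda>\<omega>. cos \<omega> * d1 g (?e \<rho> \<omega>) + sin \<omega> * d2 g (?e \<rho> \<omega>))"
      using eventually_gt_at_top[of 0]
    proof eventually_elim
      case (elim \<rho>)
      \<comment> \<open>Euler's relation for homogeneous functions: the radial derivative of
        \<open>outer_local\<close> is its angular profile \<open>?m\<close>.\<close>
      have eq: "cos \<omega> * (d1 g (?e \<rho> \<omega>) - d1 ?h (?e \<rho> \<omega>)) + sin \<omega> * (d2 g (?e \<rho> \<omega>) - d2 ?h (?e \<rho> \<omega>)) + ?m \<omega>
        = cos \<omega> * d1 g (?e \<rho> \<omega>) + sin \<omega> * d2 g (?e \<rho> \<omega>)" for \<omega>
      proof -
        have "k * 2 * cos \<omega> * (sin \<omega>)\<^sup>2 * ((cos \<omega>)\<^sup>2 + (sin \<omega>)\<^sup>2) = k * 2 * cos \<omega> * (sin \<omega>)\<^sup>2" by simp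
        then have "k * (cos \<omega> * ((sin \<omega>)\<^sup>2 - 2 * (cos \<omega>)\<^sup>2 * (sin \<omega>)\<^sup>2)
            + sin \<omega> * (2 * cos \<omega> * sin \<omega> - 2 * cos \<omega> * (sin \<omega>) ^ 3)) = k * (cos \<omega> * (sin \<omega>)\<^sup>2)"
          unfolding power2_eq_square power3_eq_cube by argo
        then show ?thesis unfolding outer_local_polar[OF elim] by (simp add: algebra_simps)
      qed
      have cont_diff: "continuous_on UNIV (\<lambda>\<omega>. cos \<omega> * (d1 g (?e \<rho> \<omega>) - d1 ?h (?e \<rho> \<omega>)))"
        "continuous_on UNIV (\<lambda>\<omega>. sin \<omega> * (d2 g (?e \<rho> \<omega>) - d2 ?h (?e \<rho> \<omega>)))"
        unfolding outer_local_polar[OF elim] by (intro continuous_intros cont)+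
      from harmonic_coeff_add[OF continuous_on_add[OF cont_diff] cont_m, of a b]
      show ?case unfolding harmonic_coeff_add[OF cont_diff] eq m by simp
    qed
  qed
qed

lemma planar_solvability:
  assumes core: "core_solution f S U V c" and adj: "adjoint_solution f U V P1 P2"
    and C2: "C2_fun U1" "C2_fun V1"
    and eq: "\<And>s. (vector [lap2 U1 s, lap2 V1 s] :: real^2)
          + core_matrix f U V (norm s) *v vector [U1 s, V1 s] =
        - ct *\<^sub>R vector [d1 (\<lambda>s. U (norm s)) s - 2 * fst s * d2 (d2 (\<lambda>s. U (norm s))) s,
                        d1 (\<lambda>s. V (norm s)) s - 2 * fst s * d2 (d2 (\<lambda>s. V (norm s))) s]
        - vector [p * d1 (\<lambda>s. U (norm s)) s + q * d2 (\<lambda>s. U (norm s)) s, 0]"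
    and ff: "far_field_agrees (\<lambda>s. 1) U1 (\<lambda>s. 0)"
      "far_field_agrees norm V1 (outer_local (S * ct / 2) \<alpha>1 \<alpha>2 c1)"
    and int: "set_integrable lborel {0<..} (\<lambda>\<rho>. deriv U \<rho> * P1 \<rho> * \<rho>)"
  shows "2 * (a * \<alpha>1 + b * \<alpha>2) =
    - (a * p + b * q) * set_lebesgue_integral lborel {0<..} (\<lambda>\<rho>. deriv U \<rho> * P1 \<rho> * \<rho>)"
proof -
  have lapU: "lap2 U1 s = - ((2 * f * U (norm s) * V (norm s) - 1) * U1 s + f * (U (norm s))\<^sup>2 * V1 s)
      - ct * (d1 (\<lambda>s. U (norm s)) s - 2 * fst s * d2 (d2 (\<lambda>s. U (norm s))) s)
      - (p * d1 (\<lambda>s. U (norm s)) s + q * d2 (\<lambda>s. U (norm s)) s)"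
    and lapV: "lap2 V1 s = - ((1 - 2 * U (norm s) * V (norm s)) * U1 s + - ((U (norm s))\<^sup>2) * V1 s)
      - ct * (d1 (\<lambda>s. V (norm s)) s - 2 * fst s * d2 (d2 (\<lambda>s. V (norm s))) s)
      - (0 * d1 (\<lambda>s. V (norm s)) s + 0 * d2 (\<lambda>s. V (norm s)) s)" for s
    using eq[of s]
    by (auto simp: vec_eq_iff forall_2 matrix_vector_mult_def sum_2 core_matrix_def algebra_simps)
  let ?e = "\<lambda>\<rho> \<omega>. (\<rho> * cos \<omega>, \<rho> * sin \<omega>) :: real \<times> real"
  define coeff where "coeff g \<rho> = harmonic_coeff a b (\<lambda>\<omega>. g (?e \<rho> \<omega>))" for g \<rho>
  define coeff' where "coeff' g \<rho> = harmonic_coeff a b (\<lambda>\<omega>. cos \<omega> * d1 g (?e \<rho> \<omega>) + sin \<omega> * d2 g (?e \<rho> \<omega>))"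
    for g \<rho>
  have derivs: "(coeff g has_real_derivative coeff' g \<rho>) (at \<rho>)"
    "0 < \<rho> \<Longrightarrow> (coeff' g has_real_derivative coeff g \<rho> / \<rho>\<^sup>2 - coeff' g \<rho> / \<rho>
      + harmonic_coeff a b (\<lambda>\<omega>. lap2 g (?e \<rho> \<omega>))) (at \<rho>)"
    "isCont (coeff' g) \<rho>" if "C2_fun g" for g \<rho>
    unfolding coeff_def[abs_def] coeff'_def[abs_def]
    by (fact harmonic_coeff_laplacian(1)[OF that], rule harmonic_coeff_laplacian(2)[OF that], assumption,
        fact harmonic_coeff_laplacian(3)[OF that])
  have coeff_0: "(coeff g \<longlongrightarrow> 0) (at_right 0)" "Bfun (coeff' g) (at_right 0)" if g: "C2_fun g" for g
  proof -
    have "isCont (coeff g) 0" using derivs(1)[OF g] by (rule DERIV_isCont)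
    \<comment> \<open>At radius 0 the averaged function is constant in the angle, so its first
      harmonic vanishes.\<close>
    moreover have "coeff g 0 = g 0 * harmonic_coeff a b (\<lambda>\<omega>. 1)"
      unfolding coeff_def harmonic_coeff_cmult[symmetric] by (simp add: zero_prod_def)
    ultimately show "(coeff g \<longlongrightarrow> 0) (at_right 0)"
      by (simp add: harmonic_coeff_moments isCont_def tendsto_within_subset[of _ _ _ UNIV])
    show "Bfun (coeff' g) (at_right 0)"
      by (rule one_sided_continuous_Bfun) (use derivs(3)[OF g, of 0] continuous_at_imp_continuous_within in blast)
  qed
  have U_top: "(coeff U1 \<longlongrightarrow> 0) at_top" "(coeff' U1 \<longlongrightarrow> 0) at_top"
  proof -
    have 0: "d1 (\<lambda>s. 0) s = 0" "d2 (\<lambda>s. 0) s = 0" for s by (simp_all add: d1_def d2_def)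
    have U: "(U1 \<longlongrightarrow> 0) at_infinity" "(d1 U1 \<longlongrightarrow> 0) at_infinity" "(d2 U1 \<longlongrightarrow> 0) at_infinity"
      using ff(1) unfolding far_field_agrees_def 0 by simp_all
    show "(coeff U1 \<longlongrightarrow> 0) at_top"
      using harmonic_coeff_at_infinity[OF U(1), of "\<lambda>_. 1" a b] unfolding coeff_def[abs_def] by simp
    have "continuous_on UNIV (d1 U1)" "continuous_on UNIV (d2 U1)"
      by (rule has_derivative_continuous_on, rule C2_fun_partials[OF C2(1)])+
    then have "coeff' U1 \<rho> = harmonic_coeff a b (\<lambda>\<omega>. cos \<omega> * d1 U1 (?e \<rho> \<omega>))
        + harmonic_coeff a b (\<lambda>\<omega>. sin \<omega> * d2 U1 (?e \<rho> \<omega>))" for \<rho>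
      unfolding coeff'_def by (intro harmonic_coeff_add continuous_intros continuous_on_polar)
    then have eq: "coeff' U1 = (\<lambda>\<rho>. harmonic_coeff a b (\<lambda>\<omega>. cos \<omega> * d1 U1 (?e \<rho> \<omega>))
        + harmonic_coeff a b (\<lambda>\<omega>. sin \<omega> * d2 U1 (?e \<rho> \<omega>)))" by (rule ext)
    have "((\<lambda>\<rho>. harmonic_coeff a b (\<lambda>\<omega>. cos \<omega> * d1 U1 (?e \<rho> \<omega>))
        + harmonic_coeff a b (\<lambda>\<omega>. sin \<omega> * d2 U1 (?e \<rho> \<omega>))) \<longlongrightarrow> 0 + 0) at_top"
      by (intro tendsto_add harmonic_coeff_at_infinity U) auto
    then show "(coeff' U1 \<longlongrightarrow> 0) at_top" unfolding eq by simp
  qed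
  \<comment> \<open>Radial solvability with \<open>k = a * ct / 2\<close> and
    \<open>m = a * p + b * q\<close>. The curvature term in the far field of \<open>V1\<close> adds
    \<open>a * S * ct / 8\<close>, and the corrector takes away the same amount.\<close>
  have "2 * (a * (S * ct / 2) / 4 + (a * \<alpha>1 + b * \<alpha>2) - a * ct / 2 * S / 4)
    = - (a * p + b * q) * set_lebesgue_integral lborel {0<..} (\<lambda>\<rho>. deriv U \<rho> * P1 \<rho> * \<rho>)"
  proof (rule radial_solvability[OF core adj derivs(1)[OF C2(1)] derivs(1)[OF C2(2)]])
    fix \<rho> :: real assume \<rho>: "0 < \<rho>"
    have "harmonic_coeff a b (\<lambda>\<omega>. lap2 U1 (?e \<rho> \<omega>)) =
      - ((2 * f * U \<rho> * V \<rho> - 1) * coeff U1 \<rho> + f * (U \<rho>)\<^sup>2 * coeff V1 \<rho>)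
      + (a * ct / 2 * \<rho> * (U \<rho> - f * (U \<rho>)\<^sup>2 * V \<rho>) - (a * p + b * q) * deriv U \<rho>)"
      unfolding coeff_def
      by (rule harmonic_coeff_inner_problem[where W = U and mu = "\<lambda>r. 2 * f * U r * V r - 1" and mv = "\<lambda>r. f * (U r)\<^sup>2",
            OF C2 core_solution_derivs(1)[OF core] core_solution_derivs(3)[OF core] lapU \<rho>])
    then show "(coeff' U1 has_real_derivative coeff U1 \<rho> / \<rho>\<^sup>2 - coeff' U1 \<rho> / \<rho>
        - ((2 * f * U \<rho> * V \<rho> - 1) * coeff U1 \<rho> + f * (U \<rho>)\<^sup>2 * coeff V1 \<rho>)
        + (a * ct / 2 * \<rho> * (U \<rho> - f * (U \<rho>)\<^sup>2 * V \<rho>) - (a * p + b * q) * deriv U \<rho>)) (at \<rho>)"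
      by (intro DERIV_cong[OF derivs(2)[OF C2(1) \<rho>]]) simp
    have "harmonic_coeff a b (\<lambda>\<omega>. lap2 V1 (?e \<rho> \<omega>)) =
      - ((1 - 2 * U \<rho> * V \<rho>) * coeff U1 \<rho> + - ((U \<rho>)\<^sup>2) * coeff V1 \<rho>)
      + (a * ct / 2 * \<rho> * ((U \<rho>)\<^sup>2 * V \<rho> - U \<rho>) - (a * 0 + b * 0) * deriv V \<rho>)"
      unfolding coeff_def
      by (rule harmonic_coeff_inner_problem[where W = V and mu = "\<lambda>r. 1 - 2 * U r * V r" and mv = "\<lambda>r. - ((U r)\<^sup>2)",
            OF C2 core_solution_derivs(2)[OF core] core_solution_derivs(4)[OF core] lapV \<rho>])
    then show "(coeff' V1 has_real_derivative coeff V1 \<rho> / \<rho>\<^sup>2 - coeff' V1 \<rho> / \<rho>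
        - ((1 - 2 * U \<rho> * V \<rho>) * coeff U1 \<rho> + (- (U \<rho>)\<^sup>2) * coeff V1 \<rho>)
        + a * ct / 2 * \<rho> * ((U \<rho>)\<^sup>2 * V \<rho> - U \<rho>)) (at \<rho>)"
      by (intro DERIV_cong[OF derivs(2)[OF C2(2) \<rho>]]) simp
  next
    show "((\<lambda>\<rho>. coeff V1 \<rho> / \<rho>) \<longlongrightarrow> a * (S * ct / 2) / 4 + (a * \<alpha>1 + b * \<alpha>2)) at_top"
      "(coeff' V1 \<longlongrightarrow> a * (S * ct / 2) / 4 + (a * \<alpha>1 + b * \<alpha>2)) at_top"
      unfolding coeff_def coeff'_def[abs_def] by (rule harmonic_coeff_far_field[OF C2(2) ff(2)])+
  qed (use U_top coeff_0 C2 int in auto)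
  then show ?thesis by (simp add: algebra_simps)
qed

section \<open>The outer solution near a spot\<close>

lemma lapS_const: "lapS (\<lambda>x. c) \<theta> \<phi> = 0"
  by (simp add: lapS_def)

lemma C2_fun_const: "C2_fun (\<lambda>x. c)"
  unfolding C2_fun_def by (intro exI[of _ "\<lambda>_. 0"]) (auto simp: zero_blinfun.rep_eq)

lemma sphere_integral_1: "sphere_integral (\<lambda>\<theta> \<phi>. 1) = 4 * pi"
proof -
  let ?A = "{0<..<pi}" and ?B = "{0<..<2*pi}"
  have "(LBINT \<theta>=ereal 0..ereal pi. sin \<theta>) = - cos pi - (- cos 0)"
    by (rule interval_integral_FTC_finite)
      (auto intro!: continuous_intros derivative_eq_intros
        simp flip: has_real_derivative_iff_has_vector_derivative)
  then have A: "(\<integral>\<theta>. indicator ?A \<theta> * sin \<theta> \<partial>lborel) = 2"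
    by (simp add: interval_lebesgue_integral_def set_lebesgue_integral_def)
  have B: "(\<integral>\<phi>. indicator ?B \<phi> \<partial>lborel) = 2 * pi" by simp
  \<comment> \<open>Fubini needs integrability on the open rectangle, which is inherited from
    continuity on the compact closed one.\<close>
  have "set_integrable lborel ({0..pi} \<times> {0..2*pi}) (\<lambda>p :: real \<times> real. sin (fst p))"
    unfolding set_integrable_def by (rule borel_integrable_compact) (auto intro!: compact_Times continuous_intros)
  then have "set_integrable lborel (?A \<times> ?B) (\<lambda>p :: real \<times> real. sin (fst p))"
    by (rule set_integrable_subset) (auto simp: borel_Times)
  moreover have "(\<lambda>p. indicator (?A \<times> ?B) p *\<^sub>R sin (fst p)) =
      (\<lambda>(\<theta>, \<phi>). (indicator ?A \<theta> * sin \<theta>) * (indicator ?B \<phi> :: real))"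
    by (auto simp: indicator_def)
  ultimately have prod: "integrable (lborel \<Otimes>\<^sub>M lborel) (\<lambda>(\<theta>, \<phi>). (indicator ?A \<theta> * sin \<theta>) * (indicator ?B \<phi> :: real))"
    by (simp add: set_integrable_def lborel_prod)
  have "sphere_integral (\<lambda>\<theta> \<phi>. 1)
      = (\<integral>p. (case p of (\<theta>, \<phi>) \<Rightarrow> (indicator ?A \<theta> * sin \<theta>) * indicator ?B \<phi>) \<partial>(lborel \<Otimes>\<^sub>M lborel))"
    unfolding sphere_integral_def set_lebesgue_integral_def lborel_prod
    by (intro Bochner_Integration.integral_cong) (auto simp: indicator_def)
  also have "\<dots> = (\<integral>\<theta>. (\<integral>\<phi>. (indicator ?A \<theta> * sin \<theta>) * indicator ?B \<phi> \<partial>lborel) \<partial>lborel)"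
    using lborel_pair.integral_fst'[OF prod] by simp
  also have "\<dots> = 4 * pi" using A B by simp
  finally show ?thesis .
qed

text \<open>Integration over the sphere means testing the distributional equation with the constant
  1: its Laplacian vanishes, and the area \<open>4 * pi\<close> balances the point sources.\<close>

lemma outer_expansion_total_strength:
  assumes "outer_expansion E \<tau> f \<epsilon>\<^sub>0 J Q" "\<epsilon> \<in> {0<..<\<epsilon>\<^sub>0}" "\<sigma> \<in> J"
  shows "(\<Sum>i\<in>UNIV. pat_S Q \<epsilon> i \<sigma>) = 2 * E"
proof -
  have "sphere_integral (\<lambda>\<theta> \<phi>. pat_outer_v Q \<epsilon> \<sigma> (sph \<theta> \<phi>) * lapS (\<lambda>x. 1) \<theta> \<phi>) =
             - E * sphere_integral (\<lambda>\<theta> \<phi>. 1) + 2 * pi * (\<Sum>i\<in>UNIV. pat_S Q \<epsilon> i \<sigma> * 1)"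
    using assms C2_fun_const[of "1::real"] unfolding outer_expansion_def by blast
  moreover have "sphere_integral (\<lambda>\<theta> \<phi>. 0) = 0"
    by (simp add: sphere_integral_def set_lebesgue_integral_def)
  ultimately have "2 * pi * (\<Sum>i\<in>UNIV. pat_S Q \<epsilon> i \<sigma>) = 2 * pi * (2 * E)"
    by (simp add: lapS_const sphere_integral_1)
  then show ?thesis by simp
qed

section \<open>Chordal distances and the logarithmic potential\<close>

lemma norm_sph_diff:
  "norm (sph \<theta> \<phi> - x) = sqrt ((cos \<phi> * sin \<theta> - x $ 1)\<^sup>2 + (sin \<phi> * sin \<theta> - x $ 2)\<^sup>2 + (cos \<theta> - x $ 3)\<^sup>2)"
  by (simp add: norm_eq_sqrt_inner inner_vec_def sum_3 sph_def power2_eq_square)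

text \<open>The law of cosines in a form where both angle differences enter through
  \<open>2 - 2 * cos\<close>, so that one estimate of this expression covers the two
  directions.\<close>

lemma norm_sph_sph_squared:
  "(norm (sph \<theta> \<phi> - sph \<theta>' \<phi>'))\<^sup>2 =
    (2 - 2 * cos (\<theta> - \<theta>')) + sin \<theta>' * sin \<theta> * (2 - 2 * cos (\<phi> - \<phi>'))"
proof -
  have "(norm (sph \<theta> \<phi> - sph \<theta>' \<phi>'))\<^sup>2 = (cos \<phi> * sin \<theta> - cos \<phi>' * sin \<theta>')\<^sup>2
      + (sin \<phi> * sin \<theta> - sin \<phi>' * sin \<theta>')\<^sup>2 + (cos \<theta> - cos \<theta>')\<^sup>2"
    unfolding norm_sph_diff by (simp add: sph_def)
  also have "\<dots> = (sin \<theta>)\<^sup>2 * ((cos \<phi>)\<^sup>2 + (sin \<phi>)\<^sup>2) + (sin \<theta>')\<^sup>2 * ((cos \<phi>')\<^sup>2 + (sin \<phi>')\<^sup>2)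
      + (cos \<theta>)\<^sup>2 + (cos \<theta>')\<^sup>2 - 2 * cos \<theta> * cos \<theta>'
      - 2 * sin \<theta> * sin \<theta>' * (cos \<phi> * cos \<phi>' + sin \<phi> * sin \<phi>')"
    by (simp only: power2_eq_square algebra_simps)
  also have "\<dots> = (2 - 2 * cos (\<theta> - \<theta>')) + sin \<theta>' * sin \<theta> * (2 - 2 * cos (\<phi> - \<phi>'))"
    by (simp add: cos_diff cos_squared_eq algebra_simps)
  finally show ?thesis .
qed

lemma ln_norm_sph_directional_derivative:
  assumes "sph \<theta> \<phi> \<noteq> x"
  shows "((\<lambda>t. ln (norm (sph (\<theta> + t * a) (\<phi> + t * b) - x))) has_real_derivative
      a * deriv (\<lambda>\<theta>. ln (norm (sph \<theta> \<phi> - x))) \<theta> + b * deriv (\<lambda>\<phi>. ln (norm (sph \<theta> \<phi> - x))) \<phi>) (at 0)"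
proof -
  define F where "F p = (cos (snd p) * sin (fst p) - x $ 1)\<^sup>2
    + (sin (snd p) * sin (fst p) - x $ 2)\<^sup>2 + (cos (fst p) - x $ 3)\<^sup>2" for p :: "real \<times> real"
  let ?L = "\<lambda>p. ln (norm (sph (fst p) (snd p) - x))"
  have "norm (sph \<theta> \<phi> - x) > 0" using assms by simp
  then have F: "F (\<theta>, \<phi>) > 0" unfolding norm_sph_diff F_def by simp
  have L: "?L = (\<lambda>p. ln (sqrt (F p)))" unfolding norm_sph_diff F_def ..
  \<comment> \<open>Only total differentiability matters; the value of the derivative is then read
    off from the partial derivatives.\<close>
  have "\<exists>F'. (F has_derivative F') (at (\<theta>, \<phi>))"
    unfolding F_def[abs_def] by (rule exI, (rule derivative_eq_intros refl)+)
  then obtain F' where F': "(F has_derivative F') (at (\<theta>, \<phi>))" by blast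
  have "\<exists>L'. (?L has_derivative L') (at (\<theta>, \<phi>))"
    unfolding L by (rule exI, (rule derivative_eq_intros F' refl | use F in simp)+)
  then obtain L' where "(?L has_derivative L') (at (\<theta>, \<phi>))" by blast
  from partials_of_has_derivative(3)[OF this]
  have "(?L has_derivative (\<lambda>h. fst h * d1 ?L (\<theta>, \<phi>) + snd h * d2 ?L (\<theta>, \<phi>))) (at (\<theta> + 0 * a, \<phi> + 0 * b))"
    by simp
  moreover have "((\<lambda>t. \<theta> + t * a) has_real_derivative a) (at 0)" "((\<lambda>t. \<phi> + t * b) has_real_derivative b) (at 0)"
    by (auto intro!: derivative_eq_intros)
  ultimately have "((\<lambda>t. ?L (\<theta> + t * a, \<phi> + t * b)) has_real_derivative a * d1 ?L (\<theta>, \<phi>) + b * d2 ?L (\<theta>, \<phi>)) (at 0)"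
    by (rule has_real_derivative_pair_compose)
  then show ?thesis by (simp add: d1_def d2_def)
qed

lemma chord_quotient:
  fixes a :: real
  shows "((\<lambda>\<eta>. ((2 - 2 * cos (\<eta> * a)) / \<eta>\<^sup>2 - a\<^sup>2) / \<eta>) \<longlongrightarrow> 0) (at_right 0)"
proof (rule Lim_null_comparison)
  show "\<forall>\<^sub>F \<eta> in at_right 0. norm (((2 - 2 * cos (\<eta> * a)) / \<eta>\<^sup>2 - a\<^sup>2) / \<eta>) \<le> a ^ 4 / 12 * \<eta>"
    using eventually_at_right_less[of 0]
  proof eventually_elim
    case (elim \<eta>)
    \<comment> \<open>Fourth order leaves an error of order \<eta> after the divisions. The phase in
      the remainder is a full period and drops out.\<close>
    obtain t where "cos (\<eta> * a) = (\<Sum>m<4. cos_coeff m * (\<eta> * a) ^ m) + cos (t + 1 / 2 * real 4 * pi) / fact 4 * (\<eta> * a) ^ 4"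
      using Maclaurin_cos_expansion[of "\<eta> * a" 4] by blast
    moreover have four: "(4::nat) = Suc (Suc (Suc (Suc 0)))" by simp
    have "(\<Sum>m<4. cos_coeff m * x ^ m) = 1 - x\<^sup>2 / 2" for x
      unfolding four sum.lessThan_Suc by (simp add: cos_coeff_def power2_eq_square)
    moreover have "cos (t + 1 / 2 * real 4 * pi) = cos t"
      using cos_periodic[of t] by (simp add: mult.commute)
    ultimately have "cos (\<eta> * a) = 1 - (\<eta> * a)\<^sup>2 / 2 + cos t / 24 * (\<eta> * a) ^ 4"
      by (simp add: fact_numeral)
    then have "((2 - 2 * cos (\<eta> * a)) / \<eta>\<^sup>2 - a\<^sup>2) / \<eta> = - cos t * (a ^ 4 / 12 * \<eta>)"
      using elim by (simp add: field_simps power2_eq_square numeral_eq_Suc)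
    moreover have "\<bar>cos t\<bar> * (a ^ 4 / 12 * \<eta>) \<le> 1 * (a ^ 4 / 12 * \<eta>)"
      using elim by (intro mult_right_mono) auto
    ultimately show ?case using elim by (simp add: abs_mult)
  qed
  have "((\<lambda>\<eta>. a ^ 4 / 12 * \<eta>) \<longlongrightarrow> a ^ 4 / 12 * 0) (at_right 0)" by (intro tendsto_intros)
  then show "((\<lambda>\<eta>. a ^ 4 / 12 * \<eta>) \<longlongrightarrow> 0) (at_right 0)" by simp
qed

text \<open>The chordal distance differs from \<open>\<eta> \<rho>\<close> at relative order \<open>\<eta>\<close>, because the inner
  coordinates are scaled with \<open>sin \<theta>\<^sub>j\<close> instead of \<open>sin \<theta>\<close>.\<close>

lemma ln_chord_expansion:
  assumes "sin \<theta> \<noteq> 0" and s: "(s1, s2) \<noteq> (0, 0)"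
  shows "((\<lambda>\<eta>. (ln (norm (sph (\<theta> + \<eta> * s1) (\<phi> + \<eta> * s2 / sin \<theta>) - sph \<theta> \<phi>)) - ln \<eta> - ln (norm (s1, s2))) / \<eta>)
    \<longlongrightarrow> cot \<theta> / 2 * (s1 * s2\<^sup>2 / (s1\<^sup>2 + s2\<^sup>2))) (at_right 0)"
proof -
  define b where "b = s2 / sin \<theta>"
  define A where "A \<eta> = (2 - 2 * cos (\<eta> * s1)) / \<eta>\<^sup>2" for \<eta>
  define C where "C \<eta> = (2 - 2 * cos (\<eta> * b)) / \<eta>\<^sup>2" for \<eta>
  define q where "q \<eta> = A \<eta> + sin \<theta> * sin (\<theta> + \<eta> * s1) * C \<eta>" for \<eta>
  define R where "R = s1\<^sup>2 + s2\<^sup>2"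
  \<comment> \<open>Filling in the limit value at 0 makes the difference quotient of
    \<open>q\<close> a one-sided derivative, to which the chain rule for \<open>ln\<close>
    applies.\<close>
  define Q where "Q \<eta> = (if \<eta> = 0 then R else q \<eta>)" for \<eta>
  have R: "0 < R" using s by (auto simp: R_def sum_power2_gt_zero_iff)
  have id: "((\<lambda>\<eta>::real. \<eta>) \<longlongrightarrow> 0) (at_right 0)" by (rule tendsto_ident_at)
  have A: "((\<lambda>\<eta>. (A \<eta> - s1\<^sup>2) / \<eta>) \<longlongrightarrow> 0) (at_right 0)" and C: "((\<lambda>\<eta>. (C \<eta> - b\<^sup>2) / \<eta>) \<longlongrightarrow> 0) (at_right 0)"
    unfolding A_def C_def by (rule chord_quotient)+
  have "((\<lambda>\<eta>. \<eta> * ((C \<eta> - b\<^sup>2) / \<eta>) + b\<^sup>2) \<longlongrightarrow> 0 * 0 + b\<^sup>2) (at_right 0)"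
    by (intro tendsto_intros id C)
  then have "((\<lambda>\<eta>. \<eta> * ((C \<eta> - b\<^sup>2) / \<eta>) + b\<^sup>2) \<longlongrightarrow> b\<^sup>2) (at_right 0)" by simp
  then have C0: "(C \<longlongrightarrow> b\<^sup>2) (at_right 0)"
    by (rule Lim_transform_eventually) (use eventually_at_right_less[of 0] in eventually_elim, simp)
  have "((\<lambda>\<eta>. sin (\<theta> + \<eta> * s1)) has_real_derivative s1 * cos \<theta>) (at 0)"
    by (auto intro!: derivative_eq_intros)
  then have sin': "((\<lambda>\<eta>. (sin (\<theta> + \<eta> * s1) - sin \<theta>) / \<eta>) \<longlongrightarrow> s1 * cos \<theta>) (at_right 0)"
    unfolding has_field_derivative_iff by (auto intro: tendsto_within_subset)
  \<comment> \<open>Of the three parts of \<open>(q \<eta> - R) / \<eta>\<close> only the middle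
    one, the variation of the sine of the polar angle, has a nonzero limit in general; it produces
    the cotangent.\<close>
  have lim0: "((\<lambda>\<eta>. (A \<eta> - s1\<^sup>2) / \<eta> + sin \<theta> * ((sin (\<theta> + \<eta> * s1) - sin \<theta>) / \<eta>) * C \<eta>
      + (sin \<theta>)\<^sup>2 * ((C \<eta> - b\<^sup>2) / \<eta>)) \<longlongrightarrow> 0 + sin \<theta> * (s1 * cos \<theta>) * b\<^sup>2 + (sin \<theta>)\<^sup>2 * 0) (at_right 0)"
    by (intro tendsto_intros A C C0 sin')
  have slope: "0 + sin \<theta> * (s1 * cos \<theta>) * b\<^sup>2 + (sin \<theta>)\<^sup>2 * 0 = cot \<theta> * (s1 * s2\<^sup>2)"
    using assms(1) by (simp add: b_def cot_def field_simps power2_eq_square)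
  have lim: "((\<lambda>\<eta>. (A \<eta> - s1\<^sup>2) / \<eta> + sin \<theta> * ((sin (\<theta> + \<eta> * s1) - sin \<theta>) / \<eta>) * C \<eta>
      + (sin \<theta>)\<^sup>2 * ((C \<eta> - b\<^sup>2) / \<eta>)) \<longlongrightarrow> cot \<theta> * (s1 * s2\<^sup>2)) (at_right 0)" using lim0 unfolding slope .
  have sb: "(sin \<theta>)\<^sup>2 * b\<^sup>2 = s2\<^sup>2" using assms(1) by (simp add: b_def power_divide)
  have "((\<lambda>\<eta>. (q \<eta> - R) / \<eta>) \<longlongrightarrow> cot \<theta> * (s1 * s2\<^sup>2)) (at_right 0)"
    by (rule Lim_transform_eventually[OF lim]) (use eventually_at_right_less[of 0] in eventually_elim,
        simp add: q_def R_def flip: sb, simp add: field_simps power2_eq_square)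
  then have "((\<lambda>\<eta>. (Q \<eta> - R) / \<eta>) \<longlongrightarrow> cot \<theta> * (s1 * s2\<^sup>2)) (at_right 0)"
    by (rule Lim_transform_eventually) (use eventually_at_right_less[of 0] in eventually_elim, simp add: Q_def)
  then have Q': "((\<lambda>\<eta>. Q \<eta>) has_real_derivative cot \<theta> * (s1 * s2\<^sup>2)) (at 0 within {0<..})"
    unfolding has_field_derivative_iff by (simp add: Q_def)
  have "(ln has_real_derivative 1 / R) (at (Q 0))"
    using R DERIV_ln_divide[of R] by (simp add: Q_def)
  from DERIV_chain2[OF this Q'] have "((\<lambda>\<eta>. ln (Q \<eta>)) has_real_derivative 1 / R * (cot \<theta> * (s1 * s2\<^sup>2))) (at 0 within {0<..})" .
  then have "((\<lambda>\<eta>. (ln (Q \<eta>) - ln R) / \<eta>) \<longlongrightarrow> 1 / R * (cot \<theta> * (s1 * s2\<^sup>2))) (at_right 0)"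
    unfolding has_field_derivative_iff by (simp add: Q_def)
  from tendsto_mult_left[OF this, of "1 / 2"]
  have "((\<lambda>\<eta>. 1 / 2 * ((ln (Q \<eta>) - ln R) / \<eta>)) \<longlongrightarrow> cot \<theta> / 2 * (s1 * s2\<^sup>2 / (s1\<^sup>2 + s2\<^sup>2))) (at_right 0)"
    by (simp add: R_def)
  moreover have "((\<lambda>\<eta>. Q \<eta>) \<longlongrightarrow> R) (at_right 0)"
    using DERIV_continuous[OF Q'] by (simp add: continuous_within Q_def)
  then have "\<forall>\<^sub>F \<eta> in at_right 0. 0 < Q \<eta>" using R by (rule order_tendstoD)
  then have "\<forall>\<^sub>F \<eta> in at_right 0. 1 / 2 * ((ln (Q \<eta>) - ln R) / \<eta>)
     = (ln (norm (sph (\<theta> + \<eta> * s1) (\<phi> + \<eta> * s2 / sin \<theta>) - sph \<theta> \<phi>)) - ln \<eta> - ln (norm (s1, s2))) / \<eta>"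
    using eventually_at_right_less[of 0]
  proof eventually_elim
    case (elim \<eta>)
    then have Q: "Q \<eta> = q \<eta>" by (simp add: Q_def)
    let ?n = "norm (sph (\<theta> + \<eta> * s1) (\<phi> + \<eta> * s2 / sin \<theta>) - sph \<theta> \<phi>)"
    have n: "?n\<^sup>2 = \<eta>\<^sup>2 * Q \<eta>"
      unfolding Q norm_sph_sph_squared q_def A_def C_def b_def using elim(2) by (simp add: field_simps)
    then have "0 < ?n\<^sup>2" using elim by simp
    then have "0 < ?n" by (metis less_le norm_ge_zero zero_less_power2)
    then have "2 * ln ?n = 2 * ln \<eta> + ln (Q \<eta>)"
      using arg_cong[OF n, of ln] elim by (simp add: ln_mult ln_realpow)
    moreover have "2 * ln (norm (s1, s2)) = ln R" using R by (simp add: norm_Pair ln_sqrt R_def)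
    ultimately show ?case using elim by (simp add: field_simps)
  qed
  ultimately show ?thesis by (rule Lim_transform_eventually)
qed

text \<open>The spot's own logarithm supplies \<open>ln \<eta>\<close>, \<open>ln (norm s)\<close>
  and the curvature term; the logarithms of the other spots are differentiable at its centre and
  supply \<open>C\<close> and the gradient coefficients.\<close>

lemma outer_log_expansion:
  fixes Q :: "'n::finite spot_pattern"
  assumes inj: "inj (\<lambda>j. pat_x Q \<epsilon> j \<sigma>)" and sin: "sin (pat_theta Q \<epsilon> j \<sigma>) \<noteq> 0" and s: "s \<noteq> 0"
  defines "C \<equiv> (\<Sum>i\<in>UNIV - {j}. pat_S Q \<epsilon> i \<sigma> * ln (norm (pat_x Q \<epsilon> j \<sigma> - pat_x Q \<epsilon> i \<sigma>))) + pat_c0 Q \<epsilon> \<sigma>"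
  shows "((\<lambda>\<eta>. (outer_log Q \<epsilon> \<sigma> \<eta> (local_point Q \<epsilon> j \<sigma> \<eta> s)
      - (pat_S Q \<epsilon> j \<sigma> * ln \<eta> + (pat_S Q \<epsilon> j \<sigma> * ln (norm s) + C))) / \<eta>) \<longlongrightarrow>
    outer_local (pat_S Q \<epsilon> j \<sigma> * cot (pat_theta Q \<epsilon> j \<sigma>) / 2) (alpha1 Q \<epsilon> j \<sigma>) (alpha2 Q \<epsilon> j \<sigma>)
      (pat_c1 Q \<epsilon> \<sigma>) s) (at_right 0)"
proof -
  define \<theta> where "\<theta> = pat_theta Q \<epsilon> j \<sigma>"
  define \<phi> where "\<phi> = pat_phi Q \<epsilon> j \<sigma>"
  define x where "x i = pat_x Q \<epsilon> i \<sigma>" for i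
  define S where "S i = pat_S Q \<epsilon> i \<sigma>" for i
  define D1 where "D1 i = deriv (\<lambda>\<theta>. ln (norm (sph \<theta> \<phi> - x i))) \<theta>" for i
  define D2 where "D2 i = deriv (\<lambda>\<phi>. ln (norm (sph \<theta> \<phi> - x i))) \<phi>" for i
  obtain s1 s2 where s12: "s = (s1, s2)" by fastforce
  define p where "p \<eta> = sph (\<theta> + \<eta> * s1) (\<phi> + \<eta> * s2 / sin \<theta>)" for \<eta>
  have xj: "x j = sph \<theta> \<phi>" by (simp add: x_def \<theta>_def \<phi>_def pat_x_def)
  have self: "((\<lambda>\<eta>. S j * ((ln (norm (p \<eta> - x j)) - ln \<eta> - ln (norm s)) / \<eta>))
      \<longlongrightarrow> S j * (cot \<theta> / 2 * (s1 * s2\<^sup>2 / (s1\<^sup>2 + s2\<^sup>2)))) (at_right 0)"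
    unfolding p_def xj s12 using s sin
    by (intro tendsto_mult_left ln_chord_expansion) (auto simp: \<theta>_def s12 zero_prod_def)
  have other: "((\<lambda>\<eta>. S i * ((ln (norm (p \<eta> - x i)) - ln (norm (x j - x i))) / \<eta>))
      \<longlongrightarrow> S i * (s1 * D1 i + s2 / sin \<theta> * D2 i)) (at_right 0)" if "i \<in> UNIV - {j}" for i
  proof -
    have "sph \<theta> \<phi> \<noteq> x i" using inj that xj by (auto simp: x_def inj_def)
    from ln_norm_sph_directional_derivative[OF this, of s1 "s2 / sin \<theta>"]
    have "((\<lambda>\<eta>. (ln (norm (p \<eta> - x i)) - ln (norm (x j - x i))) / \<eta>)
        \<longlongrightarrow> s1 * D1 i + s2 / sin \<theta> * D2 i) (at_right 0)"
      unfolding has_field_derivative_iff p_def D1_def D2_def xj by (auto intro: tendsto_within_subset)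
    then show ?thesis by (rule tendsto_mult_left)
  qed
  have "((\<lambda>\<eta>. S j * ((ln (norm (p \<eta> - x j)) - ln \<eta> - ln (norm s)) / \<eta>)
      + (\<Sum>i\<in>UNIV - {j}. S i * ((ln (norm (p \<eta> - x i)) - ln (norm (x j - x i))) / \<eta>)) + pat_c1 Q \<epsilon> \<sigma>)
      \<longlongrightarrow> S j * (cot \<theta> / 2 * (s1 * s2\<^sup>2 / (s1\<^sup>2 + s2\<^sup>2)))
        + (\<Sum>i\<in>UNIV - {j}. S i * (s1 * D1 i + s2 / sin \<theta> * D2 i)) + pat_c1 Q \<epsilon> \<sigma>) (at_right 0)"
    by (intro tendsto_add self tendsto_sum other tendsto_const)
  moreover have "S j * (cot \<theta> / 2 * (s1 * s2\<^sup>2 / (s1\<^sup>2 + s2\<^sup>2)))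
        + (\<Sum>i\<in>UNIV - {j}. S i * (s1 * D1 i + s2 / sin \<theta> * D2 i)) + pat_c1 Q \<epsilon> \<sigma>
      = outer_local (pat_S Q \<epsilon> j \<sigma> * cot (pat_theta Q \<epsilon> j \<sigma>) / 2) (alpha1 Q \<epsilon> j \<sigma>) (alpha2 Q \<epsilon> j \<sigma>)
      (pat_c1 Q \<epsilon> \<sigma>) s"
    unfolding outer_local_def alpha1_def alpha2_def s12 fst_conv snd_conv sum_distrib_right
      \<theta>_def[symmetric] \<phi>_def[symmetric] x_def[symmetric] S_def[symmetric] D1_def[symmetric] D2_def[symmetric]
    by (simp add: sum.distrib algebra_simps)
  ultimately have lim: "((\<lambda>\<eta>. S j * ((ln (norm (p \<eta> - x j)) - ln \<eta> - ln (norm s)) / \<eta>)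
      + (\<Sum>i\<in>UNIV - {j}. S i * ((ln (norm (p \<eta> - x i)) - ln (norm (x j - x i))) / \<eta>)) + pat_c1 Q \<epsilon> \<sigma>)
      \<longlongrightarrow> outer_local (pat_S Q \<epsilon> j \<sigma> * cot (pat_theta Q \<epsilon> j \<sigma>) / 2) (alpha1 Q \<epsilon> j \<sigma>) (alpha2 Q \<epsilon> j \<sigma>)
      (pat_c1 Q \<epsilon> \<sigma>) s) (at_right 0)" by (simp only:)
  show ?thesis
  proof (rule Lim_transform_eventually[OF lim])
    show "\<forall>\<^sub>F \<eta> in at_right 0. S j * ((ln (norm (p \<eta> - x j)) - ln \<eta> - ln (norm s)) / \<eta>)
      + (\<Sum>i\<in>UNIV - {j}. S i * ((ln (norm (p \<eta> - x i)) - ln (norm (x j - x i))) / \<eta>)) + pat_c1 Q \<epsilon> \<sigma>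
      = (outer_log Q \<epsilon> \<sigma> \<eta> (local_point Q \<epsilon> j \<sigma> \<eta> s)
      - (pat_S Q \<epsilon> j \<sigma> * ln \<eta> + (pat_S Q \<epsilon> j \<sigma> * ln (norm s) + C))) / \<eta>"
      using eventually_at_right_less[of 0]
    proof eventually_elim
      case (elim \<eta>)
      have "local_point Q \<epsilon> j \<sigma> \<eta> s = p \<eta>"
        by (simp add: local_point_def local_theta_def local_phi_def p_def \<theta>_def \<phi>_def s12)
      moreover have "(\<Sum>i\<in>UNIV. S i * ln (norm (p \<eta> - x i)))
          = S j * ln (norm (p \<eta> - x j)) + (\<Sum>i\<in>UNIV - {j}. S i * ln (norm (p \<eta> - x i)))"
        by (rule sum.remove) auto
      moreover have "(\<Sum>i\<in>UNIV - {j}. S i * ((ln (norm (p \<eta> - x i)) - ln (norm (x j - x i))) / \<eta>))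
          = ((\<Sum>i\<in>UNIV - {j}. S i * ln (norm (p \<eta> - x i))) - (\<Sum>i\<in>UNIV - {j}. S i * ln (norm (x j - x i)))) / \<eta>"
        by (simp add: sum_divide_distrib diff_divide_distrib right_diff_distrib flip: sum_subtractf)
      ultimately show ?case
        unfolding outer_log_def C_def x_def[symmetric] S_def[symmetric] using elim
        by (simp add: field_simps)
    qed
  qed
qed

section \<open>Matching\<close>

text \<open>\<open>L\<close> may diverge, as \<open>ln \<eta>\<close> does, because it is common to
  both expansions. This identifies the existentially quantified functions of the matching condition
  with the explicit expansion of the outer logarithms.\<close>

lemma two_term_expansion_unique:
  fixes F :: "real \<Rightarrow> real"
  assumes "((\<lambda>\<eta>. (F \<eta> - (L \<eta> + m)) / \<eta>) \<longlongrightarrow> l) (at_right 0)"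
    and "((\<lambda>\<eta>. (F \<eta> - (L \<eta> + m')) / \<eta>) \<longlongrightarrow> l') (at_right 0)"
  shows "m = m'" "l = l'"
proof -
  have "((\<lambda>\<eta>. \<eta> * ((F \<eta> - (L \<eta> + m')) / \<eta> - (F \<eta> - (L \<eta> + m)) / \<eta>)) \<longlongrightarrow> 0 * (l' - l)) (at_right 0)"
    by (intro tendsto_mult tendsto_diff assms tendsto_ident_at)
  then have "((\<lambda>\<eta>::real. m - m') \<longlongrightarrow> 0 * (l' - l)) (at_right 0)"
    by (rule Lim_transform_eventually) (use eventually_at_right_less[of 0] in eventually_elim, simp add: field_simps)
  then show m: "m = m'" by (simp add: tendsto_const_iff)
  show "l = l'" using tendsto_unique[OF _ assms(1)] assms(2) m by auto
qed

lemma matching_explicit: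
  fixes Q :: "'n::finite spot_pattern"
  assumes match: "matching \<epsilon>\<^sub>0 J K Q" and "\<epsilon> \<in> {0<..<\<epsilon>\<^sub>0}" "\<sigma> \<in> J"
    and geom: "inj (\<lambda>j. pat_x Q \<epsilon> j \<sigma>)" "sin (pat_theta Q \<epsilon> j \<sigma>) \<noteq> 0"
  defines "C \<equiv> (\<Sum>i\<in>UNIV - {j}. pat_S Q \<epsilon> i \<sigma> * ln (norm (pat_x Q \<epsilon> j \<sigma> - pat_x Q \<epsilon> i \<sigma>))) + pat_c0 Q \<epsilon> \<sigma>"
  shows "far_field_agrees (\<lambda>s. 1) (pat_V0 K Q \<epsilon> j \<sigma>)
      (\<lambda>s. pat_S Q \<epsilon> j \<sigma> * ln \<epsilon> + (pat_S Q \<epsilon> j \<sigma> * ln (norm s) + C))"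
    and "far_field_agrees norm (pat_V1 Q \<epsilon> j \<sigma>)
      (outer_local (pat_S Q \<epsilon> j \<sigma> * cot (pat_theta Q \<epsilon> j \<sigma>) / 2) (alpha1 Q \<epsilon> j \<sigma>) (alpha2 Q \<epsilon> j \<sigma>)
        (pat_c1 Q \<epsilon> \<sigma>))"
    and "far_field_agrees (\<lambda>s. 1) (pat_U1 Q \<epsilon> j \<sigma>) (\<lambda>s. 0)"
proof -
  obtain M0 M1 where M: "\<And>s. s \<noteq> 0 \<Longrightarrow>
           ((\<lambda>\<eta>. (outer_log Q \<epsilon> \<sigma> \<eta> (local_point Q \<epsilon> j \<sigma> \<eta> s)
                   - (pat_S Q \<epsilon> j \<sigma> * ln \<eta> + M0 s)) / \<eta>) \<longlongrightarrow> M1 s) (at_right 0)"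
    and V0: "far_field_agrees (\<lambda>s. 1) (pat_V0 K Q \<epsilon> j \<sigma>) (\<lambda>s. pat_S Q \<epsilon> j \<sigma> * ln \<epsilon> + M0 s)"
    and V1: "far_field_agrees norm (pat_V1 Q \<epsilon> j \<sigma>) M1"
    and U1: "far_field_agrees (\<lambda>s. 1) (pat_U1 Q \<epsilon> j \<sigma>) (\<lambda>s. 0)"
    using match assms(2,3) unfolding matching_def by blast
  note unique = two_term_expansion_unique[OF M outer_log_expansion[OF geom], folded C_def]
  show "far_field_agrees (\<lambda>s. 1) (pat_V0 K Q \<epsilon> j \<sigma>)
      (\<lambda>s. pat_S Q \<epsilon> j \<sigma> * ln \<epsilon> + (pat_S Q \<epsilon> j \<sigma> * ln (norm s) + C))"
    by (rule far_field_agrees_cong[OF V0]) (simp add: unique(1))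
  show "far_field_agrees norm (pat_V1 Q \<epsilon> j \<sigma>)
      (outer_local (pat_S Q \<epsilon> j \<sigma> * cot (pat_theta Q \<epsilon> j \<sigma>) / 2) (alpha1 Q \<epsilon> j \<sigma>) (alpha2 Q \<epsilon> j \<sigma>)
        (pat_c1 Q \<epsilon> \<sigma>))"
    by (rule far_field_agrees_cong[OF V1]) (rule unique(2))
  show "far_field_agrees (\<lambda>s. 1) (pat_U1 Q \<epsilon> j \<sigma>) (\<lambda>s. 0)" by (rule U1)
qed

text \<open>Along a ray to infinity the logarithms cancel and leave two limits for
  \<open>V \<rho> - S * ln \<rho>\<close>.\<close>

lemma core_constant_matching:
  assumes core: "core_solution f S U V c"
    and ff: "far_field_agrees (\<lambda>s. 1) (\<lambda>s. V (norm s)) (\<lambda>s. S * l + (S * ln (norm s) + C))"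
  shows "c = S * l + C"
proof -
  have ray: "filterlim (\<lambda>\<rho>::real. (\<rho>, 0::real)) at_infinity at_top"
    unfolding filterlim_at_infinity_conv_norm_at_top
    by (rule filterlim_at_top_mono[OF filterlim_ident]) (intro always_eventually allI, simp add: norm_Pair abs_ge_self)
  have outer: "((\<lambda>s. V (norm s) - (S * l + (S * ln (norm s) + C))) \<longlongrightarrow> 0) (at_infinity :: (real \<times> real) filter)"
    using ff unfolding far_field_agrees_def by simp
  from filterlim_compose[OF outer ray] have "((\<lambda>\<rho>. (V \<rho> - S * ln \<rho>) - (S * l + C)) \<longlongrightarrow> 0) at_top"
    by (rule Lim_transform_eventually)
      (use eventually_gt_at_top[of 0] in eventually_elim, simp add: norm_Pair)
  then have "((\<lambda>\<rho>. V \<rho> - S * ln \<rho>) \<longlongrightarrow> S * l + C) at_top" by (rule LIM_zero_cancel)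
  moreover have "((\<lambda>\<rho>. V \<rho> - S * ln \<rho>) \<longlongrightarrow> c) at_top"
    using core unfolding core_solution_def by blast
  ultimately show ?thesis by (metis tendsto_unique trivial_limit_at_top_linorder)
qed

section \<open>Elimination of the additive constant\<close>

lemma avg_matrix_deviation:
  fixes w :: "real^'n::finite"
  shows "((mat 1 - avg_matrix) *v w) $ i = w $ i - (\<Sum>j\<in>UNIV. w $ j) / real CARD('n)"
proof -
  have "(avg_matrix *v w) $ i = (\<Sum>j\<in>UNIV. w $ j) / real CARD('n)"
    by (simp add: matrix_vector_mult_def avg_matrix_def sum_divide_distrib)
  then show ?thesis by (simp add: matrix_vector_mult_diff_rdistrib)
qed

text \<open>The matching relations say that \<chi>(S) minus the Green matrix applied to
  \<open>S\<close> is \<open>l\<close> times \<open>S\<close> plus a constant vector. The projection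
  removes that vector and, by the total strength, subtracts the mean \<open>2 * E / N\<close> from
  \<open>S\<close>; dividing by \<open>l\<close> produces \<open>\<nu> = - 1 / l\<close>.\<close>

lemma strength_system_from_matching:
  fixes x :: "'n::finite \<Rightarrow> real^3" and S :: "real^'n"
  assumes total: "(\<Sum>i\<in>UNIV. S $ i) = 2 * E" and l: "l \<noteq> 0"
    and chi: "\<And>j. chi (S $ j) = S $ j * l + ((\<Sum>i\<in>UNIV - {j}. S $ i * ln (norm (x j - x i))) + c)"
  shows "strength_system E (- 1 / l) chi x S"
proof -
  let ?D = "mat 1 - avg_matrix :: real^'n^'n" and ?chi = "\<chi> i. chi (S $ i)"
  have "(green_matrix x *v S) $ j = (\<Sum>i\<in>UNIV - {j}. S $ i * ln (norm (x j - x i)))" for j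
    unfolding matrix_vector_mult_def green_matrix_def
    by (subst sum.remove[of _ j]) (auto intro!: sum.cong)
  then have "?chi - green_matrix x *v S = l *\<^sub>R S + (\<chi> i. c)"
    by (simp add: vec_eq_iff chi)
  then have "?D *v ?chi - ?D *v (green_matrix x *v S) = ?D *v (l *\<^sub>R S + (\<chi> i. c))"
    by (simp flip: matrix_vector_mult_diff_distrib)
  then have diff: "(?D *v ?chi) $ j - (?D *v (green_matrix x *v S)) $ j = l * (S $ j - 2 * E / real CARD('n))" for j
    unfolding vec_eq_iff vector_minus_component
    by (simp add: avg_matrix_deviation sum.distrib total field_simps flip: sum_distrib_left)
  have linear: "(mat 1 - (- 1 / l) *\<^sub>R (?D ** green_matrix x)) *v S = S - (- 1 / l) *\<^sub>R (?D *v (green_matrix x *v S))"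
    by (simp only: matrix_vector_mult_diff_rdistrib matrix_vector_mul_lid scaleR_matrix_vector_assoc
        matrix_vector_mul_assoc)
  show ?thesis
    unfolding strength_system_def linear vec_eq_iff using diff l
    by (simp add: field_simps)
qed

theorem mainTheorem1:
  fixes E \<tau> f \<epsilon>\<^sub>0 :: real
    and J :: "real set"
    and K :: core_branch
    and Q :: "'n::finite spot_pattern"
  assumes "0 < E" and "0 < \<tau>" and "0 < f" and "f < 1"
    and "0 < \<epsilon>\<^sub>0" and "\<epsilon>\<^sub>0 \<le> 1" and "open J"
    and "quasi_equilibrium_pattern E \<tau> f \<epsilon>\<^sub>0 J K Q"
    and "\<forall>\<epsilon>\<in>{0<..<\<epsilon>\<^sub>0}. \<forall>\<sigma>\<in>J. \<forall>j. core_A K (pat_S Q \<epsilon> j \<sigma>) \<noteq> 0"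
    and "\<forall>\<sigma>\<in>J. \<not> O1_instability E \<tau> f (\<lambda>\<epsilon>. pat_u Q \<epsilon> \<sigma>) (\<lambda>\<epsilon>. pat_v Q \<epsilon> \<sigma>)"
  shows "\<forall>\<epsilon>\<in>{0<..<\<epsilon>\<^sub>0}. \<forall>\<sigma>\<in>J.
    (\<forall>j. deriv (pat_theta Q \<epsilon> j) \<sigma> = - 2 / core_A K (pat_S Q \<epsilon> j \<sigma>) * alpha1 Q \<epsilon> j \<sigma> \<and>
         sin (pat_theta Q \<epsilon> j \<sigma>) * deriv (pat_phi Q \<epsilon> j) \<sigma> =
           - 2 / core_A K (pat_S Q \<epsilon> j \<sigma>) * alpha2 Q \<epsilon> j \<sigma>) \<and>
    strength_system E (- 1 / ln \<epsilon>) (core_chi K) (\<lambda>j. pat_x Q \<epsilon> j \<sigma>) (\<chi> j. pat_S Q \<epsilon> j \<sigma>)"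
proof (intro ballI conjI allI)
  fix \<epsilon> \<sigma> assume \<epsilon>: "\<epsilon> \<in> {0<..<\<epsilon>\<^sub>0}" and \<sigma>: "\<sigma> \<in> J"
  have geom: "pattern_geometry \<epsilon>\<^sub>0 J Q" and inner: "inner_expansion E \<tau> f \<epsilon>\<^sub>0 J K Q"
    and outer: "outer_expansion E \<tau> f \<epsilon>\<^sub>0 J Q" and match: "matching \<epsilon>\<^sub>0 J K Q"
    using assms(8) unfolding quasi_equilibrium_pattern_def by blast+
  have inj: "inj (\<lambda>j. pat_x Q \<epsilon> j \<sigma>)" and \<theta>: "pat_theta Q \<epsilon> j \<sigma> \<in> {0<..<pi}" for j
    using geom \<epsilon> \<sigma> unfolding pattern_geometry_def by blast+
  have sin: "sin (pat_theta Q \<epsilon> j \<sigma>) \<noteq> 0" for j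
    using sin_gt_zero[of "pat_theta Q \<epsilon> j \<sigma>"] \<theta>[of j] by simp
  note matched = matching_explicit[OF match \<epsilon> \<sigma> inj sin]
  have branch: "core_branch_at f K (pat_S Q \<epsilon> j \<sigma>)" for j
    using inner \<epsilon> \<sigma> unfolding inner_expansion_def by blast
  then have core: "core_solution f (pat_S Q \<epsilon> j \<sigma>) (core_U K (pat_S Q \<epsilon> j \<sigma>)) (core_V K (pat_S Q \<epsilon> j \<sigma>)) (core_chi K (pat_S Q \<epsilon> j \<sigma>))"
    and adj: "adjoint_solution f (core_U K (pat_S Q \<epsilon> j \<sigma>)) (core_V K (pat_S Q \<epsilon> j \<sigma>)) (core_P1 K (pat_S Q \<epsilon> j \<sigma>)) (core_P2 K (pat_S Q \<epsilon> j \<sigma>))" for j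
    unfolding core_branch_at_def by blast+
  \<comment> \<open>The choices (1, 0) and (0, 1) of \<open>(a, b)\<close> yield the two equations
    of motion.\<close>
  have solvability: "2 * (a * alpha1 Q \<epsilon> j \<sigma> + b * alpha2 Q \<epsilon> j \<sigma>) =
    - (a * deriv (pat_theta Q \<epsilon> j) \<sigma> + b * (deriv (pat_phi Q \<epsilon> j) \<sigma> * sin (pat_theta Q \<epsilon> j \<sigma>)))
      * core_A K (pat_S Q \<epsilon> j \<sigma>)" for a b j
    unfolding core_A_def
  proof (rule planar_solvability[OF core adj _ _ _ matched(3) matched(2)])
    show "C2_fun (pat_U1 Q \<epsilon> j \<sigma>)" "C2_fun (pat_V1 Q \<epsilon> j \<sigma>)"
      using inner \<epsilon> \<sigma> unfolding inner_expansion_def by blast+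
    show "set_integrable lborel {0<..} (\<lambda>\<rho>. deriv (core_U K (pat_S Q \<epsilon> j \<sigma>)) \<rho> * core_P1 K (pat_S Q \<epsilon> j \<sigma>) \<rho> * \<rho>)"
    \<comment> \<open>A non-integrable function has Lebesgue integral 0 by convention, so
      \<open>core_A\<close> being nonzero already forces integrability.\<close>
    proof (rule ccontr)
      assume "\<not> ?thesis"
      then have "core_A K (pat_S Q \<epsilon> j \<sigma>) = 0"
        unfolding core_A_def set_integrable_def set_lebesgue_integral_def by (rule not_integrable_integral_eq)
      then show False using assms(9) \<epsilon> \<sigma> by blast
    qed
    fix s
    show "(vector [lap2 (pat_U1 Q \<epsilon> j \<sigma>) s, lap2 (pat_V1 Q \<epsilon> j \<sigma>) s] :: real^2)
        + core_matrix f (core_U K (pat_S Q \<epsilon> j \<sigma>)) (core_V K (pat_S Q \<epsilon> j \<sigma>)) (norm s)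
          *v vector [pat_U1 Q \<epsilon> j \<sigma> s, pat_V1 Q \<epsilon> j \<sigma> s] =
        - cot (pat_theta Q \<epsilon> j \<sigma>) *\<^sub>R vector [d1 (\<lambda>s. core_U K (pat_S Q \<epsilon> j \<sigma>) (norm s)) s
              - 2 * fst s * d2 (d2 (\<lambda>s. core_U K (pat_S Q \<epsilon> j \<sigma>) (norm s))) s,
            d1 (\<lambda>s. core_V K (pat_S Q \<epsilon> j \<sigma>) (norm s)) s
              - 2 * fst s * d2 (d2 (\<lambda>s. core_V K (pat_S Q \<epsilon> j \<sigma>) (norm s))) s]
        - vector [deriv (pat_theta Q \<epsilon> j) \<sigma> * d1 (\<lambda>s. core_U K (pat_S Q \<epsilon> j \<sigma>) (norm s)) s
            + deriv (pat_phi Q \<epsilon> j) \<sigma> * sin (pat_theta Q \<epsilon> j \<sigma>)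
              * d2 (\<lambda>s. core_U K (pat_S Q \<epsilon> j \<sigma>) (norm s)) s, 0]"
      using inner \<epsilon> \<sigma> unfolding inner_expansion_def pat_U0_def[abs_def] pat_V0_def[abs_def] Let_def by blast
  qed
  show "deriv (pat_theta Q \<epsilon> j) \<sigma> = - 2 / core_A K (pat_S Q \<epsilon> j \<sigma>) * alpha1 Q \<epsilon> j \<sigma>"
    and "sin (pat_theta Q \<epsilon> j \<sigma>) * deriv (pat_phi Q \<epsilon> j) \<sigma> =
           - 2 / core_A K (pat_S Q \<epsilon> j \<sigma>) * alpha2 Q \<epsilon> j \<sigma>" for j
    using solvability[of 1 j 0] solvability[of 0 j 1] assms(9) \<epsilon> \<sigma> by (simp_all add: field_simps)
  show "strength_system E (- 1 / ln \<epsilon>) (core_chi K) (\<lambda>j. pat_x Q \<epsilon> j \<sigma>) (\<chi> j. pat_S Q \<epsilon> j \<sigma>)"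
  proof (rule strength_system_from_matching)
    show "(\<Sum>i\<in>UNIV. (\<chi> j. pat_S Q \<epsilon> j \<sigma>) $ i) = 2 * E"
      using outer_expansion_total_strength[OF outer \<epsilon> \<sigma>] by simp
    show "ln \<epsilon> \<noteq> 0" using \<epsilon> assms(6) by simp
    show "core_chi K ((\<chi> j. pat_S Q \<epsilon> j \<sigma>) $ j) = (\<chi> j. pat_S Q \<epsilon> j \<sigma>) $ j * ln \<epsilon>
      + ((\<Sum>i\<in>UNIV - {j}. (\<chi> j. pat_S Q \<epsilon> j \<sigma>) $ i * ln (norm (pat_x Q \<epsilon> j \<sigma> - pat_x Q \<epsilon> i \<sigma>)))
        + pat_c0 Q \<epsilon> \<sigma>)" for j
      using core_constant_matching[OF core, of j "ln \<epsilon>"] matched(1)[of j]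
      by (simp add: pat_V0_def[abs_def])
  qed
qed

end
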